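(* Let $k$ be a field of characteristic zero, let $Q$ be a finite connected quiver, and let $A=kQ/\langle Z\rangle$ be a finite-dimensional monomial algebra. Then $$\dim_k HH_1(A) = |Q_1\odot B| - |Q_0\odot B| + |Q_0| - e + s,$$ where $e$ is the number of efficient circuits and $s$ is the number of non trivial strong circuits.
   Context: Quiver: vertices $Q_0$, arrows $Q_1$, source and terminal maps $s,t:Q_1\to Q_0$. A path of length $l\ge 1$ is a sequence $a_l\cdots a_1$ of arrows with $t(a_i)=s(a_{i+1})$; its source is $s(a_1)$, its terminal vertex is $t(a_l)$. Vertices are the (trivial) paths of length $0$. A cycle is a path whose source and terminal vertex coincide. The product in $kQ$ is concatenation. $Z$ is a set of paths of length at least two, minimal for the subpath order (no strict subpath of an element of $Z$ is in $Z$), and $A=kQ/\langle Z\rangle$. $B$ is the set of paths (including vertices) containing no path of $Z$ as a subpath; it is identified with a $k$-basis of $A$. $HH_1(A)=H_1(A,A)$ is the first Hochschild homology group $\mathrm{Tor}_1(A,A)$ over $A$-$A$-bimodules. For sets of paths $X,Y$: $X\odot Y=\{(\alpha,\beta)\in X\times Y: t(\beta)=s(\alpha),\ t(\alpha)=s(\beta)\}$. A circuit is an equivalence class of cycles under the equivalence relation generated by rotation $a_n\cdots a_1\sim a_1a_n\cdots a_2$ ($a_i$ arrows); it is trivial if it corresponds to a vertex. For a circuit $C$, $(X\odot Y)_C=\{(\alpha,\beta)\in X\odot Y:\alpha\beta\in C\}$. A circuit $C$ is useful if $(Q_1\odot B)_C\ne\emptyset$; strong if every cycle of $C$ belongs to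 $B$; efficient if it is useful, not strong, and $(Z\odot B)_C\neq\emptyset$. *)

theory Defs
  imports "HOL-Algebra.QuotRing" "Jordan_Normal_Form.VS_Connect" "Graph_Theory.Graph_Theory"
begin

hide_const (open) Multiset.mult Polynomial.smult Modules.module

section \<open>Quivers and paths\<close>

text \<open>
  A quiver is a directed multigraph (loops allowed) in the sense of \<^locale>\<open>wf_digraph\<close>, with source
  map \<^const>\<open>tail\<close> and terminal map \<^const>\<open>head\<close>. A path is encoded by its source together with the list
  of its arrows \<^emph>\<open>in the order of traversal\<close>: the path written $a_l\cdots a_1$ is
  \<open>(tail Q a\<^sub>1, [a\<^sub>1, \<dots>, a\<^sub>l])\<close>, and the vertex \<open>v\<close> is \<open>(v, [])\<close>.
\<close>

type_synonym ('v, 'a) path = "'v \<times> 'a list"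

definition paths :: "('v, 'a) pre_digraph \<Rightarrow> ('v, 'a) path set" where
  "paths Q = {(u, p). \<exists>v. pre_digraph.awalk Q u p v}"

definition psource :: "('v, 'a) path \<Rightarrow> 'v" where
  "psource \<alpha> = fst \<alpha>"

definition ptarget :: "('v, 'a) pre_digraph \<Rightarrow> ('v, 'a) path \<Rightarrow> 'v" where
  "ptarget Q \<alpha> = pre_digraph.awlast Q (fst \<alpha>) (snd \<alpha>)"

text \<open>The concatenation \<open>\<alpha>\<beta>\<close> (first \<open>\<beta>\<close>, then \<open>\<alpha>\<close>), meaningful if \<open>ptarget Q \<beta> = psource \<alpha>\<close>.\<close>

definition pcomp :: "('v, 'a) path \<Rightarrow> ('v, 'a) path \<Rightarrow> ('v, 'a) path" where
  "pcomp \<alpha> \<beta> = (fst \<beta>, snd \<beta> @ snd \<alpha>)"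

definition vertex_paths :: "('v, 'a) pre_digraph \<Rightarrow> ('v, 'a) path set" where
  "vertex_paths Q = {(v, []) | v. v \<in> verts Q}"

definition arrow_paths :: "('v, 'a) pre_digraph \<Rightarrow> ('v, 'a) path set" where
  "arrow_paths Q = {(tail Q a, [a]) | a. a \<in> arcs Q}"

definition subpath :: "('v, 'a) pre_digraph \<Rightarrow> ('v, 'a) path \<Rightarrow> ('v, 'a) path \<Rightarrow> bool" where
  "subpath Q \<alpha> \<gamma> \<longleftrightarrow> (\<exists>\<delta> \<in> paths Q. \<exists>\<epsilon> \<in> paths Q.
     ptarget Q \<epsilon> = psource \<alpha> \<and> ptarget Q \<alpha> = psource \<delta> \<and> \<gamma> = pcomp \<delta> (pcomp \<alpha> \<epsilon>))"

definition monomial_relations :: "('v, 'a) pre_digraph \<Rightarrow> ('v, 'a) path set \<Rightarrow> bool" where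
  "monomial_relations Q Z \<longleftrightarrow> Z \<subseteq> paths Q \<and> (\<forall>\<zeta> \<in> Z. 2 \<le> length (snd \<zeta>)) \<and>
     (\<forall>\<zeta> \<in> Z. \<forall>\<zeta>' \<in> Z. subpath Q \<zeta> \<zeta>' \<longrightarrow> \<zeta> = \<zeta>')"

definition basis_paths :: "('v, 'a) pre_digraph \<Rightarrow> ('v, 'a) path set \<Rightarrow> ('v, 'a) path set" where
  "basis_paths Q Z = {\<beta> \<in> paths Q. \<forall>\<zeta> \<in> Z. \<not> subpath Q \<zeta> \<beta>}"

section \<open>Circuits\<close>

definition odot ::
  "('v, 'a) pre_digraph \<Rightarrow> ('v, 'a) path set \<Rightarrow> ('v, 'a) path set \<Rightarrow> (('v, 'a) path \<times> ('v, 'a) path) set"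
where
  "odot Q X Y = {(\<alpha>, \<beta>) \<in> X \<times> Y. ptarget Q \<beta> = psource \<alpha> \<and> ptarget Q \<alpha> = psource \<beta>}"

definition odot_at ::
  "('v, 'a) pre_digraph \<Rightarrow> ('v, 'a) path set \<Rightarrow> ('v, 'a) path set \<Rightarrow> ('v, 'a) path set
     \<Rightarrow> (('v, 'a) path \<times> ('v, 'a) path) set"
where
  "odot_at Q X Y C = {(\<alpha>, \<beta>) \<in> odot Q X Y. pcomp \<alpha> \<beta> \<in> C}"

definition cycles :: "('v, 'a) pre_digraph \<Rightarrow> ('v, 'a) path set" where
  "cycles Q = {\<gamma> \<in> paths Q. psource \<gamma> = ptarget Q \<gamma>}"

text \<open>Moving the first traversed arrow to the end: $a_n\cdots a_1 \mapsto a_1 a_n\cdots a_2$.\<close>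

definition rotation :: "('v, 'a) pre_digraph \<Rightarrow> ('v, 'a) path rel" where
  "rotation Q = {((u, a # p), (head Q a, p @ [a])) | u a p. (u, a # p) \<in> cycles Q}"

definition circuits :: "('v, 'a) pre_digraph \<Rightarrow> ('v, 'a) path set set" where
  "circuits Q = cycles Q // Restr ((rotation Q \<union> (rotation Q)\<inverse>)\<^sup>*) (cycles Q)"

definition trivial_circuit :: "('v, 'a) pre_digraph \<Rightarrow> ('v, 'a) path set \<Rightarrow> bool" where
  "trivial_circuit Q C \<longleftrightarrow> (\<exists>v \<in> verts Q. C = {(v, [])})"

definition useful :: "('v, 'a) pre_digraph \<Rightarrow> ('v, 'a) path set \<Rightarrow> ('v, 'a) path set \<Rightarrow> bool" where
  "useful Q Z C \<longleftrightarrow> odot_at Q (arrow_paths Q) (basis_paths Q Z) C \<noteq> {}"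

definition strong :: "('v, 'a) pre_digraph \<Rightarrow> ('v, 'a) path set \<Rightarrow> ('v, 'a) path set \<Rightarrow> bool" where
  "strong Q Z C \<longleftrightarrow> C \<subseteq> basis_paths Q Z"

definition efficient :: "('v, 'a) pre_digraph \<Rightarrow> ('v, 'a) path set \<Rightarrow> ('v, 'a) path set \<Rightarrow> bool" where
  "efficient Q Z C \<longleftrightarrow> useful Q Z C \<and> \<not> strong Q Z C \<and> odot_at Q Z (basis_paths Q Z) C \<noteq> {}"

section \<open>Vector spaces by generators and relations\<close>

text \<open>
  The ground field is a type \<open>'k\<close>, seen as a field record through \<^const>\<open>class_ring\<close>. A vector space is a
  \<^typ>\<open>('k, 'm) module\<close> record. Its fields \<open>mult\<close> and \<open>one\<close> are irrelevant unless the record stands for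
  an algebra.
\<close>

definition free_space :: "'x set \<Rightarrow> ('k::field, 'x \<Rightarrow> 'k) module" where
  "free_space X = \<lparr>carrier = {f. finite {x. f x \<noteq> 0} \<and> {x. f x \<noteq> 0} \<subseteq> X},
     mult = undefined, one = undefined,
     zero = (\<lambda>x. 0), add = (\<lambda>f g x. f x + g x), smult = (\<lambda>c f x. c * f x)\<rparr>"

definition single :: "'x \<Rightarrow> 'x \<Rightarrow> 'k::field" where
  "single x = (\<lambda>y. if y = x then 1 else 0)"

definition linear_extension :: "('k::field, 'm, 'e) module_scheme \<Rightarrow> ('x \<Rightarrow> 'm) \<Rightarrow> ('x \<Rightarrow> 'k) \<Rightarrow> 'm" where
  "linear_extension W f v = (\<Oplus>\<^bsub>W\<^esub> x \<in> {x. v x \<noteq> 0}. v x \<odot>\<^bsub>W\<^esub> f x)"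

text \<open>
  Quotient of a vector space by a subspace, or of an algebra by a two-sided ideal: the ring record
  \<^const>\<open>FactRing\<close> of cosets, supplied with the induced scalar multiplication.
\<close>

definition quotient :: "('k::field, 'm, 'e) module_scheme \<Rightarrow> 'm set \<Rightarrow> ('k, 'm set) module" where
  "quotient V U = ring.extend (V Quot U)
     (module.fields (\<lambda>c X. \<Union>x \<in> X. U +>\<^bsub>V\<^esub> (c \<odot>\<^bsub>V\<^esub> x)))"

definition presented :: "'x set \<Rightarrow> ('x \<Rightarrow> 'k::field) set \<Rightarrow> ('k, ('x \<Rightarrow> 'k) set) module" where
  "presented X R = quotient (free_space X) (LinearCombinations.module.span class_ring (free_space X) R)"

definition generator :: "'x set \<Rightarrow> ('x \<Rightarrow> 'k::field) set \<Rightarrow> 'x \<Rightarrow> ('x \<Rightarrow> 'k) set" where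
  "generator X R x =
     LinearCombinations.module.span class_ring (free_space X) R +>\<^bsub>free_space X\<^esub> single x"

text \<open>
  The linear map from a presented space to \<open>W\<close> that sends the generator of \<open>x\<close> to \<open>f x\<close>, provided that
  \<open>f\<close> respects the relations: a coset is sent to the common image of its elements.
\<close>

definition presented_map ::
  "('k::field, 'm, 'e) module_scheme \<Rightarrow> ('x \<Rightarrow> 'm) \<Rightarrow> ('x \<Rightarrow> 'k) set \<Rightarrow> 'm" where
  "presented_map W f Y = the_elem (linear_extension W f ` Y)"

section \<open>Tensor products of bimodules and the bar resolution\<close>

record ('k, 'r, 'm) bimodule = "('k, 'm) module" +
  lact :: "'r \<Rightarrow> 'm \<Rightarrow> 'm"
  ract :: "'m \<Rightarrow> 'r \<Rightarrow> 'm"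

definition regular_bimodule :: "('k::field, 'r) module \<Rightarrow> ('k, 'r, 'r) bimodule" where
  "regular_bimodule A = module.extend A (bimodule.fields (monoid.mult A) (monoid.mult A))"

text \<open>
  \<open>N \<otimes> P\<close> over the enveloping algebra of \<open>A\<close>: the tensor product over \<open>k\<close> modulo
  \<open>na \<otimes> p = n \<otimes> ap\<close> and \<open>an \<otimes> p = n \<otimes> pa\<close>.
\<close>

definition bitensor_relations ::
  "('k::field, 'r) module \<Rightarrow> ('k, 'r, 'n) bimodule \<Rightarrow> ('k, 'r, 'p) bimodule \<Rightarrow> ('n \<times> 'p \<Rightarrow> 'k) set" where
  "bitensor_relations A N P = (let F = free_space (carrier N \<times> carrier P) in
     {single (x \<oplus>\<^bsub>N\<^esub> x', y) \<ominus>\<^bsub>F\<^esub> (single (x, y) \<oplus>\<^bsub>F\<^esub> single (x', y))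
        | x x' y. x \<in> carrier N \<and> x' \<in> carrier N \<and> y \<in> carrier P}
   \<union> {single (x, y \<oplus>\<^bsub>P\<^esub> y') \<ominus>\<^bsub>F\<^esub> (single (x, y) \<oplus>\<^bsub>F\<^esub> single (x, y'))
        | x y y'. x \<in> carrier N \<and> y \<in> carrier P \<and> y' \<in> carrier P}
   \<union> {single (c \<odot>\<^bsub>N\<^esub> x, y) \<ominus>\<^bsub>F\<^esub> (c \<odot>\<^bsub>F\<^esub> single (x, y))
        | c x y. x \<in> carrier N \<and> y \<in> carrier P}
   \<union> {single (x, c \<odot>\<^bsub>P\<^esub> y) \<ominus>\<^bsub>F\<^esub> (c \<odot>\<^bsub>F\<^esub> single (x, y))
        | c x y. x \<in> carrier N \<and> y \<in> carrier P}
   \<union> {single (ract N x a, y) \<ominus>\<^bsub>F\<^esub> single (x, lact P a y)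
        | a x y. a \<in> carrier A \<and> x \<in> carrier N \<and> y \<in> carrier P}
   \<union> {single (lact N a x, y) \<ominus>\<^bsub>F\<^esub> single (x, ract P y a)
        | a x y. a \<in> carrier A \<and> x \<in> carrier N \<and> y \<in> carrier P})"

definition bitensor ::
  "('k::field, 'r) module \<Rightarrow> ('k, 'r, 'n) bimodule \<Rightarrow> ('k, 'r, 'p) bimodule
     \<Rightarrow> ('k, ('n \<times> 'p \<Rightarrow> 'k) set) module" where
  "bitensor A N P = presented (carrier N \<times> carrier P) (bitensor_relations A N P)"

text \<open>For a bimodule map \<open>d\<close> with target \<open>P'\<close>, the map \<open>id \<otimes> d\<close> with values in \<open>N \<otimes> P'\<close>.\<close>

definition bitensor_map ::
  "('k::field, 'r) module \<Rightarrow> ('k, 'r, 'n) bimodule \<Rightarrow> ('k, 'r, 'p') bimodule \<Rightarrow> ('p \<Rightarrow> 'p')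
     \<Rightarrow> ('n \<times> 'p \<Rightarrow> 'k) set \<Rightarrow> ('n \<times> 'p' \<Rightarrow> 'k) set" where
  "bitensor_map A N P' d = presented_map (bitensor A N P')
     (\<lambda>(x, y). generator (carrier N \<times> carrier P') (bitensor_relations A N P') (x, d y))"

text \<open>Tensor powers over \<open>k\<close>; the list \<open>[a\<^sub>1, \<dots>, a\<^sub>n]\<close> stands for the pure tensor of its entries.\<close>

definition tuples :: "('k::field, 'r) module \<Rightarrow> nat \<Rightarrow> 'r list set" where
  "tuples A n = {xs. length xs = n \<and> set xs \<subseteq> carrier A}"

definition multilinear_relations :: "('k::field, 'r) module \<Rightarrow> nat \<Rightarrow> ('r list \<Rightarrow> 'k) set" where
  "multilinear_relations A n = (let F = free_space (tuples A n) in
     {single (xs[i := x \<oplus>\<^bsub>A\<^esub> y]) \<ominus>\<^bsub>F\<^esub> (single (xs[i := x]) \<oplus>\<^bsub>F\<^esub> single (xs[i := y]))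
        | xs i x y. xs \<in> tuples A n \<and> i < n \<and> x \<in> carrier A \<and> y \<in> carrier A}
   \<union> {single (xs[i := c \<odot>\<^bsub>A\<^esub> x]) \<ominus>\<^bsub>F\<^esub> (c \<odot>\<^bsub>F\<^esub> single (xs[i := x]))
        | xs i c x. xs \<in> tuples A n \<and> i < n \<and> x \<in> carrier A})"

definition tensor_power :: "('k::field, 'r) module \<Rightarrow> nat \<Rightarrow> ('k, ('r list \<Rightarrow> 'k) set) module" where
  "tensor_power A n = presented (tuples A n) (multilinear_relations A n)"

definition pure_tensor :: "('k::field, 'r) module \<Rightarrow> 'r list \<Rightarrow> ('r list \<Rightarrow> 'k) set" where
  "pure_tensor A xs = generator (tuples A (length xs)) (multilinear_relations A (length xs)) xs"

text \<open>
  The bar resolution of \<open>A\<close> by free \<open>A\<close>-\<open>A\<close>-bimodules: in degree \<open>n\<close> the tensor power with \<open>n + 2\<close>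
  factors, \<open>A\<close> acting on the outer two, with differential
  $a_0\otimes\cdots\otimes a_{n+1} \mapsto \sum_{i=0}^{n} (-1)^i\, a_0\otimes\cdots\otimes a_i a_{i+1}\otimes\cdots\otimes a_{n+1}$
  (for \<open>n = 0\<close> this is the augmentation onto \<open>A\<close>).
\<close>

definition bar_bimodule :: "('k::field, 'r) module \<Rightarrow> nat \<Rightarrow> ('k, 'r, ('r list \<Rightarrow> 'k) set) bimodule" where
  "bar_bimodule A n = module.extend (tensor_power A (n + 2)) (bimodule.fields
     (\<lambda>a. presented_map (tensor_power A (n + 2)) (\<lambda>xs. pure_tensor A ((a \<otimes>\<^bsub>A\<^esub> hd xs) # tl xs)))
     (\<lambda>t a. presented_map (tensor_power A (n + 2))
        (\<lambda>xs. pure_tensor A (butlast xs @ [last xs \<otimes>\<^bsub>A\<^esub> a])) t))"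

definition bar_differential ::
  "('k::field, 'r) module \<Rightarrow> nat \<Rightarrow> ('r list \<Rightarrow> 'k) set \<Rightarrow> ('r list \<Rightarrow> 'k) set" where
  "bar_differential A n = presented_map (tensor_power A (n + 1))
     (\<lambda>xs. \<Oplus>\<^bsub>tensor_power A (n + 1)\<^esub> i \<in> {..n}. (-1) ^ i \<odot>\<^bsub>tensor_power A (n + 1)\<^esub>
        pure_tensor A (take i xs @ [xs ! i \<otimes>\<^bsub>A\<^esub> xs ! (i + 1)] @ drop (i + 2) xs))"

section \<open>First Hochschild homology\<close>

definition homology_space ::
  "('k::field, 'l, 'e1) module_scheme \<Rightarrow> ('k, 'm) module \<Rightarrow> ('k, 'n, 'e2) module_scheme
     \<Rightarrow> ('l \<Rightarrow> 'm) \<Rightarrow> ('m \<Rightarrow> 'n) \<Rightarrow> ('k, 'm set) module" where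
  "homology_space C\<^sub>2 C\<^sub>1 C\<^sub>0 d\<^sub>2 d\<^sub>1 =
     quotient (C\<^sub>1\<lparr>carrier := {x \<in> carrier C\<^sub>1. d\<^sub>1 x = \<zero>\<^bsub>C\<^sub>0\<^esub>}\<rparr>) (d\<^sub>2 ` carrier C\<^sub>2)"

text \<open>
  \<open>H\<^sub>1(A, N)\<close>, that is \<open>Tor\<^sub>1(N, A)\<close> over \<open>A\<close>-\<open>A\<close>-bimodules, computed from the bar resolution of \<open>A\<close>.
\<close>

definition hochschild_H1 ::
  "('k::field, 'r) module \<Rightarrow> ('k, 'r, 'n) bimodule
     \<Rightarrow> ('k, ('n \<times> ('r list \<Rightarrow> 'k) set \<Rightarrow> 'k) set set) module" where
  "hochschild_H1 A N = homology_space
     (bitensor A N (bar_bimodule A 2)) (bitensor A N (bar_bimodule A 1)) (bitensor A N (bar_bimodule A 0))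
     (bitensor_map A N (bar_bimodule A 1) (bar_differential A 2))
     (bitensor_map A N (bar_bimodule A 0) (bar_differential A 1))"

definition HH1 ::
  "('k::field, 'r) module \<Rightarrow> ('k, ('r \<times> ('r list \<Rightarrow> 'k) set \<Rightarrow> 'k) set set) module" where
  "HH1 A = hochschild_H1 A (regular_bimodule A)"

section \<open>Monomial algebras\<close>

definition path_algebra :: "('v, 'a) pre_digraph \<Rightarrow> ('k::field, ('v, 'a) path \<Rightarrow> 'k) module" where
  "path_algebra Q = (free_space (paths Q))
     \<lparr>mult := (\<lambda>f g \<gamma>. \<Sum>(\<alpha>, \<beta>) \<in> {(\<alpha>, \<beta>) \<in> paths Q \<times> paths Q.
          ptarget Q \<beta> = psource \<alpha> \<and> pcomp \<alpha> \<beta> = \<gamma>}. f \<alpha> * g \<beta>),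
      one := (\<lambda>\<gamma>. if \<gamma> \<in> vertex_paths Q then 1 else 0)\<rparr>"

definition monomial_algebra ::
  "('v, 'a) pre_digraph \<Rightarrow> ('v, 'a) path set \<Rightarrow> ('k::field, (('v, 'a) path \<Rightarrow> 'k) set) module" where
  "monomial_algebra Q Z = quotient (path_algebra Q) (Idl\<^bsub>path_algebra Q\<^esub> (single ` Z))"

end

theory Submission
  imports Defs
begin

text \<open>
  Write \<open>x da\<close> for the class of \<open>x \<otimes> a\<close> in the cokernel of the second Hochschild boundary, so that
  \<open>x d(ab) = (xa) db + (bx) da\<close>, and \<open>HH\<^sub>1(A)\<close> is the kernel of \<open>x da \<mapsto> xa - ax\<close>. In the monomial case the
  Leibniz rule reduces every class to the \<open>\<beta> da\<close> with \<open>(a, \<beta>) \<in> Q\<^sub>1 \<odot> B\<close>, up to classes \<open>\<beta> de\<close> with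
  \<open>\<beta>\<close> a basis path that is not a cycle and \<open>e\<close> a vertex, which the commutator map sends injectively to
  the non-cycles. The relations between the \<open>\<beta> da\<close> come from \<open>\<beta> d\<zeta> = 0\<close> for \<open>\<zeta> \<in> Z\<close>. An arrow of the
  cyclic word \<open>\<beta>\<zeta>\<close> outside \<open>\<zeta>\<close> has a complement containing \<open>\<zeta>\<close>, so the expansion of \<open>\<beta> d\<zeta>\<close> is a sum over
  all arrows of the cyclic word, which is a positive multiple of the sum of \<open>(Q\<^sub>1 \<odot> B)\<^sub>C\<close>. Hence there is
  exactly one relation for each efficient circuit \<open>C\<close>. The commutator map sends \<open>\<beta> da\<close> to the difference of two
  consecutive rotations of a cycle, where non-basis cycles count as zero. Its image has codimension one
  on each strong circuit and is everything on the other circuits.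
\<close>

section \<open>Vector spaces as records\<close>

text \<open>The delicate half is to show that the relations found among the \<beta> da are all of
  them: this takes a map out of \<open>Om\<close> that reads off coefficients. It rests on an
  encoding. The pair (a, \<beta>) becomes the cyclic word \<open>a # \<beta>\<close>, and \<beta>
  d\<gamma> expands to the sum over the first |\<gamma>| rotations of the word
  \<open>\<gamma> @ \<beta>\<close>, so that the Leibniz rule is the splitting of a range of
  summation. The expansion vanishes when \<beta> is zero in the algebra, but not always when
  \<gamma> is; the defect lies in the span of the indicator functions of efficient circuits, so the
  map is well defined modulo that span. The multiple in the relation of a circuit is the number of
  rotations that fix the word, since a proper power meets each of its pairs several times. The forms
  \<beta> de are not removed from the bar complex beforehand; they drop out at the end because arrow
  forms have commutators supported on cycles. Trivial circuits are strong, which is how the number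
  of vertices enters the formula.\<close>

abbreviation kspace :: "('k::field, 'm, 'e) module_scheme \<Rightarrow> bool" where
  "kspace V \<equiv> vectorspace class_ring V"

lemma kspace_module: "kspace V \<Longrightarrow> module class_ring V"
  by (simp add: vectorspace_def)

lemma kspace_abelian_group: "kspace V \<Longrightarrow> abelian_group V"
  by (rule module.axioms(2)[OF kspace_module])

text \<open>Additive inverses come from the scalar \<open>- 1\<close>, which turns the existence
  axiom of the additive group into an equation like the others.\<close>

lemma kspaceI:
  fixes V :: "('k::field, 'm, 'e) module_scheme"
  assumes "\<zero>\<^bsub>V\<^esub> \<in> carrier V"
    and "\<And>x y. x \<in> carrier V \<Longrightarrow> y \<in> carrier V \<Longrightarrow> x \<oplus>\<^bsub>V\<^esub> y \<in> carrier V"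
    and "\<And>c x. x \<in> carrier V \<Longrightarrow> c \<odot>\<^bsub>V\<^esub> x \<in> carrier V"
    and "\<And>x y. x \<in> carrier V \<Longrightarrow> y \<in> carrier V \<Longrightarrow> x \<oplus>\<^bsub>V\<^esub> y = y \<oplus>\<^bsub>V\<^esub> x"
    and "\<And>x y z. x \<in> carrier V \<Longrightarrow> y \<in> carrier V \<Longrightarrow> z \<in> carrier V \<Longrightarrow>
           (x \<oplus>\<^bsub>V\<^esub> y) \<oplus>\<^bsub>V\<^esub> z = x \<oplus>\<^bsub>V\<^esub> (y \<oplus>\<^bsub>V\<^esub> z)"
    and "\<And>x. x \<in> carrier V \<Longrightarrow> x \<oplus>\<^bsub>V\<^esub> \<zero>\<^bsub>V\<^esub> = x"
    and "\<And>x. x \<in> carrier V \<Longrightarrow> x \<oplus>\<^bsub>V\<^esub> ((- 1) \<odot>\<^bsub>V\<^esub> x) = \<zero>\<^bsub>V\<^esub>"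
    and "\<And>x. x \<in> carrier V \<Longrightarrow> 1 \<odot>\<^bsub>V\<^esub> x = x"
    and "\<And>a b x. x \<in> carrier V \<Longrightarrow> (a * b) \<odot>\<^bsub>V\<^esub> x = a \<odot>\<^bsub>V\<^esub> (b \<odot>\<^bsub>V\<^esub> x)"
    and "\<And>a b x. x \<in> carrier V \<Longrightarrow> (a + b) \<odot>\<^bsub>V\<^esub> x = a \<odot>\<^bsub>V\<^esub> x \<oplus>\<^bsub>V\<^esub> b \<odot>\<^bsub>V\<^esub> x"
    and "\<And>a x y. x \<in> carrier V \<Longrightarrow> y \<in> carrier V \<Longrightarrow>
           a \<odot>\<^bsub>V\<^esub> (x \<oplus>\<^bsub>V\<^esub> y) = a \<odot>\<^bsub>V\<^esub> x \<oplus>\<^bsub>V\<^esub> a \<odot>\<^bsub>V\<^esub> y"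
  shows "kspace V"
proof -
  have "\<exists>y \<in> carrier V. x \<oplus>\<^bsub>V\<^esub> y = \<zero>\<^bsub>V\<^esub>" if "x \<in> carrier V" for x
    using assms(3,7)[OF that] by blast
  then have "module class_ring V"
    by (intro module_criteria) (use assms(1-6,8-) in \<open>auto intro: class_cring.is_cring\<close>)
  then show ?thesis by (simp add: vectorspace_def class_field)
qed

context
  fixes V :: "('k::field, 'm, 'e) module_scheme"
  assumes V: "kspace V"
begin

interpretation V: vectorspace class_ring V by (rule V)

lemma kspace_zero [simp]: "\<zero>\<^bsub>V\<^esub> \<in> carrier V" by simp

lemma kspace_add [simp]: "x \<in> carrier V \<Longrightarrow> y \<in> carrier V \<Longrightarrow> x \<oplus>\<^bsub>V\<^esub> y \<in> carrier V" by simp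

lemma kspace_smult [simp]: "x \<in> carrier V \<Longrightarrow> c \<odot>\<^bsub>V\<^esub> x \<in> carrier V"
  by (simp add: V.smult_closed)

lemma kspace_minus [simp]: "x \<in> carrier V \<Longrightarrow> y \<in> carrier V \<Longrightarrow> x \<ominus>\<^bsub>V\<^esub> y \<in> carrier V" by simp

lemma kspace_assoc:
  "x \<in> carrier V \<Longrightarrow> y \<in> carrier V \<Longrightarrow> z \<in> carrier V \<Longrightarrow>
     (x \<oplus>\<^bsub>V\<^esub> y) \<oplus>\<^bsub>V\<^esub> z = x \<oplus>\<^bsub>V\<^esub> (y \<oplus>\<^bsub>V\<^esub> z)"
  by (rule V.a_assoc)

lemma kspace_comm: "x \<in> carrier V \<Longrightarrow> y \<in> carrier V \<Longrightarrow> x \<oplus>\<^bsub>V\<^esub> y = y \<oplus>\<^bsub>V\<^esub> x"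
  by (rule V.a_comm)

lemma kspace_add_zero [simp]:
  "x \<in> carrier V \<Longrightarrow> x \<oplus>\<^bsub>V\<^esub> \<zero>\<^bsub>V\<^esub> = x" "x \<in> carrier V \<Longrightarrow> \<zero>\<^bsub>V\<^esub> \<oplus>\<^bsub>V\<^esub> x = x"
  by simp_all

lemma kspace_smult_zero [simp]:
  "x \<in> carrier V \<Longrightarrow> 0 \<odot>\<^bsub>V\<^esub> x = \<zero>\<^bsub>V\<^esub>" "c \<odot>\<^bsub>V\<^esub> \<zero>\<^bsub>V\<^esub> = \<zero>\<^bsub>V\<^esub>"
  using V.smult_l_null[of x] V.smult_r_null[of c] by simp_all

lemma kspace_smult_one [simp]: "x \<in> carrier V \<Longrightarrow> 1 \<odot>\<^bsub>V\<^esub> x = x"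
  using V.smult_one[of x] by simp

lemma kspace_smult_smult: "x \<in> carrier V \<Longrightarrow> a \<odot>\<^bsub>V\<^esub> (b \<odot>\<^bsub>V\<^esub> x) = (a * b) \<odot>\<^bsub>V\<^esub> x"
  using V.smult_assoc1[of a b x] by simp

lemma kspace_add_smult: "x \<in> carrier V \<Longrightarrow> (a + b) \<odot>\<^bsub>V\<^esub> x = a \<odot>\<^bsub>V\<^esub> x \<oplus>\<^bsub>V\<^esub> b \<odot>\<^bsub>V\<^esub> x"
  using V.smult_l_distr[of a b x] by simp

lemma kspace_smult_add:
  "x \<in> carrier V \<Longrightarrow> y \<in> carrier V \<Longrightarrow> a \<odot>\<^bsub>V\<^esub> (x \<oplus>\<^bsub>V\<^esub> y) = a \<odot>\<^bsub>V\<^esub> x \<oplus>\<^bsub>V\<^esub> a \<odot>\<^bsub>V\<^esub> y"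
  using V.smult_r_distr[of a x y] by simp

lemma kspace_minus_eq: "x \<in> carrier V \<Longrightarrow> y \<in> carrier V \<Longrightarrow> x \<ominus>\<^bsub>V\<^esub> y = x \<oplus>\<^bsub>V\<^esub> ((- 1) \<odot>\<^bsub>V\<^esub> y)"
  using V.smult_minus_1[of y] V.minus_eq[of x y] by (simp add: class_ring_simps)

lemma kspace_minus_self [simp]: "x \<in> carrier V \<Longrightarrow> x \<ominus>\<^bsub>V\<^esub> x = \<zero>\<^bsub>V\<^esub>"
  by (simp add: V.minus_eq V.r_neg)

lemma kspace_minus_iff:
  "x \<in> carrier V \<Longrightarrow> y \<in> carrier V \<Longrightarrow> z \<in> carrier V \<Longrightarrow> x \<ominus>\<^bsub>V\<^esub> y = z \<longleftrightarrow> x = y \<oplus>\<^bsub>V\<^esub> z"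
  by (metis V.add.inv_closed V.add.inv_solve_left' V.add.m_comm V.minus_eq)

lemma kspace_minus_eq_zero_iff:
  "x \<in> carrier V \<Longrightarrow> y \<in> carrier V \<Longrightarrow> x \<ominus>\<^bsub>V\<^esub> y = \<zero>\<^bsub>V\<^esub> \<longleftrightarrow> x = y"
  using kspace_minus_iff[of x y "\<zero>\<^bsub>V\<^esub>"] by simp

lemma kspace_add_eq_self:
  "x \<in> carrier V \<Longrightarrow> y \<in> carrier V \<Longrightarrow> x \<oplus>\<^bsub>V\<^esub> y = x \<longleftrightarrow> y = \<zero>\<^bsub>V\<^esub>"
  using V.add.l_cancel_one by simp

end

section \<open>Linear maps between vector space records\<close>

definition lin ::
  "('k::field, 'm, 'e) module_scheme \<Rightarrow> ('k, 'n, 'd) module_scheme \<Rightarrow> ('m \<Rightarrow> 'n) \<Rightarrow> bool" where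
  "lin V W f \<longleftrightarrow> (\<forall>x \<in> carrier V. f x \<in> carrier W) \<and>
     (\<forall>x \<in> carrier V. \<forall>y \<in> carrier V. f (x \<oplus>\<^bsub>V\<^esub> y) = f x \<oplus>\<^bsub>W\<^esub> f y) \<and>
     (\<forall>c. \<forall>x \<in> carrier V. f (c \<odot>\<^bsub>V\<^esub> x) = c \<odot>\<^bsub>W\<^esub> f x)"

lemma linI:
  assumes "\<And>x. x \<in> carrier V \<Longrightarrow> f x \<in> carrier W"
    and "\<And>x y. x \<in> carrier V \<Longrightarrow> y \<in> carrier V \<Longrightarrow> f (x \<oplus>\<^bsub>V\<^esub> y) = f x \<oplus>\<^bsub>W\<^esub> f y"
    and "\<And>c x. x \<in> carrier V \<Longrightarrow> f (c \<odot>\<^bsub>V\<^esub> x) = c \<odot>\<^bsub>W\<^esub> f x"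
  shows "lin V W f"
  using assms unfolding lin_def by blast

lemma lin_closed: "lin V W f \<Longrightarrow> x \<in> carrier V \<Longrightarrow> f x \<in> carrier W"
  and lin_add: "lin V W f \<Longrightarrow> x \<in> carrier V \<Longrightarrow> y \<in> carrier V \<Longrightarrow> f (x \<oplus>\<^bsub>V\<^esub> y) = f x \<oplus>\<^bsub>W\<^esub> f y"
  and lin_smult: "lin V W f \<Longrightarrow> x \<in> carrier V \<Longrightarrow> f (c \<odot>\<^bsub>V\<^esub> x) = c \<odot>\<^bsub>W\<^esub> f x"
  unfolding lin_def by blast+

lemma lin_zero: "lin V W f \<Longrightarrow> kspace V \<Longrightarrow> kspace W \<Longrightarrow> f \<zero>\<^bsub>V\<^esub> = \<zero>\<^bsub>W\<^esub>"
  by (metis kspace_smult_zero(1) kspace_zero lin_closed lin_smult)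

lemma lin_minus:
  "lin V W f \<Longrightarrow> kspace V \<Longrightarrow> kspace W \<Longrightarrow> x \<in> carrier V \<Longrightarrow> y \<in> carrier V \<Longrightarrow>
     f (x \<ominus>\<^bsub>V\<^esub> y) = f x \<ominus>\<^bsub>W\<^esub> f y"
  by (simp add: kspace_minus_eq lin_add lin_smult lin_closed)

lemma lin_comp: "lin V W f \<Longrightarrow> lin W U g \<Longrightarrow> lin V U (\<lambda>x. g (f x))"
  unfolding lin_def by simp

lemma lin_cong: "(\<And>x. x \<in> carrier V \<Longrightarrow> f x = g x) \<Longrightarrow> kspace V \<Longrightarrow> lin V W f \<longleftrightarrow> lin V W g"
  unfolding lin_def by simp

lemma lin_linear_map:
  assumes "kspace V" "kspace W" "lin V W f"
  shows "linear_map class_ring V W f"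
  using assms unfolding linear_map_def mod_hom_def mod_hom_axioms_def LinearCombinations.module_hom_def lin_def
  by (auto simp: kspace_module)

subsection \<open>Subspaces and quotients\<close>

definition is_subspace :: "('k::field, 'm, 'e) module_scheme \<Rightarrow> 'm set \<Rightarrow> bool" where
  "is_subspace V U \<longleftrightarrow> U \<subseteq> carrier V \<and> \<zero>\<^bsub>V\<^esub> \<in> U \<and>
     (\<forall>x \<in> U. \<forall>y \<in> U. x \<oplus>\<^bsub>V\<^esub> y \<in> U) \<and> (\<forall>c. \<forall>x \<in> U. c \<odot>\<^bsub>V\<^esub> x \<in> U)"

lemma is_subspaceI:
  assumes "\<And>x. x \<in> U \<Longrightarrow> x \<in> carrier V" and "\<zero>\<^bsub>V\<^esub> \<in> U"
    and "\<And>x y. x \<in> U \<Longrightarrow> y \<in> U \<Longrightarrow> x \<oplus>\<^bsub>V\<^esub> y \<in> U" and "\<And>c x. x \<in> U \<Longrightarrow> c \<odot>\<^bsub>V\<^esub> x \<in> U"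
  shows "is_subspace V U"
  using assms unfolding is_subspace_def by blast

lemma is_subspace_carrier: "is_subspace V U \<Longrightarrow> x \<in> U \<Longrightarrow> x \<in> carrier V"
  and is_subspace_zero: "is_subspace V U \<Longrightarrow> \<zero>\<^bsub>V\<^esub> \<in> U"
  and is_subspace_add: "is_subspace V U \<Longrightarrow> x \<in> U \<Longrightarrow> y \<in> U \<Longrightarrow> x \<oplus>\<^bsub>V\<^esub> y \<in> U"
  and is_subspace_smult: "is_subspace V U \<Longrightarrow> x \<in> U \<Longrightarrow> c \<odot>\<^bsub>V\<^esub> x \<in> U"
  unfolding is_subspace_def by blast+

lemma is_subspace_minus:
  "kspace V \<Longrightarrow> is_subspace V U \<Longrightarrow> x \<in> U \<Longrightarrow> y \<in> U \<Longrightarrow> x \<ominus>\<^bsub>V\<^esub> y \<in> U"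
  by (simp add: kspace_minus_eq is_subspace_carrier is_subspace_add is_subspace_smult)

lemma kspace_restrict:
  assumes "kspace V" "is_subspace V U"
  shows "kspace (V\<lparr>carrier := U\<rparr>)"
proof -
  note U = is_subspace_carrier[OF assms(2)] is_subspace_zero[OF assms(2)]
    is_subspace_add[OF assms(2)] is_subspace_smult[OF assms(2)]
  have neg: "x \<oplus>\<^bsub>V\<^esub> ((- 1) \<odot>\<^bsub>V\<^esub> x) = \<zero>\<^bsub>V\<^esub>" if "x \<in> carrier V" for x
    using that assms(1) kspace_minus_eq kspace_minus_self by metis
  show ?thesis
    by (rule kspaceI) (use assms(1) U in
        \<open>simp_all add: kspace_assoc kspace_smult_smult kspace_add_smult kspace_smult_add neg, auto intro: kspace_comm\<close>)
qed

lemma is_subspace_ker: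
  assumes "kspace V" "kspace W" "lin V W f"
  shows "is_subspace V {x \<in> carrier V. f x = \<zero>\<^bsub>W\<^esub>}"
  by (rule is_subspaceI) (use assms in \<open>auto simp: lin_zero lin_add lin_smult\<close>)

lemma is_subspace_im:
  assumes "kspace V" "kspace W" "lin V W f"
  shows "is_subspace W (f ` carrier V)"
proof (rule is_subspaceI)
  show "\<zero>\<^bsub>W\<^esub> \<in> f ` carrier V" using assms lin_zero[symmetric, OF assms(3)] by auto
qed (use assms in \<open>auto simp: lin_closed lin_add[symmetric] lin_smult[symmetric]\<close>)

lemma is_subspace_span:
  assumes "kspace V" "R \<subseteq> carrier V"
  shows "is_subspace V (LinearCombinations.module.span class_ring V R)"
proof -
  interpret V: vectorspace class_ring V by (rule assms)
  interpret subspace class_ring "V.span R" V by (rule V.span_is_subspace) (rule assms)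
  interpret submodule class_ring "V.span R" V by (rule submod)
  show ?thesis by (rule is_subspaceI) (use subset in auto)
qed

lemma span_induct:
  assumes "kspace V" "R \<subseteq> carrier V" "R \<subseteq> U" "is_subspace V U"
    and "x \<in> LinearCombinations.module.span class_ring V R"
  shows "x \<in> U"
proof -
  interpret V: vectorspace class_ring V by (rule assms)
  have "submodule class_ring U V"
    using assms(4) unfolding is_subspace_def by unfold_locales auto
  then show ?thesis using V.span_is_subset[of R U] assms(3,5) by auto
qed

lemma span_superset:
  assumes "kspace V" "R \<subseteq> carrier V" "x \<in> R"
  shows "x \<in> LinearCombinations.module.span class_ring V R"
proof -
  interpret V: vectorspace class_ring V by (rule assms)
  show ?thesis using V.in_own_span[of R] assms by auto
qed

context
  fixes V :: "('k::field, 'm, 'e) module_scheme" and U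
  assumes V: "kspace V" and U: "is_subspace V U"
begin

interpretation V: vectorspace class_ring V by (rule V)

lemma subspace_abelian_subgroup: "abelian_subgroup U V"
proof -
  have "\<ominus>\<^bsub>V\<^esub> x \<in> U" if "x \<in> U" for x
    using V.smult_minus_1[of x] is_subspace_smult[OF U that, of "-1"] is_subspace_carrier[OF U that]
    by (simp add: class_ring_simps)
  then have "additive_subgroup U V"
    by (intro additive_subgroup.intro subgroup.intro)
      (use U in \<open>auto simp: is_subspace_def a_inv_def\<close>)
  then show ?thesis by (rule abelian_subgroupI3) (rule V.abelian_group_axioms)
qed

interpretation U: abelian_subgroup U V by (rule subspace_abelian_subgroup)

lemma coset_eq_iff:
  assumes "x \<in> carrier V" "y \<in> carrier V"
  shows "U +>\<^bsub>V\<^esub> x = U +>\<^bsub>V\<^esub> y \<longleftrightarrow> x \<ominus>\<^bsub>V\<^esub> y \<in> U"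
proof -
  have "U +>\<^bsub>V\<^esub> x = U +>\<^bsub>V\<^esub> y \<longleftrightarrow> x \<in> U +>\<^bsub>V\<^esub> y"
    using U.a_rcos_self[OF assms(1)] U.a_repr_independence'[OF _ assms(2), of x] by auto
  then show ?thesis using U.a_rcos_module[OF assms(2,1)] by (simp add: V.minus_eq)
qed

lemma coset_zero: "U +>\<^bsub>V\<^esub> \<zero>\<^bsub>V\<^esub> = U"
  using V.a_coset_add_zero U.a_subset by blast

lemma coset_eq_zero_iff: "x \<in> carrier V \<Longrightarrow> U +>\<^bsub>V\<^esub> x = U \<longleftrightarrow> x \<in> U"
  using coset_eq_iff[of x "\<zero>\<^bsub>V\<^esub>"] V kspace_minus_iff[OF V, of x "\<zero>\<^bsub>V\<^esub>" x]
  by (simp add: coset_zero)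

lemma mem_coset_iff:
  assumes "x \<in> carrier V" "y \<in> carrier V"
  shows "x \<in> U +>\<^bsub>V\<^esub> y \<longleftrightarrow> x \<ominus>\<^bsub>V\<^esub> y \<in> U"
  using coset_eq_iff[OF assms] U.a_rcos_self[OF assms(1)] U.a_repr_independence'[OF _ assms(2), of x] by auto

lemma coset_subset: "x \<in> carrier V \<Longrightarrow> U +>\<^bsub>V\<^esub> x \<subseteq> carrier V"
  by (simp add: V.a_r_coset_subset_G U.a_subset)


lemma quotient_carrier: "carrier (quotient V U) = (\<lambda>x. U +>\<^bsub>V\<^esub> x) ` carrier V"
  by (auto simp: quotient_def ring.defs module.defs FactRing_def A_RCOSETS_def')

lemma quotient_zero: "\<zero>\<^bsub>quotient V U\<^esub> = U"
  by (simp add: quotient_def ring.defs module.defs FactRing_def)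

lemma quotient_add:
  "x \<in> carrier V \<Longrightarrow> y \<in> carrier V \<Longrightarrow>
     (U +>\<^bsub>V\<^esub> x) \<oplus>\<^bsub>quotient V U\<^esub> (U +>\<^bsub>V\<^esub> y) = U +>\<^bsub>V\<^esub> (x \<oplus>\<^bsub>V\<^esub> y)"
  by (simp add: quotient_def ring.defs module.defs FactRing_def U.a_rcos_sum)

text \<open>The record defines scalar multiplication as a union over all representatives; the union
  is one coset because the difference of two representatives stays in \<open>U\<close> after
  scaling.\<close>

lemma quotient_smult:
  assumes x: "x \<in> carrier V"
  shows "c \<odot>\<^bsub>quotient V U\<^esub> (U +>\<^bsub>V\<^esub> x) = U +>\<^bsub>V\<^esub> (c \<odot>\<^bsub>V\<^esub> x)"
proof -
  have "U +>\<^bsub>V\<^esub> (c \<odot>\<^bsub>V\<^esub> y) = U +>\<^bsub>V\<^esub> (c \<odot>\<^bsub>V\<^esub> x)" if y: "y \<in> U +>\<^bsub>V\<^esub> x" for y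
  proof -
    have yV: "y \<in> carrier V" using coset_subset[OF x] y by blast
    have "c \<odot>\<^bsub>V\<^esub> (y \<ominus>\<^bsub>V\<^esub> x) \<in> U"
      using y x yV by (intro is_subspace_smult[OF U]) (simp add: mem_coset_iff)
    moreover have "c \<odot>\<^bsub>V\<^esub> (y \<ominus>\<^bsub>V\<^esub> x) = c \<odot>\<^bsub>V\<^esub> y \<ominus>\<^bsub>V\<^esub> c \<odot>\<^bsub>V\<^esub> x"
      using V x yV by (simp add: kspace_minus_eq kspace_smult_add kspace_smult_smult)
    ultimately show ?thesis using V x yV by (simp add: coset_eq_iff)
  qed
  moreover have "x \<in> U +>\<^bsub>V\<^esub> x" using x by (rule U.a_rcos_self)
  ultimately have "(\<Union>y \<in> U +>\<^bsub>V\<^esub> x. U +>\<^bsub>V\<^esub> (c \<odot>\<^bsub>V\<^esub> y)) = U +>\<^bsub>V\<^esub> (c \<odot>\<^bsub>V\<^esub> x)" by blast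
  then show ?thesis by (simp add: quotient_def ring.defs module.defs FactRing_def)
qed

lemma kspace_quotient: "kspace (quotient V U)"
proof (rule kspaceI)
  show "\<zero>\<^bsub>quotient V U\<^esub> \<in> carrier (quotient V U)"
    using coset_zero kspace_zero[OF V] by (force simp: quotient_carrier quotient_zero)
next
  fix x assume "x \<in> carrier (quotient V U)"
  then show "x \<oplus>\<^bsub>quotient V U\<^esub> \<zero>\<^bsub>quotient V U\<^esub> = x"
    using quotient_add[of _ "\<zero>\<^bsub>V\<^esub>"] V by (auto simp: quotient_carrier quotient_zero coset_zero)
next
  fix x assume "x \<in> carrier (quotient V U)"
  then obtain x' where x: "x = U +>\<^bsub>V\<^esub> x'" "x' \<in> carrier V" by (auto simp: quotient_carrier)
  have "x' \<oplus>\<^bsub>V\<^esub> ((- 1) \<odot>\<^bsub>V\<^esub> x') = \<zero>\<^bsub>V\<^esub>"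
    using x V kspace_minus_eq kspace_minus_self by metis
  then show "x \<oplus>\<^bsub>quotient V U\<^esub> ((- 1) \<odot>\<^bsub>quotient V U\<^esub> x) = \<zero>\<^bsub>quotient V U\<^esub>"
    using x V by (simp add: quotient_smult quotient_add quotient_zero coset_zero)
next
  fix x y assume "x \<in> carrier (quotient V U)" "y \<in> carrier (quotient V U)"
  then show "x \<oplus>\<^bsub>quotient V U\<^esub> y = y \<oplus>\<^bsub>quotient V U\<^esub> x"
    using kspace_comm[OF V] by (auto simp: quotient_carrier quotient_add)
qed (use V in \<open>auto simp: quotient_carrier quotient_add quotient_smult kspace_assoc
      kspace_smult_smult kspace_add_smult kspace_smult_add\<close>)

lemma lin_coset: "lin V (quotient V U) (\<lambda>x. U +>\<^bsub>V\<^esub> x)"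
  by (rule linI) (auto simp: quotient_carrier quotient_add quotient_smult)

text \<open>A linear map that kills \<open>U\<close> is constant on cosets, so the image of a coset
  is a singleton. This gives \<open>the_elem\<close> in \<open>presented_map\<close> its
  meaning.\<close>

lemma the_elem_image_coset:
  assumes W: "kspace W" and f: "lin V W f" and kill: "\<And>x. x \<in> U \<Longrightarrow> f x = \<zero>\<^bsub>W\<^esub>"
    and x: "x \<in> carrier V"
  shows "the_elem (f ` (U +>\<^bsub>V\<^esub> x)) = f x"
proof -
  have "f y = f x" if "y \<in> U +>\<^bsub>V\<^esub> x" for y
  proof -
    have y: "y \<in> carrier V" using coset_subset[OF x] that by blast
    have "f (y \<ominus>\<^bsub>V\<^esub> x) = \<zero>\<^bsub>W\<^esub>" using that x y by (intro kill) (simp add: mem_coset_iff)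
    then show ?thesis
      using lin_minus[OF f V W y x] kspace_minus_eq_zero_iff[OF W] lin_closed[OF f] x y by simp
  qed
  moreover have "x \<in> U +>\<^bsub>V\<^esub> x" using x by (rule U.a_rcos_self)
  ultimately have "f ` (U +>\<^bsub>V\<^esub> x) = {f x}" by blast
  then show ?thesis by simp
qed

lemma lin_quotient_map:
  assumes W: "kspace W" and f: "lin V W f" and kill: "\<And>x. x \<in> U \<Longrightarrow> f x = \<zero>\<^bsub>W\<^esub>"
  shows "lin (quotient V U) W (\<lambda>Y. the_elem (f ` Y))"
  by (rule linI) (use V f in \<open>auto simp: quotient_carrier quotient_add quotient_smult
      the_elem_image_coset[OF W f kill] lin_closed lin_add lin_smult\<close>)

end

subsection \<open>Free and presented spaces\<close>

lemma free_space_simps [simp]: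
  "\<zero>\<^bsub>free_space X\<^esub> = (\<lambda>x. 0)"
  "f \<oplus>\<^bsub>free_space X\<^esub> g = (\<lambda>x. f x + g x)"
  "c \<odot>\<^bsub>free_space X\<^esub> f = (\<lambda>x. c * f x)"
  by (simp_all add: free_space_def)

lemma free_space_carrier:
  "f \<in> carrier (free_space X) \<longleftrightarrow> finite {x. f x \<noteq> 0} \<and> {x. f x \<noteq> 0} \<subseteq> X"
  by (simp add: free_space_def)

lemma free_space_carrierI: "finite Y \<Longrightarrow> Y \<subseteq> X \<Longrightarrow> (\<And>x. x \<notin> Y \<Longrightarrow> f x = 0) \<Longrightarrow> f \<in> carrier (free_space X)"
  unfolding free_space_carrier by (rule conjI, rule finite_subset[of _ Y]) auto

lemma kspace_free_space [simp]: "kspace (free_space X :: ('k::field, 'x \<Rightarrow> 'k) module)"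
proof (rule kspaceI)
  fix f g :: "'x \<Rightarrow> 'k"
  assume "f \<in> carrier (free_space X)" "g \<in> carrier (free_space X)"
  then show "f \<oplus>\<^bsub>free_space X\<^esub> g \<in> carrier (free_space X)"
    by (intro free_space_carrierI[of "{x. f x \<noteq> 0} \<union> {x. g x \<noteq> 0}"]) (auto simp: free_space_carrier)
next
  fix f :: "'x \<Rightarrow> 'k" and c
  assume "f \<in> carrier (free_space X)"
  then show "c \<odot>\<^bsub>free_space X\<^esub> f \<in> carrier (free_space X)"
    by (intro free_space_carrierI[of "{x. f x \<noteq> 0}"]) (auto simp: free_space_carrier)
qed (auto simp: free_space_carrier algebra_simps fun_eq_iff)

lemma free_space_minus [simp]:
  fixes f :: "'x \<Rightarrow> 'k::field"
  assumes "f \<in> carrier (free_space X)" "g \<in> carrier (free_space X)"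
  shows "f \<ominus>\<^bsub>free_space X\<^esub> g = (\<lambda>x. f x - g x)"
  using kspace_minus_eq[OF kspace_free_space assms] by simp

lemma single_apply: "single x y = (if y = x then 1 else 0)"
  by (simp add: single_def)

lemma single_carrier [simp]: "x \<in> X \<Longrightarrow> single x \<in> carrier (free_space X)"
  by (rule free_space_carrierI[of "{x}"]) (auto simp: single_def)

lemma free_space_induct [consumes 1, case_names zero single add]:
  assumes "v \<in> carrier (free_space X)" and "P (\<lambda>x. 0)"
    and "\<And>x c. x \<in> X \<Longrightarrow> P (\<lambda>y. c * single x y)"
    and "\<And>f g. f \<in> carrier (free_space X) \<Longrightarrow> g \<in> carrier (free_space X) \<Longrightarrow> P f \<Longrightarrow> P g \<Longrightarrow> P (\<lambda>x. f x + g x)"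
  shows "P (v :: 'x \<Rightarrow> 'k::field)"
proof -
  have "P v" if "finite Y" "Y \<subseteq> X" "\<And>x. x \<notin> Y \<Longrightarrow> v x = 0" for Y and v :: "'x \<Rightarrow> 'k"
    using that
  proof (induction Y arbitrary: v)
    case empty
    then have "v = (\<lambda>x. 0)" by auto
    then show ?case using assms(2) by simp
  next
    case (insert y Y)
    let ?w = "v(y := 0)"
    have w: "P ?w" using insert.prems by (intro insert.IH) auto
    have "?w \<in> carrier (free_space X)"
      using insert by (intro free_space_carrierI[of Y]) auto
    moreover have "(\<lambda>x. v y * single y x) \<in> carrier (free_space X)"
      using insert by (intro free_space_carrierI[of "{y}"]) (auto simp: single_def)
    moreover have "P (\<lambda>x. v y * single y x)" using assms(3) insert.prems by auto
    ultimately have "P (\<lambda>x. v y * single y x + ?w x)" using w by (intro assms(4))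
    moreover have "(\<lambda>x. v y * single y x + ?w x) = v" by (auto simp: single_def)
    ultimately show ?case by simp
  qed
  then show ?thesis using assms(1) unfolding free_space_carrier by blast
qed

context
  fixes W :: "('k::field, 'm, 'e) module_scheme" and f :: "'x \<Rightarrow> 'm" and X
  assumes W: "kspace W" and f: "\<And>x. x \<in> X \<Longrightarrow> f x \<in> carrier W"
begin

interpretation W: vectorspace class_ring W by (rule W)

text \<open>The defining sum runs over the support of \<open>v\<close>, which varies with
  \<open>v\<close>; a common finite superset allows two such sums to be added.\<close>

lemma linear_extension_superset:
  assumes "finite Y" "Y \<subseteq> X" "\<And>x. x \<notin> Y \<Longrightarrow> v x = 0"
  shows "linear_extension W f v = (\<Oplus>\<^bsub>W\<^esub> x \<in> Y. v x \<odot>\<^bsub>W\<^esub> f x)"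
proof -
  have "{x. v x \<noteq> 0} \<subseteq> Y" using assms by auto
  then show ?thesis unfolding linear_extension_def
    by (intro W.add.finprod_mono_neutral_cong_left) (use assms W f in \<open>auto simp: kspace_smult subset_iff\<close>)
qed

lemma linear_extension_single: "x \<in> X \<Longrightarrow> linear_extension W f (single x) = f x"
  using f W by (subst linear_extension_superset[of "{x}"]) (auto simp: single_def)

lemma lin_linear_extension: "lin (free_space X) W (linear_extension W f)"
proof (rule linI)
  fix v :: "'x \<Rightarrow> 'k" assume "v \<in> carrier (free_space X)"
  then show "linear_extension W f v \<in> carrier W"
    unfolding linear_extension_def using W f
    by (intro W.finsum_closed) (auto simp: free_space_carrier subset_iff)
next
  fix v w :: "'x \<Rightarrow> 'k" assume v: "v \<in> carrier (free_space X)" and w: "w \<in> carrier (free_space X)"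
  let ?Y = "{x. v x \<noteq> 0} \<union> {x. w x \<noteq> 0}"
  have Y: "finite ?Y" "?Y \<subseteq> X" using v w by (auto simp: free_space_carrier)
  have fY: "f x \<in> carrier W" if "x \<in> ?Y" for x using that Y f by blast
  show "linear_extension W f (v \<oplus>\<^bsub>free_space X\<^esub> w) = linear_extension W f v \<oplus>\<^bsub>W\<^esub> linear_extension W f w"
  proof -
    have "linear_extension W f (v \<oplus>\<^bsub>free_space X\<^esub> w) = (\<Oplus>\<^bsub>W\<^esub> x \<in> ?Y. (v x + w x) \<odot>\<^bsub>W\<^esub> f x)"
      using linear_extension_superset[OF Y, of "\<lambda>x. v x + w x"] by simp
    also have "\<dots> = (\<Oplus>\<^bsub>W\<^esub> x \<in> ?Y. v x \<odot>\<^bsub>W\<^esub> f x \<oplus>\<^bsub>W\<^esub> w x \<odot>\<^bsub>W\<^esub> f x)"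
      using fY W by (intro W.finsum_cong') (auto simp: kspace_add_smult)
    also have "\<dots> = (\<Oplus>\<^bsub>W\<^esub> x \<in> ?Y. v x \<odot>\<^bsub>W\<^esub> f x) \<oplus>\<^bsub>W\<^esub> (\<Oplus>\<^bsub>W\<^esub> x \<in> ?Y. w x \<odot>\<^bsub>W\<^esub> f x)"
      using fY W by (intro W.finsum_addf) auto
    also have "\<dots> = linear_extension W f v \<oplus>\<^bsub>W\<^esub> linear_extension W f w"
      using linear_extension_superset[OF Y, of v] linear_extension_superset[OF Y, of w] by simp
    finally show ?thesis .
  qed
next
  fix v :: "'x \<Rightarrow> 'k" and c assume v: "v \<in> carrier (free_space X)"
  let ?Y = "{x. v x \<noteq> 0}"
  have Y: "finite ?Y" "?Y \<subseteq> X" using v by (auto simp: free_space_carrier)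
  have fY: "f x \<in> carrier W" if "x \<in> ?Y" for x using that Y f by blast
  show "linear_extension W f (c \<odot>\<^bsub>free_space X\<^esub> v) = c \<odot>\<^bsub>W\<^esub> linear_extension W f v"
  proof -
    have "linear_extension W f (c \<odot>\<^bsub>free_space X\<^esub> v) = (\<Oplus>\<^bsub>W\<^esub> x \<in> ?Y. (c * v x) \<odot>\<^bsub>W\<^esub> f x)"
      using linear_extension_superset[OF Y, of "\<lambda>x. c * v x"] by simp
    also have "\<dots> = (\<Oplus>\<^bsub>W\<^esub> x \<in> ?Y. c \<odot>\<^bsub>W\<^esub> (v x \<odot>\<^bsub>W\<^esub> f x))"
      using fY W by (intro W.finsum_cong') (auto simp: kspace_smult_smult)
    also have "\<dots> = c \<odot>\<^bsub>W\<^esub> (\<Oplus>\<^bsub>W\<^esub> x \<in> ?Y. v x \<odot>\<^bsub>W\<^esub> f x)"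
      using fY W by (intro W.finsum_smult[symmetric]) auto
    finally show ?thesis using linear_extension_superset[OF Y, of v] by simp
  qed
qed

end

lemma lin_free_space_eq:
  assumes W: "kspace W" and f: "lin (free_space X) W f" and g: "lin (free_space X) W g"
    and eq: "\<And>x. x \<in> X \<Longrightarrow> f (single x) = g (single x)" and v: "v \<in> carrier (free_space X)"
  shows "f v = g v"
  using v
proof (induction rule: free_space_induct)
  case zero
  then show ?case using lin_zero[OF f kspace_free_space W] lin_zero[OF g kspace_free_space W] by simp
next
  case (single x c)
  then show ?case using lin_smult[OF f, of "single x" c] lin_smult[OF g, of "single x" c] eq by simp
next
  case (add u w)
  then show ?case using lin_add[OF f, of u w] lin_add[OF g, of u w] by simp
qed

context
  fixes X :: "'x set" and R :: "('x \<Rightarrow> 'k::field) set"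
  assumes R: "R \<subseteq> carrier (free_space X)"
begin

private abbreviation "S \<equiv> LinearCombinations.module.span class_ring (free_space X) R"

lemma presented_subspace: "is_subspace (free_space X) S"
  by (rule is_subspace_span) (use R in simp_all)

lemma kspace_presented: "kspace (presented X R)"
  unfolding presented_def by (rule kspace_quotient) (simp_all add: presented_subspace)

lemma lin_presented_coset: "lin (free_space X) (presented X R) (\<lambda>v. S +>\<^bsub>free_space X\<^esub> v)"
  unfolding presented_def by (rule lin_coset) (simp_all add: presented_subspace)

lemma generator_closed: "x \<in> X \<Longrightarrow> generator X R x \<in> carrier (presented X R)"
  unfolding generator_def by (rule lin_closed[OF lin_presented_coset]) simp

lemma presented_relation_eq:
  "u \<ominus>\<^bsub>free_space X\<^esub> v \<in> R \<Longrightarrow> u \<in> carrier (free_space X) \<Longrightarrow> v \<in> carrier (free_space X) \<Longrightarrow>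
     S +>\<^bsub>free_space X\<^esub> u = S +>\<^bsub>free_space X\<^esub> v"
  by (simp add: coset_eq_iff[OF kspace_free_space presented_subspace]
      span_superset[OF kspace_free_space R] del: free_space_minus)

context
  fixes W :: "('k, 'm, 'e) module_scheme" and f :: "'x \<Rightarrow> 'm"
  assumes W: "kspace W" and f: "\<And>x. x \<in> X \<Longrightarrow> f x \<in> carrier W"
    and rel: "\<And>r. r \<in> R \<Longrightarrow> linear_extension W f r = \<zero>\<^bsub>W\<^esub>"
begin

lemma linear_extension_span_zero:
  assumes "u \<in> S"
  shows "linear_extension W f u = \<zero>\<^bsub>W\<^esub>"
  using assms span_induct[OF kspace_free_space R,
      of "{x \<in> carrier (free_space X). linear_extension W f x = \<zero>\<^bsub>W\<^esub>}" u]
    is_subspace_ker[OF kspace_free_space W lin_linear_extension[of W X f, OF W f]] R rel by auto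

lemma lin_presented_map: "lin (presented X R) W (presented_map W f)"
  unfolding presented_def presented_map_def
  by (rule lin_quotient_map)
    (use W f linear_extension_span_zero in \<open>auto intro!: presented_subspace lin_linear_extension\<close>)

lemma presented_map_generator: "x \<in> X \<Longrightarrow> presented_map W f (generator X R x) = f x"
  unfolding presented_map_def generator_def
  by (subst the_elem_image_coset[OF kspace_free_space presented_subspace W lin_linear_extension[OF W f]])
    (use W f linear_extension_span_zero linear_extension_single[of W X f] in auto)

end

end

lemma presented_induct [consumes 2, case_names generator add smult zero]:
  fixes R :: "('x \<Rightarrow> 'k::field) set"
  assumes R: "R \<subseteq> carrier (free_space X)" and "v \<in> carrier (presented X R)"
    and "\<And>x. x \<in> X \<Longrightarrow> P (generator X R x)"
    and "\<And>v w. v \<in> carrier (presented X R) \<Longrightarrow> w \<in> carrier (presented X R) \<Longrightarrow> P v \<Longrightarrow> P w \<Longrightarrow>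
      P (v \<oplus>\<^bsub>presented X R\<^esub> w)"
    and "\<And>c v. v \<in> carrier (presented X R) \<Longrightarrow> P v \<Longrightarrow> P (c \<odot>\<^bsub>presented X R\<^esub> v)"
    and "P \<zero>\<^bsub>presented X R\<^esub>"
  shows "P v"
proof -
  let ?S = "LinearCombinations.module.span class_ring (free_space X) R"
  note c = lin_presented_coset[OF R]
  obtain u where u: "u \<in> carrier (free_space X)" "v = ?S +>\<^bsub>free_space X\<^esub> u"
    using assms(2) unfolding presented_def
    by (auto simp: quotient_carrier[OF kspace_free_space presented_subspace[OF R]])
  have "P (?S +>\<^bsub>free_space X\<^esub> u)" using u(1)
  proof (induction rule: free_space_induct)
    case zero
    then show ?case using lin_zero[OF c kspace_free_space kspace_presented[OF R]] assms(6) by simp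
  next
    case (single x a)
    then show ?case
      using lin_smult[OF c, of "single x" a] assms(5)[OF generator_closed[OF R] assms(3), of x]
      by (simp add: generator_def)
  next
    case (add f g)
    then show ?case using lin_add[OF c, of f g] assms(4) lin_closed[OF c] by simp
  qed
  then show ?thesis using u by simp
qed

section \<open>Tensor powers and the bar resolution\<close>

lemma finsum_closed_kspace:
  "kspace W \<Longrightarrow> (\<And>i. i \<in> I \<Longrightarrow> f i \<in> carrier W) \<Longrightarrow> (\<Oplus>\<^bsub>W\<^esub> i \<in> I. f i) \<in> carrier W"
  using abelian_monoid.finsum_closed[OF abelian_group.axioms(1)[OF kspace_abelian_group], of W f I]
  by (simp add: Pi_def)

lemma finsum_insert_kspace:
  "kspace W \<Longrightarrow> finite I \<Longrightarrow> j \<notin> I \<Longrightarrow> (\<And>i. i \<in> insert j I \<Longrightarrow> f i \<in> carrier W) \<Longrightarrow>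
     (\<Oplus>\<^bsub>W\<^esub> i \<in> insert j I. f i) = f j \<oplus>\<^bsub>W\<^esub> (\<Oplus>\<^bsub>W\<^esub> i \<in> I. f i)"
  using abelian_monoid.finsum_insert[OF abelian_group.axioms(1)[OF kspace_abelian_group], of W I j f]
  by (simp add: Pi_def)

lemma finsum_empty_kspace: "kspace W \<Longrightarrow> (\<Oplus>\<^bsub>W\<^esub> i \<in> {}. f i) = \<zero>\<^bsub>W\<^esub>"
  by (rule abelian_monoid.finsum_empty[OF abelian_group.axioms(1)[OF kspace_abelian_group]])

lemma lin_const_zero: "kspace W \<Longrightarrow> lin V W (\<lambda>x. \<zero>\<^bsub>W\<^esub>)"
  by (rule linI) simp_all

lemma lin_plus:
  assumes W: "kspace W" and f: "lin V W f" and g: "lin V W g"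
  shows "lin V W (\<lambda>x. f x \<oplus>\<^bsub>W\<^esub> g x)"
proof -
  interpret W: vectorspace class_ring W by (rule W)
  show ?thesis
    by (rule linI) (use W f g in \<open>simp_all add: lin_closed lin_add lin_smult kspace_smult_add W.M.add.m_ac\<close>)
qed

lemma lin_scale: "kspace W \<Longrightarrow> lin V W f \<Longrightarrow> lin V W (\<lambda>x. c \<odot>\<^bsub>W\<^esub> f x)"
  by (rule linI)
    (simp_all add: lin_closed lin_add lin_smult kspace_smult_add kspace_smult_smult mult.commute)

lemma lin_finsum:
  assumes W: "kspace W" and "finite I" "\<And>i. i \<in> I \<Longrightarrow> lin V W (f i)" and V: "kspace V"
  shows "lin V W (\<lambda>x. \<Oplus>\<^bsub>W\<^esub> i \<in> I. f i x)"
  using assms(2,3)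
proof (induction I)
  case empty
  have "(\<lambda>x. \<Oplus>\<^bsub>W\<^esub> i \<in> {}. f i x) = (\<lambda>x. \<zero>\<^bsub>W\<^esub>)" by (rule ext) (rule finsum_empty_kspace[OF W])
  then show ?case using lin_const_zero[OF W] by simp
next
  case (insert j I)
  have "lin V W (\<lambda>x. f j x \<oplus>\<^bsub>W\<^esub> (\<Oplus>\<^bsub>W\<^esub> i \<in> I. f i x))"
    using insert by (intro lin_plus W) auto
  moreover have "f j x \<oplus>\<^bsub>W\<^esub> (\<Oplus>\<^bsub>W\<^esub> i \<in> I. f i x) = (\<Oplus>\<^bsub>W\<^esub> i \<in> insert j I. f i x)" if "x \<in> carrier V" for x
    using insert that by (subst finsum_insert_kspace[OF W]) (auto intro: lin_closed)
  ultimately show ?case using lin_cong[OF _ V] by (smt (verit, best))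
qed

lemma lin_apply_finsum:
  assumes V: "kspace V" and W: "kspace W" and g: "lin V W g"
    and "finite I" "\<And>i. i \<in> I \<Longrightarrow> f i \<in> carrier V"
  shows "g (\<Oplus>\<^bsub>V\<^esub> i \<in> I. f i) = (\<Oplus>\<^bsub>W\<^esub> i \<in> I. g (f i))"
  using assms(4,5)
proof (induction I)
  case empty
  then show ?case by (simp add: finsum_empty_kspace V W lin_zero[OF g])
next
  case (insert j I)
  then have "g (f j \<oplus>\<^bsub>V\<^esub> (\<Oplus>\<^bsub>V\<^esub> i \<in> I. f i)) = g (f j) \<oplus>\<^bsub>W\<^esub> (\<Oplus>\<^bsub>W\<^esub> i \<in> I. g (f i))"
    by (simp add: lin_add[OF g] finsum_closed_kspace V)
  moreover have "(\<Oplus>\<^bsub>V\<^esub> i \<in> insert j I. f i) = f j \<oplus>\<^bsub>V\<^esub> (\<Oplus>\<^bsub>V\<^esub> i \<in> I. f i)"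
    using insert by (intro finsum_insert_kspace[OF V]) auto
  moreover have "(\<Oplus>\<^bsub>W\<^esub> i \<in> insert j I. g (f i)) = g (f j) \<oplus>\<^bsub>W\<^esub> (\<Oplus>\<^bsub>W\<^esub> i \<in> I. g (f i))"
    using insert by (intro finsum_insert_kspace[OF W]) (auto intro: lin_closed[OF g])
  ultimately show ?case by simp
qed

section \<open>Multilinear maps and the universal property of tensor powers\<close>

definition multilinear ::
  "('k::field, 'r) module \<Rightarrow> nat \<Rightarrow> ('k, 'm, 'e) module_scheme \<Rightarrow> ('r list \<Rightarrow> 'm) \<Rightarrow> bool" where
  "multilinear A n W f \<longleftrightarrow> (\<forall>xs \<in> tuples A n. f xs \<in> carrier W \<and> (\<forall>i<n. lin A W (\<lambda>x. f (xs[i := x]))))"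

lemma multilinearI:
  assumes "\<And>xs. xs \<in> tuples A n \<Longrightarrow> f xs \<in> carrier W"
    and "\<And>xs i. xs \<in> tuples A n \<Longrightarrow> i < n \<Longrightarrow> lin A W (\<lambda>x. f (xs[i := x]))"
  shows "multilinear A n W f"
  using assms unfolding multilinear_def by blast

lemma multilinear_closed: "multilinear A n W f \<Longrightarrow> xs \<in> tuples A n \<Longrightarrow> f xs \<in> carrier W"
  and multilinear_lin: "multilinear A n W f \<Longrightarrow> xs \<in> tuples A n \<Longrightarrow> i < n \<Longrightarrow> lin A W (\<lambda>x. f (xs[i := x]))"
  unfolding multilinear_def by blast+

lemma tuples_update: "xs \<in> tuples A n \<Longrightarrow> x \<in> carrier A \<Longrightarrow> xs[i := x] \<in> tuples A n"
  unfolding tuples_def by (auto dest: set_update_subset_insert[THEN subsetD])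

lemma tuples_nth: "xs \<in> tuples A n \<Longrightarrow> i < n \<Longrightarrow> xs ! i \<in> carrier A"
  unfolding tuples_def by auto

lemma tuples_length: "xs \<in> tuples A n \<Longrightarrow> length xs = n"
  unfolding tuples_def by simp

context
  fixes A :: "('k::field, 'r) module"
  assumes A: "kspace A"
begin

lemma multilinear_relations_carrier: "multilinear_relations A n \<subseteq> carrier (free_space (tuples A n))"
  unfolding multilinear_relations_def Let_def using A
  by (auto simp del: free_space_simps free_space_minus
      intro!: kspace_minus kspace_add kspace_smult single_carrier tuples_update)

lemma kspace_tensor_power: "kspace (tensor_power A n)"
  unfolding tensor_power_def by (rule kspace_presented[OF multilinear_relations_carrier])

lemma multilinear_pure_tensor: "multilinear A n (tensor_power A n) (pure_tensor A)"
proof -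
  let ?X = "tuples A n" and ?R = "multilinear_relations A n"
  let ?F = "free_space ?X :: ('k, 'r list \<Rightarrow> 'k) module"
  let ?T = "presented ?X ?R"
  let ?q = "\<lambda>v. LinearCombinations.module.span class_ring ?F ?R +>\<^bsub>?F\<^esub> v"
  note q = lin_presented_coset[OF multilinear_relations_carrier[of n]]
  note T = kspace_presented[OF multilinear_relations_carrier[of n]]
  have gen: "pure_tensor A xs = ?q (single xs)" if "xs \<in> ?X" for xs
    using that by (simp add: pure_tensor_def generator_def tuples_length)
  note eq = presented_relation_eq[OF multilinear_relations_carrier[of n]]
  show ?thesis unfolding tensor_power_def
  proof (rule multilinearI)
    fix xs assume "xs \<in> ?X"
    then show "pure_tensor A xs \<in> carrier ?T"
      using gen lin_closed[OF q, of "single xs"] by simp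
  next
    fix xs i assume xs: "xs \<in> ?X" and i: "i < n"
    show "lin A ?T (\<lambda>x. pure_tensor A (xs[i := x]))"
    proof (rule linI)
      fix x assume "x \<in> carrier A"
      then show "pure_tensor A (xs[i := x]) \<in> carrier ?T"
        using xs gen lin_closed[OF q, of "single (xs[i := x])"] by (simp add: tuples_update)
    next
      fix x y assume x: "x \<in> carrier A" and y: "y \<in> carrier A"
      let ?u = "single (xs[i := x \<oplus>\<^bsub>A\<^esub> y])"
      let ?v = "single (xs[i := x])" and ?w = "single (xs[i := y])"
      have "?q ?u = ?q (?v \<oplus>\<^bsub>?F\<^esub> ?w)"
      proof (rule eq)
        show "?u \<ominus>\<^bsub>?F\<^esub> (?v \<oplus>\<^bsub>?F\<^esub> ?w) \<in> ?R"
          unfolding multilinear_relations_def Let_def using xs i x y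
          by (intro UnI1 CollectI exI[of _ xs] exI[of _ i] exI[of _ x] exI[of _ y]) simp
        show "?v \<oplus>\<^bsub>?F\<^esub> ?w \<in> carrier ?F"
          using xs x y by (intro kspace_add) (auto intro!: single_carrier tuples_update)
        show "?u \<in> carrier ?F" using xs x y A by (auto intro!: single_carrier tuples_update)
      qed
      also have "\<dots> = ?q ?v \<oplus>\<^bsub>?T\<^esub> ?q ?w" using xs x y by (intro lin_add[OF q]) (auto intro!: single_carrier tuples_update)
      finally show "pure_tensor A (xs[i := x \<oplus>\<^bsub>A\<^esub> y]) = pure_tensor A (xs[i := x]) \<oplus>\<^bsub>?T\<^esub> pure_tensor A (xs[i := y])"
        using xs x y A by (simp add: gen tuples_update)
    next
      fix c x assume x: "x \<in> carrier A"
      let ?u = "single (xs[i := c \<odot>\<^bsub>A\<^esub> x])" and ?v = "single (xs[i := x])"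
      have "?q ?u = ?q (c \<odot>\<^bsub>?F\<^esub> ?v)"
      proof (rule eq)
        show "?u \<ominus>\<^bsub>?F\<^esub> (c \<odot>\<^bsub>?F\<^esub> ?v) \<in> ?R"
          unfolding multilinear_relations_def Let_def using xs i x
          by (intro UnI2 CollectI exI[of _ xs] exI[of _ i] exI[of _ x] exI[of _ c]) simp
        show "c \<odot>\<^bsub>?F\<^esub> ?v \<in> carrier ?F"
          using xs x by (intro kspace_smult) (auto intro!: single_carrier tuples_update)
        show "?u \<in> carrier ?F" using xs x A by (auto intro!: single_carrier tuples_update)
      qed
      also have "\<dots> = c \<odot>\<^bsub>?T\<^esub> ?q ?v" using xs x by (intro lin_smult[OF q]) (auto intro!: single_carrier tuples_update)
      finally show "pure_tensor A (xs[i := c \<odot>\<^bsub>A\<^esub> x]) = c \<odot>\<^bsub>?T\<^esub> pure_tensor A (xs[i := x])"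
        using xs x A by (simp add: gen tuples_update)
    qed
  qed
qed

lemma pure_tensor_closed: "xs \<in> tuples A n \<Longrightarrow> pure_tensor A xs \<in> carrier (tensor_power A n)"
  by (rule multilinear_closed[OF multilinear_pure_tensor])

lemma tensor_power_induct [consumes 1, case_names pure add smult zero]:
  assumes "t \<in> carrier (tensor_power A n)"
    and "\<And>xs. xs \<in> tuples A n \<Longrightarrow> P (pure_tensor A xs)"
    and "\<And>s t. s \<in> carrier (tensor_power A n) \<Longrightarrow> t \<in> carrier (tensor_power A n) \<Longrightarrow> P s \<Longrightarrow> P t \<Longrightarrow>
      P (s \<oplus>\<^bsub>tensor_power A n\<^esub> t)"
    and "\<And>c t. t \<in> carrier (tensor_power A n) \<Longrightarrow> P t \<Longrightarrow> P (c \<odot>\<^bsub>tensor_power A n\<^esub> t)"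
    and "P \<zero>\<^bsub>tensor_power A n\<^esub>"
  shows "P t"
  by (rule presented_induct[OF multilinear_relations_carrier, of t n P, folded tensor_power_def])
    (use assms in \<open>auto simp: pure_tensor_def tuples_length\<close>)

text \<open>Every relation is a difference of two elements on which the linear extension of
  \<open>f\<close> agrees, by linearity of \<open>f\<close> in a single slot.\<close>

lemma tensor_power_map:
  fixes W :: "('k, 'm, 'e) module_scheme"
  assumes W: "kspace W" and f: "multilinear A n W f"
  shows lin_tensor_power_map: "lin (tensor_power A n) W (presented_map W f)"
    and tensor_power_map_pure: "xs \<in> tuples A n \<Longrightarrow> presented_map W f (pure_tensor A xs) = f xs"
proof -
  let ?X = "tuples A n" and ?R = "multilinear_relations A n"
  let ?F = "free_space ?X :: ('k, 'r list \<Rightarrow> 'k) module"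
  note fc = multilinear_closed[OF f]
  note l = lin_linear_extension[of W ?X f, OF W fc]
  note s = linear_extension_single[of W ?X f, OF W fc]
  have "linear_extension W f r = \<zero>\<^bsub>W\<^esub>" if "r \<in> ?R" for r
  proof -
    have m: "linear_extension W f (u \<ominus>\<^bsub>?F\<^esub> v) = \<zero>\<^bsub>W\<^esub>"
      if "u \<in> carrier ?F" "v \<in> carrier ?F" "linear_extension W f u = linear_extension W f v" for u v
      using that by (simp only: lin_minus[OF l kspace_free_space W] kspace_minus_self[OF W] lin_closed[OF l])
    from that show ?thesis unfolding multilinear_relations_def Let_def
    proof (elim UnE CollectE exE conjE)
      fix xs i x y assume h: "r = single (xs[i := x \<oplus>\<^bsub>A\<^esub> y]) \<ominus>\<^bsub>?F\<^esub> (single (xs[i := x]) \<oplus>\<^bsub>?F\<^esub> single (xs[i := y]))"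
        "xs \<in> ?X" "i < n" "x \<in> carrier A" "y \<in> carrier A"
      note up = tuples_update[OF h(2)]
      have "linear_extension W f (single (xs[i := x \<oplus>\<^bsub>A\<^esub> y])) =
          linear_extension W f (single (xs[i := x]) \<oplus>\<^bsub>?F\<^esub> single (xs[i := y]))"
        using lin_add[OF multilinear_lin[OF f h(2,3)] h(4,5)] h A
        by (subst lin_add[OF l]) (auto simp: s up simp del: free_space_simps)
      then show ?thesis unfolding h(1) using h(2-) A
        by (intro m) (auto simp del: free_space_simps intro!: kspace_add single_carrier up)
    next
      fix xs i c x assume h: "r = single (xs[i := c \<odot>\<^bsub>A\<^esub> x]) \<ominus>\<^bsub>?F\<^esub> (c \<odot>\<^bsub>?F\<^esub> single (xs[i := x]))"
        "xs \<in> ?X" "i < n" "x \<in> carrier A"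
      note up = tuples_update[OF h(2)]
      have "linear_extension W f (single (xs[i := c \<odot>\<^bsub>A\<^esub> x])) =
          linear_extension W f (c \<odot>\<^bsub>?F\<^esub> single (xs[i := x]))"
        using lin_smult[OF multilinear_lin[OF f h(2,3)] h(4)] h A
        by (subst lin_smult[OF l]) (auto simp: s up simp del: free_space_simps)
      then show ?thesis unfolding h(1) using h(2-) A
        by (intro m) (auto simp del: free_space_simps intro!: kspace_smult single_carrier up)
    qed
  qed
  note rel = this
  show "lin (tensor_power A n) W (presented_map W f)"
    unfolding tensor_power_def
    by (rule lin_presented_map[OF multilinear_relations_carrier W]) (use fc rel in auto)
  show "presented_map W f (pure_tensor A xs) = f xs" if "xs \<in> tuples A n"
    using presented_map_generator[OF multilinear_relations_carrier W, of n f xs] fc rel that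
    by (simp add: pure_tensor_def tuples_length)
qed

end

section \<open>Algebras over a field and the bimodules of the bar resolution\<close>

locale kalgebra = ring A for A :: "('k::field, 'r) module" (structure) +
  assumes kspace: "kspace A"
    and smult_mult_left: "x \<in> carrier A \<Longrightarrow> y \<in> carrier A \<Longrightarrow> (c \<odot> x) \<otimes> y = c \<odot> (x \<otimes> y)"
    and smult_mult_right: "x \<in> carrier A \<Longrightarrow> y \<in> carrier A \<Longrightarrow> x \<otimes> (c \<odot> y) = c \<odot> (x \<otimes> y)"
begin

lemma lin_mult_left: "a \<in> carrier A \<Longrightarrow> lin A A (\<lambda>x. a \<otimes> x)"
  by (rule linI) (auto simp: r_distr smult_mult_right)

lemma lin_mult_right: "a \<in> carrier A \<Longrightarrow> lin A A (\<lambda>x. x \<otimes> a)"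
  by (rule linI) (auto simp: l_distr smult_mult_left)

text \<open>The faces of the bar complex. Treating them one at a time reduces multilinearity and
  bimodule linearity of the differential to statements about lists.\<close>

definition contract :: "nat \<Rightarrow> 'r list \<Rightarrow> 'r list" where
  "contract i xs = take i xs @ [xs ! i \<otimes> xs ! (i + 1)] @ drop (i + 2) xs"

lemma length_contract: "i + 1 < length xs \<Longrightarrow> length (contract i xs) = length xs - 1"
  by (simp add: contract_def)

lemma nth_contract:
  "i + 1 < length xs \<Longrightarrow> j < length xs - 1 \<Longrightarrow>
     contract i xs ! j = (if j < i then xs ! j else if j = i then xs ! i \<otimes> xs ! (i + 1) else xs ! (j + 1))"
proof (cases j i rule: linorder_cases)
  case greater
  assume len: "i + 1 < length xs" "j < length xs - 1"
  obtain k where k: "j = i + Suc k" using greater less_imp_Suc_add by auto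
  have "contract i xs ! j = drop (i + 2) xs ! k"
    using len k by (simp add: contract_def nth_append)
  also have "\<dots> = xs ! (j + 1)" using len k by (simp add: add.commute)
  finally show ?thesis using greater by simp
qed (simp_all add: contract_def nth_append)

lemma contract_tuples:
  assumes "xs \<in> tuples A (n + 1)" "i < n"
  shows "contract i xs \<in> tuples A n"
proof -
  have "xs ! i \<in> carrier A" "xs ! (i + 1) \<in> carrier A" using assms by (auto intro: tuples_nth)
  then show ?thesis using assms
    by (auto simp: tuples_def contract_def dest!: in_set_takeD in_set_dropD)
qed

text \<open>Slotwise linearity of a face is visible here: a changed entry either survives, with its
  index shifted if it lies to the right, or becomes a factor of the merged entry.\<close>

lemma contract_update:
  assumes "i + 1 < length xs" "j < length xs"
  shows "contract i (xs[j := x]) =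
    (if j < i then (contract i xs)[j := x]
     else if j = i then (contract i xs)[i := x \<otimes> xs ! (i + 1)]
     else if j = i + 1 then (contract i xs)[i := xs ! i \<otimes> x]
     else (contract i xs)[j - 1 := x])"
  by (rule nth_equalityI) (use assms in \<open>auto simp: length_contract nth_contract nth_list_update\<close>)

lemma multilinear_contract:
  assumes f: "multilinear A n W f" and i: "i < n"
  shows "multilinear A (n + 1) W (\<lambda>xs. f (contract i xs))"
proof (rule multilinearI)
  fix xs assume xs: "xs \<in> tuples A (n + 1)"
  then show "f (contract i xs) \<in> carrier W" by (intro multilinear_closed[OF f] contract_tuples i)
next
  fix xs j assume xs: "xs \<in> tuples A (n + 1)" and j: "j < n + 1"
  have len: "i + 1 < length xs" "j < length xs" using xs j i by (simp_all add: tuples_length)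
  have nth: "xs ! i \<in> carrier A" "xs ! (i + 1) \<in> carrier A" using xs i by (auto intro: tuples_nth)
  note l = multilinear_lin[OF f contract_tuples[OF xs i]]
  consider "j < i" | "j = i" | "j = i + 1" | "i + 1 < j" by linarith
  then show "lin A W (\<lambda>x. f (contract i (xs[j := x])))"
  proof cases
    case 1 then show ?thesis using l[of j] i by (simp add: contract_update[OF len])
  next
    case 2 then show ?thesis
      using lin_comp[OF lin_mult_right[OF nth(2)] l[OF i]] contract_update[OF len] by simp
  next
    case 3 then show ?thesis
      using lin_comp[OF lin_mult_left[OF nth(1)] l[OF i]] contract_update[OF len] by simp
  next
    case 4 then show ?thesis using l[of "j - 1"] j by (simp add: contract_update[OF len])
  qed
qed

lemma multilinear_apply_entry:
  assumes f: "multilinear A n W f" and g: "lin A A g" and j: "j < n"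
  shows "multilinear A n W (\<lambda>xs. f (xs[j := g (xs ! j)]))"
proof (rule multilinearI)
  fix xs assume xs: "xs \<in> tuples A n"
  show "f (xs[j := g (xs ! j)]) \<in> carrier W"
    using xs j by (intro multilinear_closed[OF f] tuples_update lin_closed[OF g] tuples_nth)
  fix i assume i: "i < n"
  show "lin A W (\<lambda>x. f (xs[i := x, j := g (xs[i := x] ! j)]))"
  proof (cases "i = j")
    case True
    then show ?thesis using lin_comp[OF g multilinear_lin[OF f xs i]] xs i by (simp add: tuples_length)
  next
    case False
    have "xs[j := g (xs ! j)] \<in> tuples A n"
      using xs j by (intro tuples_update lin_closed[OF g] tuples_nth)
    from multilinear_lin[OF f this i] show ?thesis using False by (simp add: list_update_swap)
  qed
qed

abbreviation "T \<equiv> tensor_power A"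
abbreviation "Bar \<equiv> bar_bimodule A"

lemma kspace_T [simp]: "kspace (T n)"
  by (rule kspace_tensor_power[OF kspace])

lemmas T_induct [consumes 1, case_names pure add smult zero] = tensor_power_induct[OF kspace]

lemma bar_carrier [simp]: "carrier (Bar n) = carrier (T (n + 2))"
  and bar_add [simp]: "add (Bar n) = add (T (n + 2))"
  and bar_smult [simp]: "module.smult (Bar n) = module.smult (T (n + 2))"
  and bar_zero [simp]: "zero (Bar n) = zero (T (n + 2))"
  by (simp_all add: bar_bimodule_def module.defs)

lemma bar_lact: 
  assumes a: "a \<in> carrier A"
  shows "lin (T (n + 2)) (T (n + 2)) (lact (Bar n) a)"
    and "xs \<in> tuples A (n + 2) \<Longrightarrow> lact (Bar n) a (pure_tensor A xs) = pure_tensor A (xs[0 := a \<otimes> xs ! 0])"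
proof -
  have eq: "xs[0 := a \<otimes> xs ! 0] = (a \<otimes> hd xs) # tl xs" if "xs \<in> tuples A (n + 2)" for xs
    using tuples_length[OF that] by (cases xs) auto
  have "multilinear A (n + 2) (T (n + 2)) (\<lambda>xs. pure_tensor A (xs[0 := a \<otimes> xs ! 0]))"
    by (rule multilinear_apply_entry[OF multilinear_pure_tensor[OF kspace] lin_mult_left[OF a]]) simp
  moreover have "(xs[i := x])[0 := a \<otimes> (xs[i := x]) ! 0] = (a \<otimes> hd (xs[i := x])) # tl (xs[i := x])"
    if "xs \<in> tuples A (n + 2)" for xs i x
    using tuples_length[OF that] by (cases xs; cases i) auto
  ultimately have m: "multilinear A (n + 2) (T (n + 2)) (\<lambda>xs. pure_tensor A ((a \<otimes> hd xs) # tl xs))"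
    unfolding multilinear_def using eq by simp
  show "lin (T (n + 2)) (T (n + 2)) (lact (Bar n) a)"
    using lin_tensor_power_map[OF kspace _ m] by (simp add: bar_bimodule_def module.defs bimodule.defs)
  show "lact (Bar n) a (pure_tensor A xs) = pure_tensor A (xs[0 := a \<otimes> xs ! 0])" if "xs \<in> tuples A (n + 2)"
    using tensor_power_map_pure[OF kspace _ m that] eq[OF that]
    by (simp add: bar_bimodule_def module.defs bimodule.defs)
qed

lemma bar_ract: 
  assumes a: "a \<in> carrier A"
  shows "lin (T (n + 2)) (T (n + 2)) (\<lambda>t. ract (Bar n) t a)"
    and "xs \<in> tuples A (n + 2) \<Longrightarrow>
      ract (Bar n) (pure_tensor A xs) a = pure_tensor A (xs[n + 1 := xs ! (n + 1) \<otimes> a])"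
proof -
  have eq: "xs[n + 1 := xs ! (n + 1) \<otimes> a] = butlast xs @ [last xs \<otimes> a]" if "length xs = n + 2" for xs
    using that by (cases xs rule: rev_cases) (auto simp: nth_append list_update_append)
  have "multilinear A (n + 2) (T (n + 2)) (\<lambda>xs. pure_tensor A (xs[n + 1 := xs ! (n + 1) \<otimes> a]))"
    by (rule multilinear_apply_entry[OF multilinear_pure_tensor[OF kspace] lin_mult_right[OF a]]) simp
  then have m: "multilinear A (n + 2) (T (n + 2)) (\<lambda>xs. pure_tensor A (butlast xs @ [last xs \<otimes> a]))"
    unfolding multilinear_def by (simp add: eq tuples_length del: One_nat_def add_2_eq_Suc add_2_eq_Suc')
  show "lin (T (n + 2)) (T (n + 2)) (\<lambda>t. ract (Bar n) t a)"
    using lin_tensor_power_map[OF kspace _ m] by (simp add: bar_bimodule_def module.defs bimodule.defs)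
  show "ract (Bar n) (pure_tensor A xs) a = pure_tensor A (xs[n + 1 := xs ! (n + 1) \<otimes> a])"
    if "xs \<in> tuples A (n + 2)"
    using tensor_power_map_pure[OF kspace _ m that] eq[of xs] tuples_length[OF that]
    by (simp add: bar_bimodule_def module.defs bimodule.defs)
qed

lemma multilinear_finsum:
  assumes "kspace W" "finite I" "\<And>i. i \<in> I \<Longrightarrow> multilinear A n W (f i)"
  shows "multilinear A n W (\<lambda>xs. \<Oplus>\<^bsub>W\<^esub> i \<in> I. f i xs)"
  using assms kspace
  by (intro multilinearI finsum_closed_kspace lin_finsum) (auto intro: multilinear_closed multilinear_lin)

lemma multilinear_scale:
  "kspace W \<Longrightarrow> multilinear A n W f \<Longrightarrow> multilinear A n W (\<lambda>xs. c \<odot>\<^bsub>W\<^esub> f xs)"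
  by (intro multilinearI lin_scale kspace_smult) (auto intro: multilinear_closed multilinear_lin)

lemma bar_differential:
  shows lin_bar_differential: "lin (T (n + 2)) (T (n + 1)) (bar_differential A n)"
    and bar_differential_pure: "xs \<in> tuples A (n + 2) \<Longrightarrow> bar_differential A n (pure_tensor A xs) =
      (\<Oplus>\<^bsub>T (n + 1)\<^esub> i \<in> {..n}. (-1) ^ i \<odot>\<^bsub>T (n + 1)\<^esub> pure_tensor A (contract i xs))"
proof -
  have m: "multilinear A (n + 1 + 1) (T (n + 1))
      (\<lambda>xs. \<Oplus>\<^bsub>T (n + 1)\<^esub> i \<in> {..n}. (-1) ^ i \<odot>\<^bsub>T (n + 1)\<^esub> pure_tensor A (contract i xs))"
    by (intro multilinear_finsum multilinear_scale multilinear_contract multilinear_pure_tensor kspace) auto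
  show "lin (T (n + 2)) (T (n + 1)) (bar_differential A n)"
    using lin_tensor_power_map[OF kspace _ m] by (simp add: bar_differential_def contract_def)
  show "bar_differential A n (pure_tensor A xs) =
      (\<Oplus>\<^bsub>T (n + 1)\<^esub> i \<in> {..n}. (-1) ^ i \<odot>\<^bsub>T (n + 1)\<^esub> pure_tensor A (contract i xs))"
    if "xs \<in> tuples A (n + 2)"
    using tensor_power_map_pure[OF kspace _ m, of xs] that by (simp add: bar_differential_def contract_def)
qed

lemma lin_tensor_power_eq:
  assumes W: "kspace W" and f: "lin (T n) W f" and g: "lin (T n) W g"
    and eq: "\<And>xs. xs \<in> tuples A n \<Longrightarrow> f (pure_tensor A xs) = g (pure_tensor A xs)"
    and t: "t \<in> carrier (T n)"
  shows "f t = g t"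
  using t
proof (induction rule: T_induct)
  case pure then show ?case by (rule eq)
next
  case add then show ?case using f g by (simp add: lin_add)
next
  case smult then show ?case using f g by (simp add: lin_smult)
next
  case zero then show ?case using lin_zero[OF f] lin_zero[OF g] W by simp
qed

text \<open>By linearity pure tensors suffice, and there the claim holds face by face as soon as the
  operation on tuples commutes with every contraction. The left and the right action are both of
  this form.\<close>

lemma bar_differential_commute:
  assumes L': "lin (T (n + 3)) (T (n + 3)) L'" and L: "lin (T (n + 2)) (T (n + 2)) L"
    and p': "\<And>xs. xs \<in> tuples A (n + 3) \<Longrightarrow> p' xs \<in> tuples A (n + 3) \<and> L' (pure_tensor A xs) = pure_tensor A (p' xs)"
    and p: "\<And>xs. xs \<in> tuples A (n + 2) \<Longrightarrow> L (pure_tensor A xs) = pure_tensor A (p xs)"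
    and *: "\<And>xs i. xs \<in> tuples A (n + 3) \<Longrightarrow> i \<le> n + 1 \<Longrightarrow> contract i (p' xs) = p (contract i xs)"
    and t: "t \<in> carrier (T (n + 3))"
  shows "bar_differential A (n + 1) (L' t) = L (bar_differential A (n + 1) t)"
proof (rule lin_tensor_power_eq[where W = "T (n + 2)" and n = "n + 3", OF kspace_T _ _ _ t])
  have d: "lin (T (n + 3)) (T (n + 2)) (bar_differential A (n + 1))"
    using lin_bar_differential[of "n + 1"] by (simp add: numeral_3_eq_3)
  show "lin (T (n + 3)) (T (n + 2)) (\<lambda>t. bar_differential A (n + 1) (L' t))"
    by (rule lin_comp[OF L' d])
  show "lin (T (n + 3)) (T (n + 2)) (\<lambda>t. L (bar_differential A (n + 1) t))"
    by (rule lin_comp[OF d L])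
  fix xs assume xs: "xs \<in> tuples A (n + 3)"
  let ?c = "\<lambda>i. (-1) ^ i \<odot>\<^bsub>T (n + 2)\<^esub> pure_tensor A (contract i xs)"
  have dp: "bar_differential A (n + 1) (pure_tensor A ys) =
      (\<Oplus>\<^bsub>T (n + 2)\<^esub> i \<in> {..n + 1}. (-1) ^ i \<odot>\<^bsub>T (n + 2)\<^esub> pure_tensor A (contract i ys))"
    if "ys \<in> tuples A (n + 3)" for ys
    using bar_differential_pure[of ys "n + 1"] that by (simp add: numeral_3_eq_3)
  have ct: "contract i xs \<in> tuples A (n + 2)" if "i \<le> n + 1" for i
    using that xs by (intro contract_tuples) (auto simp: numeral_3_eq_3)
  have l: "L (?c i) = (-1) ^ i \<odot>\<^bsub>T (n + 2)\<^esub> pure_tensor A (contract i (p' xs))" if "i \<le> n + 1" for i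
    using lin_smult[OF L] p[OF ct[OF that]] *[OF xs that] pure_tensor_closed[OF kspace ct[OF that]] by simp
  have "bar_differential A (n + 1) (L' (pure_tensor A xs)) =
      (\<Oplus>\<^bsub>T (n + 2)\<^esub> i \<in> {..n + 1}. (-1) ^ i \<odot>\<^bsub>T (n + 2)\<^esub> pure_tensor A (contract i (p' xs)))"
    using p'[OF xs] dp[of "p' xs"] by simp
  also have "\<dots> = (\<Oplus>\<^bsub>T (n + 2)\<^esub> i \<in> {..n + 1}. L (?c i))"
  proof (rule abelian_monoid.finsum_cong'[OF abelian_group.axioms(1)[OF kspace_abelian_group[OF kspace_T]]])
    show "(\<lambda>i. L (?c i)) \<in> {..n + 1} \<rightarrow> carrier (T (n + 2))"
      using lin_closed[OF L] kspace_smult[OF kspace_T] pure_tensor_closed[OF kspace ct]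
      by (auto simp del: add_2_eq_Suc')
    show "(-1) ^ i \<odot>\<^bsub>T (n + 2)\<^esub> pure_tensor A (contract i (p' xs)) = L (?c i)" if "i \<in> {..n + 1}" for i
      using l[of i] that by simp
  qed simp
  also have "\<dots> = L (\<Oplus>\<^bsub>T (n + 2)\<^esub> i \<in> {..n + 1}. ?c i)"
    using kspace_smult[OF kspace_T] pure_tensor_closed[OF kspace ct]
    by (intro lin_apply_finsum[OF kspace_T kspace_T L, symmetric]) (auto simp del: add_2_eq_Suc')
  also have "\<dots> = L (bar_differential A (n + 1) (pure_tensor A xs))"
    using dp[OF xs] by simp
  finally show "bar_differential A (n + 1) (L' (pure_tensor A xs)) = L (bar_differential A (n + 1) (pure_tensor A xs))" .
qed

lemma bar_differential_lact:
  assumes a: "a \<in> carrier A" and t: "t \<in> carrier (T (n + 3))"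
  shows "bar_differential A (n + 1) (lact (Bar (n + 1)) a t) = lact (Bar n) a (bar_differential A (n + 1) t)"
proof (rule bar_differential_commute[OF _ bar_lact(1)[OF a] _ bar_lact(2)[OF a] _ t])
  show "lin (T (n + 3)) (T (n + 3)) (lact (Bar (n + 1)) a)"
    using bar_lact(1)[OF a, of "n + 1"] by (simp add: numeral_3_eq_3)
next
  fix xs assume xs: "xs \<in> tuples A (n + 3)"
  then show "xs[0 := a \<otimes> xs ! 0] \<in> tuples A (n + 3) \<and>
      lact (Bar (n + 1)) a (pure_tensor A xs) = pure_tensor A (xs[0 := a \<otimes> xs ! 0])"
    using bar_lact(2)[OF a, of xs "n + 1"] a tuples_nth[OF xs, of 0]
    by (auto simp: numeral_3_eq_3 intro!: tuples_update)
  \<comment> \<open>Only the contraction at index 0 merges the altered entry, and there the claim is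
    associativity.\<close>
  show "contract i (xs[0 := a \<otimes> xs ! 0]) = (contract i xs)[0 := a \<otimes> (contract i xs) ! 0]" if "i \<le> n + 1" for i
    using that a xs tuples_nth[OF xs, of 0] tuples_nth[OF xs, of 1]
    by (cases i) (auto simp: tuples_length contract_update nth_contract m_assoc)
qed assumption

lemma bar_differential_ract:
  assumes a: "a \<in> carrier A" and t: "t \<in> carrier (T (n + 3))"
  shows "bar_differential A (n + 1) (ract (Bar (n + 1)) t a) = ract (Bar n) (bar_differential A (n + 1) t) a"
proof (rule bar_differential_commute[where L' = "\<lambda>t. ract (Bar (n + 1)) t a" and L = "\<lambda>t. ract (Bar n) t a",
      OF _ bar_ract(1)[OF a] _ bar_ract(2)[OF a] _ t])
  show "lin (T (n + 3)) (T (n + 3)) (\<lambda>t. ract (Bar (n + 1)) t a)"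
    using bar_ract(1)[OF a, of "n + 1"] by (simp add: numeral_3_eq_3)
next
  fix xs assume xs: "xs \<in> tuples A (n + 3)"
  then show "xs[n + 2 := xs ! (n + 2) \<otimes> a] \<in> tuples A (n + 3) \<and>
      ract (Bar (n + 1)) (pure_tensor A xs) a = pure_tensor A (xs[n + 2 := xs ! (n + 2) \<otimes> a])"
    using bar_ract(2)[OF a, of xs "n + 1"] a tuples_nth[OF xs, of "n + 2"]
    by (auto simp: numeral_3_eq_3 intro!: tuples_update)
  \<comment> \<open>Every contraction moves the last entry from index \<open>n + 2\<close> to
    \<open>n + 1\<close>; only the one at \<open>n + 1\<close> merges it, and there the claim is
    associativity.\<close>
  show "contract i (xs[n + 2 := xs ! (n + 2) \<otimes> a]) =
      (contract i xs)[n + 1 := (contract i xs) ! (n + 1) \<otimes> a]" if "i \<le> n + 1" for i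
    using that a xs tuples_nth[OF xs, of "n + 2"] tuples_nth[OF xs, of "n + 1"]
    by (cases "i = n + 1") (auto simp: tuples_length contract_update nth_contract m_assoc)
qed assumption

end

section \<open>First Hochschild homology as a kernel\<close>

context kalgebra
begin

abbreviation "N \<equiv> regular_bimodule A"

lemma regular_bimodule_simps [simp]:
  "carrier N = carrier A" "add N = add A" "module.smult N = module.smult A" "zero N = zero A"
  "lact N = (\<otimes>)" "ract N = (\<otimes>)"
  by (simp_all add: regular_bimodule_def module.defs bimodule.defs)

abbreviation "X n \<equiv> carrier A \<times> carrier (T (n + 2))"
abbreviation "rel n \<equiv> bitensor_relations A N (Bar n)"
abbreviation "C n \<equiv> bitensor A N (Bar n)"

lemma bar_lact_closed: "a \<in> carrier A \<Longrightarrow> t \<in> carrier (T (n + 2)) \<Longrightarrow> lact (Bar n) a t \<in> carrier (T (n + 2))"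
  by (rule lin_closed[OF bar_lact(1)])

lemma bar_ract_closed: "a \<in> carrier A \<Longrightarrow> t \<in> carrier (T (n + 2)) \<Longrightarrow> ract (Bar n) t a \<in> carrier (T (n + 2))"
  by (rule lin_closed[OF bar_ract(1)])

lemma rel_carrier: "rel n \<subseteq> carrier (free_space (X n))"
  unfolding bitensor_relations_def Let_def using kspace bar_lact_closed[of _ _ n] bar_ract_closed[of _ _ n]
  by (auto simp del: free_space_simps free_space_minus add_2_eq_Suc'
      intro!: kspace_minus kspace_add kspace_smult single_carrier)

lemma C_presented: "C n = presented (X n) (rel n)"
  by (simp add: bitensor_def)

lemma kspace_C [simp]: "kspace (C n)"
  unfolding C_presented by (rule kspace_presented[OF rel_carrier])

text \<open>The pure tensor of \<open>x\<close> and \<open>t\<close> over the enveloping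
  algebra.\<close>

definition tens :: "nat \<Rightarrow> 'r \<Rightarrow> ('r list \<Rightarrow> 'k) set \<Rightarrow> ('r \<times> ('r list \<Rightarrow> 'k) set \<Rightarrow> 'k) set" where
  "tens n x t = generator (X n) (rel n) (x, t)"

lemma tens:
  shows tens_closed: "x \<in> carrier A \<Longrightarrow> t \<in> carrier (T (n + 2)) \<Longrightarrow> tens n x t \<in> carrier (C n)"
    and lin_tens_left: "t \<in> carrier (T (n + 2)) \<Longrightarrow> lin A (C n) (\<lambda>x. tens n x t)"
    and lin_tens_right: "x \<in> carrier A \<Longrightarrow> lin (T (n + 2)) (C n) (tens n x)"
    and tens_lact: "a \<in> carrier A \<Longrightarrow> x \<in> carrier A \<Longrightarrow> t \<in> carrier (T (n + 2)) \<Longrightarrow>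
      tens n x (lact (Bar n) a t) = tens n (x \<otimes> a) t"
    and tens_ract: "a \<in> carrier A \<Longrightarrow> x \<in> carrier A \<Longrightarrow> t \<in> carrier (T (n + 2)) \<Longrightarrow>
      tens n x (ract (Bar n) t a) = tens n (a \<otimes> x) t"
proof -
  let ?F = "free_space (X n) :: ('k, _) module"
  let ?q = "\<lambda>v. LinearCombinations.module.span class_ring ?F (rel n) +>\<^bsub>?F\<^esub> v"
  note q = lin_presented_coset[OF rel_carrier[of n], folded C_presented]
  note eq = presented_relation_eq[OF rel_carrier[of n]]
  have t: "tens n x t = ?q (single (x, t))" for x t
    by (simp add: tens_def generator_def)
  show cl: "tens n x t \<in> carrier (C n)" if "x \<in> carrier A" "t \<in> carrier (T (n + 2))" for x t
    unfolding t using that by (intro lin_closed[OF q]) simp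
  show "lin A (C n) (\<lambda>x. tens n x t)" if tT: "t \<in> carrier (T (n + 2))" for t
  proof (rule linI)
    fix x y assume x: "x \<in> carrier A" and y: "y \<in> carrier A"
    have "?q (single (x \<oplus> y, t)) = ?q (single (x, t) \<oplus>\<^bsub>?F\<^esub> single (y, t))"
    proof (rule eq)
      show "single (x \<oplus> y, t) \<ominus>\<^bsub>?F\<^esub> (single (x, t) \<oplus>\<^bsub>?F\<^esub> single (y, t)) \<in> rel n"
        unfolding bitensor_relations_def Let_def using x y tT by (intro UnI1 CollectI) auto
    qed (use x y tT in \<open>auto simp del: free_space_simps add_2_eq_Suc' intro!: kspace_add single_carrier\<close>)
    also have "\<dots> = ?q (single (x, t)) \<oplus>\<^bsub>C n\<^esub> ?q (single (y, t))"
      using x y tT by (intro lin_add[OF q] single_carrier) auto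
    finally show "tens n (x \<oplus> y) t = tens n x t \<oplus>\<^bsub>C n\<^esub> tens n y t" by (simp add: t)
  next
    fix c x assume x: "x \<in> carrier A"
    have "?q (single (c \<odot> x, t)) = ?q (c \<odot>\<^bsub>?F\<^esub> single (x, t))"
    proof (rule eq)
      show "single (c \<odot> x, t) \<ominus>\<^bsub>?F\<^esub> (c \<odot>\<^bsub>?F\<^esub> single (x, t)) \<in> rel n"
        unfolding bitensor_relations_def Let_def using x tT
        by (intro UnI1[of _ "_ \<union> _ \<union> _"] UnI1 UnI2 CollectI) auto
    qed (use x tT kspace in \<open>auto simp del: free_space_simps add_2_eq_Suc' intro!: kspace_smult single_carrier\<close>)
    also have "\<dots> = c \<odot>\<^bsub>C n\<^esub> ?q (single (x, t))"
      using x tT by (intro lin_smult[OF q] single_carrier) auto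
    finally show "tens n (c \<odot> x) t = c \<odot>\<^bsub>C n\<^esub> tens n x t" by (simp add: t)
  qed (use cl tT in auto)
  show "lin (T (n + 2)) (C n) (tens n x)" if x: "x \<in> carrier A" for x
  proof (rule linI)
    fix s t' assume s: "s \<in> carrier (T (n + 2))" and t': "t' \<in> carrier (T (n + 2))"
    have "?q (single (x, s \<oplus>\<^bsub>T (n + 2)\<^esub> t')) = ?q (single (x, s) \<oplus>\<^bsub>?F\<^esub> single (x, t'))"
    proof (rule eq)
      show "single (x, s \<oplus>\<^bsub>T (n + 2)\<^esub> t') \<ominus>\<^bsub>?F\<^esub> (single (x, s) \<oplus>\<^bsub>?F\<^esub> single (x, t')) \<in> rel n"
        unfolding bitensor_relations_def Let_def using x s t'
        by (intro UnI1 UnI2 CollectI) auto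
    qed (use x s t' in \<open>auto simp del: free_space_simps add_2_eq_Suc' intro!: kspace_add single_carrier\<close>)
    also have "\<dots> = ?q (single (x, s)) \<oplus>\<^bsub>C n\<^esub> ?q (single (x, t'))"
      using x s t' by (intro lin_add[OF q] single_carrier) auto
    finally show "tens n x (s \<oplus>\<^bsub>T (n + 2)\<^esub> t') = tens n x s \<oplus>\<^bsub>C n\<^esub> tens n x t'" by (simp add: t)
  next
    fix c s assume s: "s \<in> carrier (T (n + 2))"
    have "?q (single (x, c \<odot>\<^bsub>T (n + 2)\<^esub> s)) = ?q (c \<odot>\<^bsub>?F\<^esub> single (x, s))"
    proof (rule eq)
      show "single (x, c \<odot>\<^bsub>T (n + 2)\<^esub> s) \<ominus>\<^bsub>?F\<^esub> (c \<odot>\<^bsub>?F\<^esub> single (x, s)) \<in> rel n"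
        unfolding bitensor_relations_def Let_def using x s
        by (intro UnI1 UnI2 CollectI) auto
    qed (use x s in \<open>auto simp del: free_space_simps add_2_eq_Suc' intro!: kspace_smult single_carrier\<close>)
    also have "\<dots> = c \<odot>\<^bsub>C n\<^esub> ?q (single (x, s))"
      using x s by (intro lin_smult[OF q] single_carrier) auto
    finally show "tens n x (c \<odot>\<^bsub>T (n + 2)\<^esub> s) = c \<odot>\<^bsub>C n\<^esub> tens n x s" by (simp add: t)
  qed (use cl x in auto)
  show "tens n x (lact (Bar n) a t) = tens n (x \<otimes> a) t"
    if "a \<in> carrier A" "x \<in> carrier A" "t \<in> carrier (T (n + 2))"
    unfolding t
  proof (rule eq[symmetric])
    show "single (x \<otimes> a, t) \<ominus>\<^bsub>?F\<^esub> single (x, lact (Bar n) a t) \<in> rel n"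
      unfolding bitensor_relations_def Let_def using that by (intro UnI1 UnI2 CollectI) auto
  qed (use that bar_lact_closed[of _ _ n] in \<open>auto simp del: add_2_eq_Suc' intro!: single_carrier\<close>)
  show "tens n x (ract (Bar n) t a) = tens n (a \<otimes> x) t"
    if "a \<in> carrier A" "x \<in> carrier A" "t \<in> carrier (T (n + 2))"
    unfolding t
  proof (rule eq[symmetric])
    show "single (a \<otimes> x, t) \<ominus>\<^bsub>?F\<^esub> single (x, ract (Bar n) t a) \<in> rel n"
      unfolding bitensor_relations_def Let_def using that by (intro UnI2 CollectI) auto
  qed (use that bar_ract_closed[of _ _ n] in \<open>auto simp del: add_2_eq_Suc' intro!: single_carrier\<close>)
qed

text \<open>Universal property of the tensor product over the enveloping algebra. The six families
  of relations come in three shapes, for additivity, scalars and balancing, which are handled by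
  \<open>m1\<close>, \<open>m2\<close> and \<open>m3\<close>.\<close>

lemma C_map:
  fixes W :: "('k, 'm, 'e) module_scheme"
  assumes W: "kspace W"
    and l1: "\<And>t. t \<in> carrier (T (n + 2)) \<Longrightarrow> lin A W (\<lambda>x. g x t)"
    and l2: "\<And>x. x \<in> carrier A \<Longrightarrow> lin (T (n + 2)) W (g x)"
    and b1: "\<And>a x t. a \<in> carrier A \<Longrightarrow> x \<in> carrier A \<Longrightarrow> t \<in> carrier (T (n + 2)) \<Longrightarrow>
      g (x \<otimes> a) t = g x (lact (Bar n) a t)"
    and b2: "\<And>a x t. a \<in> carrier A \<Longrightarrow> x \<in> carrier A \<Longrightarrow> t \<in> carrier (T (n + 2)) \<Longrightarrow>
      g (a \<otimes> x) t = g x (ract (Bar n) t a)"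
  shows "lin (C n) W (presented_map W (\<lambda>(x, t). g x t))"
    and "x \<in> carrier A \<Longrightarrow> t \<in> carrier (T (n + 2)) \<Longrightarrow> presented_map W (\<lambda>(x, t). g x t) (tens n x t) = g x t"
proof -
  let ?f = "\<lambda>(x, t). g x t"
  let ?F = "free_space (X n) :: ('k, _) module"
  let ?L = "linear_extension W ?f"
  have f: "\<And>p. p \<in> X n \<Longrightarrow> ?f p \<in> carrier W" using l1 lin_closed by fastforce
  note l = lin_linear_extension[of W "X n" ?f, OF W f]
  have s: "?L (single (x, t)) = g x t" if "x \<in> carrier A" "t \<in> carrier (T (n + 2))" for x t
    using linear_extension_single[of W "X n" ?f "(x, t)", OF W f] that by simp
  have m: "?L (u \<ominus>\<^bsub>?F\<^esub> v) = \<zero>\<^bsub>W\<^esub>"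
    if "u \<in> carrier ?F" "v \<in> carrier ?F" "?L u = ?L v" for u v
    using that by (simp only: lin_minus[OF l kspace_free_space W] kspace_minus_self[OF W] lin_closed[OF l])
  have m1: "?L (single p \<ominus>\<^bsub>?F\<^esub> (single p' \<oplus>\<^bsub>?F\<^esub> single p'')) = \<zero>\<^bsub>W\<^esub>"
    if "p \<in> X n" "p' \<in> X n" "p'' \<in> X n" "?f p = ?f p' \<oplus>\<^bsub>W\<^esub> ?f p''" for p p' p''
    using that lin_add[OF l single_carrier single_carrier, of p' p'']
    by (intro m kspace_add kspace_free_space single_carrier)
      (auto simp: s simp del: free_space_simps add_2_eq_Suc')
  have m2: "?L (single p \<ominus>\<^bsub>?F\<^esub> (c \<odot>\<^bsub>?F\<^esub> single p')) = \<zero>\<^bsub>W\<^esub>"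
    if "p \<in> X n" "p' \<in> X n" "?f p = c \<odot>\<^bsub>W\<^esub> ?f p'" for p p' c
    using that lin_smult[OF l single_carrier, of p' c]
    by (intro m kspace_smult kspace_free_space single_carrier)
      (auto simp: s simp del: free_space_simps add_2_eq_Suc')
  have m3: "?L (single p \<ominus>\<^bsub>?F\<^esub> single p') = \<zero>\<^bsub>W\<^esub>"
    if "p \<in> X n" "p' \<in> X n" "?f p = ?f p'" for p p'
    using that by (intro m single_carrier) (auto simp: s simp del: add_2_eq_Suc')
  have rel0: "?L r = \<zero>\<^bsub>W\<^esub>" if "r \<in> rel n" for r
    using that kspace unfolding bitensor_relations_def Let_def
    by (elim UnE CollectE exE conjE; hypsubst)
      (auto simp: lin_add[OF l1] lin_add[OF l2] lin_smult[OF l1] lin_smult[OF l2]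
        bar_lact_closed bar_ract_closed simp del: free_space_simps free_space_minus add_2_eq_Suc'
        intro!: m1 m2 m3 intro: b1 b2)
  show "lin (C n) W (presented_map W ?f)"
    unfolding C_presented by (rule lin_presented_map[OF rel_carrier W f rel0])
  show "presented_map W ?f (tens n x t) = g x t" if "x \<in> carrier A" "t \<in> carrier (T (n + 2))"
    using presented_map_generator[of "rel n" "X n" W ?f "(x, t)", OF rel_carrier W f rel0] that
    by (simp add: tens_def)
qed

lemma C_induct_tens [consumes 1, case_names tens add smult zero]:
  assumes "v \<in> carrier (C n)"
    and "\<And>x t. x \<in> carrier A \<Longrightarrow> t \<in> carrier (T (n + 2)) \<Longrightarrow> P (tens n x t)"
    and "\<And>v w. v \<in> carrier (C n) \<Longrightarrow> w \<in> carrier (C n) \<Longrightarrow> P v \<Longrightarrow> P w \<Longrightarrow> P (v \<oplus>\<^bsub>C n\<^esub> w)"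
    and "\<And>c v. v \<in> carrier (C n) \<Longrightarrow> P v \<Longrightarrow> P (c \<odot>\<^bsub>C n\<^esub> v)"
    and "P \<zero>\<^bsub>C n\<^esub>"
  shows "P v"
  by (rule presented_induct[OF rel_carrier, of v n P, folded C_presented])
    (use assms in \<open>auto simp: tens_def simp del: add_2_eq_Suc'\<close>)

definition el :: "nat \<Rightarrow> 'r \<Rightarrow> 'r list \<Rightarrow> ('r \<times> ('r list \<Rightarrow> 'k) set \<Rightarrow> 'k) set" where
  "el n x as = tens n x (pure_tensor A (\<one> # as @ [\<one>]))"

lemma tuples_bordered: "as \<in> tuples A n \<Longrightarrow> a \<in> carrier A \<Longrightarrow> b \<in> carrier A \<Longrightarrow> a # as @ [b] \<in> tuples A (n + 2)"
  by (auto simp: tuples_def)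

lemma pure_bordered_closed:
  "as \<in> tuples A n \<Longrightarrow> a \<in> carrier A \<Longrightarrow> b \<in> carrier A \<Longrightarrow> pure_tensor A (a # as @ [b]) \<in> carrier (T (n + 2))"
  by (rule pure_tensor_closed[OF kspace tuples_bordered])

lemma el_closed: "x \<in> carrier A \<Longrightarrow> as \<in> tuples A n \<Longrightarrow> el n x as \<in> carrier (C n)"
  unfolding el_def by (intro tens_closed pure_bordered_closed) auto

lemma lin_el: "as \<in> tuples A n \<Longrightarrow> lin A (C n) (\<lambda>x. el n x as)"
  unfolding el_def by (intro lin_tens_left pure_bordered_closed) auto

lemma multilinear_el:
  assumes x: "x \<in> carrier A"
  shows "multilinear A n (C n) (el n x)"
proof (rule multilinearI)
  fix as i assume as: "as \<in> tuples A n" and i: "i < n"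
  show "lin A (C n) (\<lambda>y. el n x (as[i := y]))"
    using lin_comp[OF multilinear_lin[OF multilinear_pure_tensor[OF kspace] tuples_bordered[OF as], of \<one> \<one> "Suc i"]
        lin_tens_right[OF x]] i as
    by (simp add: el_def list_update_append1 tuples_length)
qed (rule el_closed[OF x])

text \<open>Moving the outer factors across the tensor sign closes the tensor into a cycle:
  \<open>a\<close> arrives to the right of \<open>x\<close> and \<open>b\<close> to its
  left.\<close>

lemma tens_pure_bordered:
  assumes "x \<in> carrier A" "a \<in> carrier A" "b \<in> carrier A" and as: "as \<in> tuples A n"
  shows "tens n x (pure_tensor A (a # as @ [b])) = el n (b \<otimes> x \<otimes> a) as"
proof -
  have "pure_tensor A (a # as @ [b]) = lact (Bar n) a (pure_tensor A (\<one> # as @ [b]))"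
    using bar_lact(2)[OF assms(2) tuples_bordered[OF as], of \<one> b] assms by simp
  moreover have "pure_tensor A (\<one> # as @ [b]) = ract (Bar n) (pure_tensor A (\<one> # as @ [\<one>])) b"
    using bar_ract(2)[OF assms(3) tuples_bordered[OF as], of \<one> \<one>] assms as
    by (simp add: tuples_length nth_append list_update_append)
  ultimately show ?thesis
    using assms by (simp add: tens_lact tens_ract bar_ract_closed pure_bordered_closed el_def m_assoc
        del: add_2_eq_Suc')
qed

lemma tuples_bordered_cases:
  assumes "xs \<in> tuples A (n + 2)"
  obtains a as b where "xs = a # as @ [b]" "a \<in> carrier A" "b \<in> carrier A" "as \<in> tuples A n"
proof -
  obtain a ys where "xs = a # ys" "length ys = n + 1" using assms by (cases xs) (auto simp: tuples_def)
  moreover from this obtain as b where "ys = as @ [b]" by (cases ys rule: rev_cases) auto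
  ultimately show ?thesis using assms that[of a as b] by (auto simp: tuples_def)
qed

lemma C_induct [consumes 1, case_names el add smult zero]:
  assumes v: "v \<in> carrier (C n)"
    and el: "\<And>x as. x \<in> carrier A \<Longrightarrow> as \<in> tuples A n \<Longrightarrow> P (el n x as)"
    and add: "\<And>v w. v \<in> carrier (C n) \<Longrightarrow> w \<in> carrier (C n) \<Longrightarrow> P v \<Longrightarrow> P w \<Longrightarrow> P (v \<oplus>\<^bsub>C n\<^esub> w)"
    and smult: "\<And>c v. v \<in> carrier (C n) \<Longrightarrow> P v \<Longrightarrow> P (c \<odot>\<^bsub>C n\<^esub> v)"
    and zero: "P \<zero>\<^bsub>C n\<^esub>"
  shows "P v"
  using v
proof (induction rule: C_induct_tens)
  case (tens x t)
  from tens(2) show ?case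
  proof (induction rule: T_induct)
    case (pure xs)
    then show ?case by (rule tuples_bordered_cases) (auto simp: tens_pure_bordered tens(1) intro!: el)
  next
    case (add s t)
    then show ?case using lin_add[OF lin_tens_right[OF tens(1)], of s n t] assms(3) tens_closed[OF tens(1)] by simp
  next
    case (smult c t)
    then show ?case using lin_smult[OF lin_tens_right[OF tens(1)], of t n c] assms(4) tens_closed[OF tens(1)] by simp
  next
    case zero
    then show ?case using lin_zero[OF lin_tens_right[OF tens(1)] kspace_T kspace_C] assms(5) by simp
  qed
qed (use assms in auto)

text \<open>Universal property of \<open>C n\<close> seen as A tensored with the n-th tensor power.
  The auxiliary \<open>\<psi>\<close> is forced: by \<open>tens_pure_bordered\<close> the outer
  factors \<open>a\<close> and \<open>b\<close> can only enter through
  \<open>b \<otimes> x \<otimes> a\<close>.\<close>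

lemma C_map_el:
  fixes W :: "('k, 'm, 'e) module_scheme"
  assumes W: "kspace W" and l: "\<And>as. as \<in> tuples A n \<Longrightarrow> lin A W (\<lambda>x. \<phi> x as)"
    and m: "\<And>x. x \<in> carrier A \<Longrightarrow> multilinear A n W (\<phi> x)"
  obtains F where "lin (C n) W F" "\<And>x as. x \<in> carrier A \<Longrightarrow> as \<in> tuples A n \<Longrightarrow> F (el n x as) = \<phi> x as"
proof -
  define \<psi> where "\<psi> x xs = \<phi> (last xs \<otimes> x \<otimes> hd xs) (butlast (tl xs))" for x xs
  have \<psi>: "\<psi> x (a # as @ [b]) = \<phi> (b \<otimes> x \<otimes> a) as" for x a as b
    by (simp add: \<psi>_def)
  have m\<psi>: "multilinear A (n + 2) W (\<psi> x)" if x: "x \<in> carrier A" for x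
  proof (rule multilinearI)
    fix xs assume xs: "xs \<in> tuples A (n + 2)"
    then obtain a as b where ab: "xs = a # as @ [b]" "a \<in> carrier A" "b \<in> carrier A" "as \<in> tuples A n"
      by (rule tuples_bordered_cases)
    show "\<psi> x xs \<in> carrier W" unfolding ab(1) \<psi> using ab x by (intro multilinear_closed[OF m]) auto
    fix i assume i: "i < n + 2"
    consider "i = 0" | "i = n + 1" | j where "i = Suc j" "j < n"
      using i by (cases i) (auto simp: less_Suc_eq)
    then show "lin A W (\<lambda>y. \<psi> x (xs[i := y]))"
    proof cases
      case 1
      have "lin A W (\<lambda>y. \<phi> (b \<otimes> x \<otimes> y) as)"
        by (rule lin_comp[OF lin_mult_left l]) (use ab x in auto)
      then show ?thesis using 1 ab by (simp add: \<psi>)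
    next
      case 2
      have "lin A W (\<lambda>y. \<phi> (y \<otimes> x \<otimes> a) as)"
        by (rule lin_comp[OF lin_comp[OF lin_mult_right lin_mult_right] l]) (use ab x in auto)
      then show ?thesis using 2 ab by (simp add: \<psi> tuples_length list_update_append)
    next
      case 3
      have "lin A W (\<lambda>y. \<phi> (b \<otimes> x \<otimes> a) (as[j := y]))"
        by (rule multilinear_lin[OF m]) (use ab x 3 in auto)
      then show ?thesis using 3 ab by (simp add: \<psi> tuples_length list_update_append)
    qed
  qed
  define g where "g x = presented_map W (\<psi> x)" for x
  have gp: "g x (pure_tensor A xs) = \<psi> x xs" if "x \<in> carrier A" "xs \<in> tuples A (n + 2)" for x xs
    unfolding g_def by (rule tensor_power_map_pure[OF kspace W m\<psi>]) (use that in auto)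
  have l2: "lin (T (n + 2)) W (g x)" if "x \<in> carrier A" for x
    unfolding g_def by (rule lin_tensor_power_map[OF kspace W m\<psi>[OF that]])
  have l1: "lin A W (\<lambda>x. g x t)" if "t \<in> carrier (T (n + 2))" for t
    using that
  proof (induction rule: T_induct)
    case (pure xs)
    then obtain a as b where ab: "xs = a # as @ [b]" "a \<in> carrier A" "b \<in> carrier A" "as \<in> tuples A n"
      by (rule tuples_bordered_cases)
    have "lin A W (\<lambda>x. \<phi> (b \<otimes> x \<otimes> a) as)"
      by (rule lin_comp[OF lin_comp[OF lin_mult_left lin_mult_right] l]) (use ab in auto)
    then show ?case
      using lin_cong[OF _ kspace, of "\<lambda>x. g x (pure_tensor A xs)" "\<lambda>x. \<phi> (b \<otimes> x \<otimes> a) as" W] pure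
      by (simp add: gp ab(1) \<psi>)
  next
    case (add s t)
    then show ?case
      using lin_cong[OF _ kspace, of "\<lambda>x. g x (s \<oplus>\<^bsub>T (n + 2)\<^esub> t)" "\<lambda>x. g x s \<oplus>\<^bsub>W\<^esub> g x t" W]
        lin_plus[OF W add.IH] by (simp add: lin_add[OF l2] del: add_2_eq_Suc')
  next
    case (smult c t)
    then show ?case
      using lin_cong[OF _ kspace, of "\<lambda>x. g x (c \<odot>\<^bsub>T (n + 2)\<^esub> t)" "\<lambda>x. c \<odot>\<^bsub>W\<^esub> g x t" W]
        lin_scale[OF W smult.IH] by (simp add: lin_smult[OF l2] del: add_2_eq_Suc')
  next
    case zero
    then show ?case
      using lin_cong[OF _ kspace, of "\<lambda>x. g x (\<zero>\<^bsub>T (n + 2)\<^esub>)" "\<lambda>x. \<zero>\<^bsub>W\<^esub>" W]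
        lin_const_zero[OF W, of A] lin_zero[OF l2 kspace_T W] by (simp del: add_2_eq_Suc')
  qed
  have b1: "g (x \<otimes> a) t = g x (lact (Bar n) a t)"
    if "a \<in> carrier A" "x \<in> carrier A" "t \<in> carrier (T (n + 2))" for a x t
  proof (rule lin_tensor_power_eq[OF W l2 lin_comp[OF bar_lact(1) l2] _ that(3)])
    fix xs assume xs: "xs \<in> tuples A (n + 2)"
    then obtain a' as b where ab: "xs = a' # as @ [b]" "a' \<in> carrier A" "b \<in> carrier A" "as \<in> tuples A n"
      by (rule tuples_bordered_cases)
    show "g (x \<otimes> a) (pure_tensor A xs) = g x (lact (Bar n) a (pure_tensor A xs))"
      using xs that ab tuples_bordered[OF ab(4), of "a \<otimes> a'" b]
      by (simp add: gp bar_lact(2) \<psi> m_assoc del: add_2_eq_Suc')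
  qed (use that in auto)
  have b2: "g (a \<otimes> x) t = g x (ract (Bar n) t a)"
    if "a \<in> carrier A" "x \<in> carrier A" "t \<in> carrier (T (n + 2))" for a x t
  proof (rule lin_tensor_power_eq[OF W l2 lin_comp[OF bar_ract(1) l2] _ that(3)])
    fix xs assume xs: "xs \<in> tuples A (n + 2)"
    then obtain a' as b where ab: "xs = a' # as @ [b]" "a' \<in> carrier A" "b \<in> carrier A" "as \<in> tuples A n"
      by (rule tuples_bordered_cases)
    have "xs[n + 1 := xs ! (n + 1) \<otimes> a] = a' # as @ [b \<otimes> a]"
      using ab by (simp add: tuples_length nth_append list_update_append)
    then show "g (a \<otimes> x) (pure_tensor A xs) = g x (ract (Bar n) (pure_tensor A xs) a)"
      using xs that ab tuples_bordered[OF ab(4), of a' "b \<otimes> a"]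
      by (simp only: gp bar_ract(2) m_closed) (simp add: \<psi> m_assoc)
  qed (use that in auto)
  note C = C_map[OF W l1 l2 b1 b2]
  show ?thesis
  proof
    show "lin (C n) W (presented_map W (\<lambda>(x, t). g x t))" by (rule C(1))
    show "presented_map W (\<lambda>(x, t). g x t) (el n x as) = \<phi> x as" if "x \<in> carrier A" "as \<in> tuples A n" for x as
    proof -
      have "presented_map W (\<lambda>(x, t). g x t) (el n x as) = g x (pure_tensor A (\<one> # as @ [\<one>]))"
        unfolding el_def by (rule C(2)) (use that in \<open>auto simp del: add_2_eq_Suc' intro: pure_bordered_closed\<close>)
      then show ?thesis using that gp[OF that(1) tuples_bordered[OF that(2)]] by (simp add: \<psi>)
    qed
  qed
qed

abbreviation "D n \<equiv> bitensor_map A N (Bar n) (bar_differential A (n + 1))"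

lemma D:
  shows lin_D: "lin (C (n + 1)) (C n) (D n)"
    and D_tens: "x \<in> carrier A \<Longrightarrow> t \<in> carrier (T (n + 3)) \<Longrightarrow> D n (tens (n + 1) x t) = tens n x (bar_differential A (n + 1) t)"
proof -
  let ?g = "\<lambda>x t. tens n x (bar_differential A (n + 1) t)"
  have n: "n + 1 + 2 = n + 3" by simp
  have d: "lin (T (n + 3)) (T (n + 2)) (bar_differential A (n + 1))"
    using lin_bar_differential[of "n + 1"] by (simp add: numeral_3_eq_3)
  have Dn: "D n = presented_map (C n) (\<lambda>(x, t). ?g x t)"
    by (simp add: bitensor_map_def tens_def[abs_def])
  have l1: "lin A (C n) (\<lambda>x. ?g x t)" if "t \<in> carrier (T (n + 3))" for t
    by (rule lin_tens_left[OF lin_closed[OF d that]])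
  have l2: "lin (T (n + 3)) (C n) (?g x)" if "x \<in> carrier A" for x
    by (rule lin_comp[OF d lin_tens_right[OF that]])
  have b1: "?g (x \<otimes> a) t = ?g x (lact (Bar (n + 1)) a t)"
    if "a \<in> carrier A" "x \<in> carrier A" "t \<in> carrier (T (n + 3))" for a x t
    using that lin_closed[OF d] by (simp only: bar_differential_lact tens_lact)
  have b2: "?g (a \<otimes> x) t = ?g x (ract (Bar (n + 1)) t a)"
    if "a \<in> carrier A" "x \<in> carrier A" "t \<in> carrier (T (n + 3))" for a x t
    using that lin_closed[OF d] by (simp only: bar_differential_ract tens_ract)
  note * = C_map[where n = "n + 1" and g = ?g, unfolded n, OF kspace_C l1 l2 b1 b2]
  show "lin (C (n + 1)) (C n) (D n)" unfolding Dn by (rule *(1))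
  show "D n (tens (n + 1) x t) = ?g x t" if "x \<in> carrier A" "t \<in> carrier (T (n + 3))"
    unfolding Dn by (rule *(2)) (use that in auto)
qed

end

text \<open>Coset operations do not refer to the carrier, so restricting to a subspace before or
  after the quotient gives the same record, not merely an isomorphic one. Homology is defined by
  taking the kernel first, whereas \<open>Om\<close> is formed by taking the quotient first.\<close>

lemma quotient_restrict:
  "quotient (V\<lparr>carrier := K\<rparr>) U = (quotient V U)\<lparr>carrier := (\<lambda>v. U +>\<^bsub>V\<^esub> v) ` K\<rparr>"
proof -
  let ?V = "V\<lparr>carrier := K\<rparr>"
  have 1: "a_r_coset ?V = a_r_coset V" by (intro ext) (simp add: a_r_coset_def')
  have 2: "set_add ?V = set_add V" by (intro ext) (simp add: set_add_def')
  have 3: "rcoset_mult ?V U = rcoset_mult V U" by (intro ext) (simp add: rcoset_mult_def 1)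
  have 4: "a_rcosets\<^bsub>?V\<^esub> U = (\<lambda>v. U +>\<^bsub>V\<^esub> v) ` K" by (auto simp: A_RCOSETS_def' 1)
  show ?thesis by (simp add: quotient_def FactRing_def ring.defs module.defs 1 2 3 4)
qed

lemma finsum_atMost_1:
  assumes W: "kspace W" and f: "f 0 \<in> carrier W" "f 1 \<in> carrier W"
  shows "(\<Oplus>\<^bsub>W\<^esub> i \<in> {..1 :: nat}. f i) = f 0 \<oplus>\<^bsub>W\<^esub> f 1"
proof -
  have "{..1 :: nat} = insert 0 {1}" by auto
  moreover have "(\<Oplus>\<^bsub>W\<^esub> i \<in> {1 :: nat}. f i) = f 1"
    using finsum_insert_kspace[OF W, of "{}" "1 :: nat" f] f W by (simp add: finsum_empty_kspace)
  ultimately show ?thesis using finsum_insert_kspace[OF W, of "{1}" "0 :: nat" f] f by auto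
qed

lemma finsum_atMost_2:
  assumes W: "kspace W" and f: "f 0 \<in> carrier W" "f 1 \<in> carrier W" "f 2 \<in> carrier W"
  shows "(\<Oplus>\<^bsub>W\<^esub> i \<in> {..2 :: nat}. f i) = f 0 \<oplus>\<^bsub>W\<^esub> (f 1 \<oplus>\<^bsub>W\<^esub> f 2)"
proof -
  have "{..2 :: nat} = insert 2 {..1}" by auto
  moreover have "f i \<in> carrier W" if "i \<in> insert 2 {..1 :: nat}" for i
    using that f by (cases "i = 0"; cases "i = 1"; cases "i = 2") auto
  ultimately have "(\<Oplus>\<^bsub>W\<^esub> i \<in> {..2 :: nat}. f i) = f 2 \<oplus>\<^bsub>W\<^esub> (f 0 \<oplus>\<^bsub>W\<^esub> f 1)"
    using finsum_insert_kspace[OF W, of "{..1 :: nat}" 2 f] finsum_atMost_1[of W f, OF W f(1,2)] by simp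
  then show ?thesis using f W kspace_comm[OF W, of "f 2"] by (simp add: kspace_assoc)
qed

section \<open>Low-degree Hochschild boundaries and one-forms modulo commutators\<close>

context kalgebra
begin

lemma D0_el:
  assumes "x \<in> carrier A" "a \<in> carrier A"
  shows "D 0 (el 1 x [a]) = el 0 (x \<otimes> a) [] \<oplus>\<^bsub>C 0\<^esub> ((- 1) \<odot>\<^bsub>C 0\<^esub> el 0 (a \<otimes> x) [])"
proof -
  have tup: "[\<one>, a, \<one>] \<in> tuples A 3" "[a, \<one>] \<in> tuples A 2" "[\<one>, a] \<in> tuples A 2"
    using assms by (auto simp: tuples_def)
  note cl = pure_tensor_closed[OF kspace tup(2)] pure_tensor_closed[OF kspace tup(3)]
  have "bar_differential A 1 (pure_tensor A [\<one>, a, \<one>]) =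
      (\<Oplus>\<^bsub>T 2\<^esub> i \<in> {..1}. (-1) ^ i \<odot>\<^bsub>T 2\<^esub> pure_tensor A (contract i [\<one>, a, \<one>]))"
    using bar_differential_pure[of "[\<one>, a, \<one>]" 1] tup by (simp add: numeral_2_eq_2 numeral_3_eq_3)
  also have "\<dots> = pure_tensor A [a, \<one>] \<oplus>\<^bsub>T 2\<^esub> ((- 1) \<odot>\<^bsub>T 2\<^esub> pure_tensor A [\<one>, a])"
    using assms cl kspace_smult[OF kspace_T cl(2), of "-1"]
    by (subst finsum_atMost_1) (simp_all add: contract_def)
  finally have d: "bar_differential A 1 (pure_tensor A [\<one>, a, \<one>]) =
      pure_tensor A [a, \<one>] \<oplus>\<^bsub>T 2\<^esub> ((- 1) \<odot>\<^bsub>T 2\<^esub> pure_tensor A [\<one>, a])" .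
  have "D 0 (el 1 x [a]) = tens 0 x (bar_differential A 1 (pure_tensor A [\<one>, a, \<one>]))"
    using D_tens[OF assms(1), of _ 0] pure_tensor_closed[OF kspace tup(1)] by (simp add: el_def)
  also have "\<dots> = tens 0 x (pure_tensor A [a, \<one>]) \<oplus>\<^bsub>C 0\<^esub> ((- 1) \<odot>\<^bsub>C 0\<^esub> tens 0 x (pure_tensor A [\<one>, a]))"
    using lin_add[OF lin_tens_right[OF assms(1), of 0]] lin_smult[OF lin_tens_right[OF assms(1), of 0]] cl
      kspace_smult[OF kspace_T cl(2)] unfolding d by (simp add: numeral_2_eq_2)
  also have "\<dots> = el 0 (x \<otimes> a) [] \<oplus>\<^bsub>C 0\<^esub> ((- 1) \<odot>\<^bsub>C 0\<^esub> el 0 (a \<otimes> x) [])"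
    using tens_pure_bordered[OF assms(1), of a \<one> "[]" 0] tens_pure_bordered[OF assms(1), of \<one> a "[]" 0] assms
    by (simp add: tuples_def)
  finally show ?thesis .
qed

lemma D1_el:
  assumes "x \<in> carrier A" "a \<in> carrier A" "b \<in> carrier A"
  shows "D 1 (el 2 x [a, b]) =
    el 1 (x \<otimes> a) [b] \<oplus>\<^bsub>C 1\<^esub> (((- 1) \<odot>\<^bsub>C 1\<^esub> el 1 x [a \<otimes> b]) \<oplus>\<^bsub>C 1\<^esub> el 1 (b \<otimes> x) [a])"
proof -
  have tup: "[\<one>, a, b, \<one>] \<in> tuples A 4" "[a, b, \<one>] \<in> tuples A 3" "[\<one>, a \<otimes> b, \<one>] \<in> tuples A 3"
      "[\<one>, a, b] \<in> tuples A 3"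
    using assms by (auto simp: tuples_def)
  note cl = pure_tensor_closed[OF kspace tup(2)] pure_tensor_closed[OF kspace tup(3)]
    pure_tensor_closed[OF kspace tup(4)]
  have "bar_differential A 2 (pure_tensor A [\<one>, a, b, \<one>]) =
      (\<Oplus>\<^bsub>T 3\<^esub> i \<in> {..2}. (-1) ^ i \<odot>\<^bsub>T 3\<^esub> pure_tensor A (contract i [\<one>, a, b, \<one>]))"
    using bar_differential_pure[of "[\<one>, a, b, \<one>]" 2] tup by (simp add: numeral_eq_Suc)
  also have "\<dots> =
      pure_tensor A [a, b, \<one>] \<oplus>\<^bsub>T 3\<^esub> (((- 1) \<odot>\<^bsub>T 3\<^esub> pure_tensor A [\<one>, a \<otimes> b, \<one>]) \<oplus>\<^bsub>T 3\<^esub> pure_tensor A [\<one>, a, b])"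
    using assms cl kspace_smult[OF kspace_T cl(2), of "-1"]
    by (subst finsum_atMost_2) (simp_all add: contract_def numeral_2_eq_2)
  finally have d: "bar_differential A 2 (pure_tensor A [\<one>, a, b, \<one>]) = pure_tensor A [a, b, \<one>] \<oplus>\<^bsub>T 3\<^esub>
      (((- 1) \<odot>\<^bsub>T 3\<^esub> pure_tensor A [\<one>, a \<otimes> b, \<one>]) \<oplus>\<^bsub>T 3\<^esub> pure_tensor A [\<one>, a, b])" .
  have l: "lin (T 3) (C 1) (tens 1 x)" using lin_tens_right[OF assms(1), of 1] by (simp add: numeral_3_eq_3)
  have "D 1 (el 2 x [a, b]) = tens 1 x (bar_differential A 2 (pure_tensor A [\<one>, a, b, \<one>]))"
    using D_tens[OF assms(1), of "pure_tensor A [\<one>, a, b, \<one>]" 1] pure_tensor_closed[OF kspace tup(1)]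
    by (simp add: el_def numeral_2_eq_2[symmetric])
  also have "\<dots> = tens 1 x (pure_tensor A [a, b, \<one>]) \<oplus>\<^bsub>C 1\<^esub>
      (((- 1) \<odot>\<^bsub>C 1\<^esub> tens 1 x (pure_tensor A [\<one>, a \<otimes> b, \<one>])) \<oplus>\<^bsub>C 1\<^esub> tens 1 x (pure_tensor A [\<one>, a, b]))"
    using cl unfolding d by (simp add: lin_add[OF l] lin_smult[OF l] del: One_nat_def)
  also have "\<dots> = el 1 (x \<otimes> a) [b] \<oplus>\<^bsub>C 1\<^esub> (((- 1) \<odot>\<^bsub>C 1\<^esub> el 1 x [a \<otimes> b]) \<oplus>\<^bsub>C 1\<^esub> el 1 (b \<otimes> x) [a])"
    using tens_pure_bordered[OF assms(1), of a \<one> "[b]" 1] tens_pure_bordered[OF assms(1), of \<one> \<one> "[a \<otimes> b]" 1]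
      tens_pure_bordered[OF assms(1), of \<one> b "[a]" 1] assms
    by (simp add: tuples_def)
  finally show ?thesis .
qed

lemma lin_C_eq:
  assumes W: "kspace W" and f: "lin (C n) W f" and g: "lin (C n) W g"
    and eq: "\<And>x as. x \<in> carrier A \<Longrightarrow> as \<in> tuples A n \<Longrightarrow> f (el n x as) = g (el n x as)"
    and v: "v \<in> carrier (C n)"
  shows "f v = g v"
  using v
proof (induction rule: C_induct)
  case el then show ?case by (rule eq)
next
  case add then show ?case using f g by (simp add: lin_add)
next
  case smult then show ?case using f g by (simp add: lin_smult)
next
  case zero then show ?case using lin_zero[OF f] lin_zero[OF g] W by simp
qed

lemma singleton_tuple: "a \<in> carrier A \<Longrightarrow> [a] \<in> tuples A 1"
  by (simp add: tuples_def)

lemma lin_el_1_right: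
  assumes "x \<in> carrier A"
  shows "lin A (C 1) (\<lambda>a. el 1 x [a])"
  using multilinear_lin[OF multilinear_el[OF assms], of "[\<zero>]" 1 0] by (simp add: tuples_def)

text \<open>The class \<open>om x a\<close> plays the role of the noncommutative one-form \<open>x da\<close>, taken modulo commutators.\<close>

definition boundaries where "boundaries = D 1 ` carrier (C 2)"

definition Om where "Om = quotient (C 1) boundaries"

definition om where "om x a = boundaries +>\<^bsub>C 1\<^esub> el 1 x [a]"

lemma boundary_subspace: "is_subspace (C 1) boundaries"
  using is_subspace_im[OF kspace_C kspace_C lin_D[of 1]] by (simp add: numeral_2_eq_2 boundaries_def)

lemma kspace_Om [simp]: "kspace Om"
  unfolding Om_def by (rule kspace_quotient[OF kspace_C boundary_subspace])

lemma lin_Om_coset: "lin (C 1) Om (\<lambda>v. boundaries +>\<^bsub>C 1\<^esub> v)"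
  unfolding Om_def by (rule lin_coset[OF kspace_C boundary_subspace])

lemma lin_om_left: "a \<in> carrier A \<Longrightarrow> lin A Om (\<lambda>x. om x a)"
  unfolding om_def by (rule lin_comp[OF lin_el lin_Om_coset]) (rule singleton_tuple)

lemma lin_om_right: "x \<in> carrier A \<Longrightarrow> lin A Om (om x)"
  unfolding om_def by (rule lin_comp[OF lin_el_1_right lin_Om_coset])

lemma om_closed: "x \<in> carrier A \<Longrightarrow> a \<in> carrier A \<Longrightarrow> om x a \<in> carrier Om"
  by (rule lin_closed[OF lin_om_right])

text \<open>This is the vanishing of the boundary of x \<otimes> a \<otimes> b, that is, of xa
  \<otimes> b - x \<otimes> ab + bx \<otimes> a.\<close>

lemma om_Leibniz:
  assumes "x \<in> carrier A" "a \<in> carrier A" "b \<in> carrier A"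
  shows "om x (a \<otimes> b) = om (x \<otimes> a) b \<oplus>\<^bsub>Om\<^esub> om (b \<otimes> x) a"
proof -
  let ?u = "el 1 (x \<otimes> a) [b]" and ?v = "el 1 x [a \<otimes> b]" and ?w = "el 1 (b \<otimes> x) [a]"
  have cl: "?u \<in> carrier (C 1)" "?v \<in> carrier (C 1)" "?w \<in> carrier (C 1)"
    using assms by (auto intro!: el_closed singleton_tuple simp del: One_nat_def)
  have "D 1 (el 2 x [a, b]) \<in> boundaries"
    unfolding boundaries_def using assms by (intro imageI el_closed) (auto simp: tuples_def)
  moreover have "D 1 (el 2 x [a, b]) = (?u \<oplus>\<^bsub>C 1\<^esub> ?w) \<ominus>\<^bsub>C 1\<^esub> ?v"
    unfolding D1_el[OF assms] using cl
    using kspace_comm[OF kspace_C kspace_smult[OF kspace_C cl(2), of "- 1"] cl(3)]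
    by (simp add: kspace_minus_eq kspace_assoc del: One_nat_def)
  ultimately have "om x (a \<otimes> b) = boundaries +>\<^bsub>C 1\<^esub> (?u \<oplus>\<^bsub>C 1\<^esub> ?w)"
    using coset_eq_iff[OF kspace_C boundary_subspace, of "?u \<oplus>\<^bsub>C 1\<^esub> ?w" ?v] cl
    by (simp add: om_def)
  then show ?thesis using lin_add[OF lin_Om_coset cl(1,3)] by (simp add: om_def)
qed

lemma Om_induct [consumes 1, case_names om add smult zero]:
  assumes "v \<in> carrier Om"
    and "\<And>x a. x \<in> carrier A \<Longrightarrow> a \<in> carrier A \<Longrightarrow> P (om x a)"
    and "\<And>v w. v \<in> carrier Om \<Longrightarrow> w \<in> carrier Om \<Longrightarrow> P v \<Longrightarrow> P w \<Longrightarrow> P (v \<oplus>\<^bsub>Om\<^esub> w)"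
    and "\<And>c v. v \<in> carrier Om \<Longrightarrow> P v \<Longrightarrow> P (c \<odot>\<^bsub>Om\<^esub> v)"
    and "P \<zero>\<^bsub>Om\<^esub>"
  shows "P v"
proof -
  let ?q = "\<lambda>v. boundaries +>\<^bsub>C 1\<^esub> v"
  obtain u where u: "u \<in> carrier (C 1)" "v = ?q u"
    using assms(1) unfolding Om_def by (auto simp: quotient_carrier[OF kspace_C boundary_subspace] simp del: One_nat_def)
  have "P (?q u)" using u(1)
  proof (induction rule: C_induct)
    case (el x as)
    then obtain a where "as = [a]" "a \<in> carrier A" by (cases as) (auto simp: tuples_def)
    then show ?case using assms(2)[of x a] el by (simp add: om_def del: One_nat_def)
  next
    case (add v w)
    then show ?case using assms(3) lin_add[OF lin_Om_coset] lin_closed[OF lin_Om_coset] by (simp del: One_nat_def)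
  next
    case (smult c v)
    then show ?case using assms(4) lin_smult[OF lin_Om_coset] lin_closed[OF lin_Om_coset] by (simp del: One_nat_def)
  next
    case zero
    then show ?case using assms(5) lin_zero[OF lin_Om_coset kspace_C kspace_Om] by (simp del: One_nat_def)
  qed
  then show ?thesis using u by simp
qed

text \<open>Conversely, the Leibniz rule is the only relation beyond bilinearity. Two maps are
  obtained from this: the commutator map, and the map that bounds the relations among arrow
  forms.\<close>

lemma Om_map:
  fixes W :: "('k, 'm, 'e) module_scheme"
  assumes W: "kspace W"
    and l1: "\<And>a. a \<in> carrier A \<Longrightarrow> lin A W (\<lambda>x. \<phi> x a)"
    and l2: "\<And>x. x \<in> carrier A \<Longrightarrow> lin A W (\<phi> x)"
    and Leibniz: "\<And>x a b. x \<in> carrier A \<Longrightarrow> a \<in> carrier A \<Longrightarrow> b \<in> carrier A \<Longrightarrow>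
      \<phi> x (a \<otimes> b) = \<phi> (x \<otimes> a) b \<oplus>\<^bsub>W\<^esub> \<phi> (b \<otimes> x) a"
  obtains F where "lin Om W F" "\<And>x a. x \<in> carrier A \<Longrightarrow> a \<in> carrier A \<Longrightarrow> F (om x a) = \<phi> x a"
proof -
  have m: "multilinear A 1 W (\<lambda>as. \<phi> x (hd as))" if x: "x \<in> carrier A" for x
  proof (rule multilinearI)
    fix as i assume as: "as \<in> tuples A 1" and "i < (1::nat)"
    then obtain a where "as = [a]" "a \<in> carrier A" "i = 0" by (cases as) (auto simp: tuples_def)
    then show "lin A W (\<lambda>y. \<phi> x (hd (as[i := y])))" using l2[OF x] by simp
  next
    fix as assume "as \<in> tuples A 1"
    then show "\<phi> x (hd as) \<in> carrier W"
      using lin_closed[OF l2[OF x]] by (cases as) (auto simp: tuples_def)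
  qed
  have hd: "hd as \<in> carrier A" if "as \<in> tuples A 1" for as using that by (cases as) (auto simp: tuples_def)
  obtain G where G: "lin (C 1) W G"
    and Gel: "\<And>x as. x \<in> carrier A \<Longrightarrow> as \<in> tuples A 1 \<Longrightarrow> G (el 1 x as) = \<phi> x (hd as)"
  proof -
    show thesis by (rule C_map_el[OF W l1[OF hd] m]) (assumption | rule that)+
  qed
  have Ga: "G (el 1 x [a]) = \<phi> x a" if "x \<in> carrier A" "a \<in> carrier A" for x a
    using Gel[OF that(1) singleton_tuple[OF that(2)]] by simp
  have lD: "lin (C 2) (C 1) (D 1)" using lin_D[of 1] by (simp add: numeral_2_eq_2)
  have kill: "G (D 1 v) = \<zero>\<^bsub>W\<^esub>" if "v \<in> carrier (C 2)" for v
    using that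
  proof (rule lin_C_eq[OF W lin_comp[OF lD G] lin_const_zero[OF W], rotated])
    fix x as assume x: "x \<in> carrier A" and "as \<in> tuples A 2"
    then obtain a b where as: "as = [a, b]" "a \<in> carrier A" "b \<in> carrier A"
      by (auto simp: tuples_def length_Suc_conv numeral_2_eq_2)
    let ?u = "el 1 (x \<otimes> a) [b]" and ?v = "el 1 x [a \<otimes> b]" and ?w = "el 1 (b \<otimes> x) [a]"
    have cl: "?u \<in> carrier (C 1)" "?v \<in> carrier (C 1)" "?w \<in> carrier (C 1)"
      using as x by (auto intro!: el_closed singleton_tuple simp del: One_nat_def)
    have c\<phi>: "\<phi> (x \<otimes> a) b \<in> carrier W" "\<phi> (b \<otimes> x) a \<in> carrier W"
      using as x by (auto intro!: lin_closed[OF l2])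
    have "G (D 1 (el 2 x as)) = \<phi> (x \<otimes> a) b \<oplus>\<^bsub>W\<^esub> (((- 1) \<odot>\<^bsub>W\<^esub> \<phi> x (a \<otimes> b)) \<oplus>\<^bsub>W\<^esub> \<phi> (b \<otimes> x) a)"
      unfolding as(1) D1_el[OF x as(2,3)] using cl x as by (simp add: lin_add[OF G] lin_smult[OF G] Ga del: One_nat_def)
    also have "\<dots> = (\<phi> (x \<otimes> a) b \<oplus>\<^bsub>W\<^esub> \<phi> (b \<otimes> x) a) \<ominus>\<^bsub>W\<^esub> \<phi> x (a \<otimes> b)"
      using c\<phi> W kspace_comm[OF W, of "(- 1) \<odot>\<^bsub>W\<^esub> \<phi> x (a \<otimes> b)" "\<phi> (b \<otimes> x) a"]
        lin_closed[OF l2[OF x] m_closed[OF as(2,3)]]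
      by (simp add: kspace_minus_eq kspace_assoc)
    also have "\<dots> = \<zero>\<^bsub>W\<^esub>" using c\<phi> W Leibniz[OF x as(2,3)] by simp
    finally show "G (D 1 (el 2 x as)) = \<zero>\<^bsub>W\<^esub>" .
  qed
  show ?thesis
  proof
    show "lin Om W (\<lambda>Y. the_elem (G ` Y))"
      unfolding Om_def by (rule lin_quotient_map[OF kspace_C boundary_subspace W G]) (use kill in \<open>auto simp: boundaries_def\<close>)
    show "the_elem (G ` om x a) = \<phi> x a" if "x \<in> carrier A" "a \<in> carrier A" for x a
      unfolding om_def
      by (subst the_elem_image_coset[OF kspace_C boundary_subspace W G])
        (use kill that Ga el_closed singleton_tuple in \<open>auto simp: boundaries_def simp del: One_nat_def\<close>)
  qed
qed

text \<open>\<open>C 0\<close> is a copy of the algebra, since x \<mapsto> \<open>el 0 x []\<close>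
  inverts \<mu> on generators. Hence the kernel of \<open>D 0\<close> can be tested inside the
  algebra.\<close>

lemma el_0_map:
  obtains \<mu> where "lin (C 0) A \<mu>" "\<And>x. x \<in> carrier A \<Longrightarrow> \<mu> (el 0 x []) = x"
    "\<And>v. v \<in> carrier (C 0) \<Longrightarrow> \<mu> v = \<zero> \<Longrightarrow> v = \<zero>\<^bsub>C 0\<^esub>"
proof -
  have m: "multilinear A 0 A (\<lambda>as. x)" if "x \<in> carrier A" for x
    using that by (auto simp: multilinear_def)
  have id: "lin A A (\<lambda>x. x)" by (rule linI) auto
  obtain \<mu> where \<mu>: "lin (C 0) A \<mu>"
    "\<And>x as. x \<in> carrier A \<Longrightarrow> as \<in> tuples A 0 \<Longrightarrow> \<mu> (el 0 x as) = x"
  proof -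
    show thesis by (rule C_map_el[OF kspace id m]) (assumption | rule that)+
  qed
  have nil: "[] \<in> tuples A 0" by (simp add: tuples_def)
  have "lin (C 0) (C 0) (\<lambda>v. v)" by (rule linI) auto
  then have inv: "el 0 (\<mu> v) [] = v" if "v \<in> carrier (C 0)" for v
    using lin_C_eq[OF kspace_C lin_comp[OF \<mu>(1) lin_el[OF nil]] _ _ that] \<mu>(2)
    by (auto simp: tuples_def)
  have "v = \<zero>\<^bsub>C 0\<^esub>" if "v \<in> carrier (C 0)" "\<mu> v = \<zero>" for v
    using inv[OF that(1)] that(2) lin_zero[OF lin_el[OF nil] kspace kspace_C] by simp
  then show ?thesis using that[OF \<mu>(1)] \<mu>(2) nil by blast
qed

lemma HH1_eq:
  obtains \<delta> where "lin Om A \<delta>"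
    "\<And>x a. x \<in> carrier A \<Longrightarrow> a \<in> carrier A \<Longrightarrow> \<delta> (om x a) = x \<otimes> a \<ominus> a \<otimes> x"
    "HH1 A = Om\<lparr>carrier := {v \<in> carrier Om. \<delta> v = \<zero>}\<rparr>"
proof -
  let ?U = "boundaries"
  let ?K = "{v \<in> carrier (C 1). D 0 v = \<zero>\<^bsub>C 0\<^esub>}"
  obtain \<mu> where \<mu>: "lin (C 0) A \<mu>" "\<And>x. x \<in> carrier A \<Longrightarrow> \<mu> (el 0 x []) = x"
    "\<And>v. v \<in> carrier (C 0) \<Longrightarrow> \<mu> v = \<zero> \<Longrightarrow> v = \<zero>\<^bsub>C 0\<^esub>"
    using el_0_map by blast
  have minus: "x \<ominus> y = x \<oplus> ((- 1) \<odot> y)" if "x \<in> carrier A" "y \<in> carrier A" for x y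
    using kspace_minus_eq[OF kspace that] .
  \<comment> \<open>The commutator satisfies the Leibniz rule by telescoping through bxa.\<close>
  have L: "x \<otimes> (a \<otimes> b) \<ominus> (a \<otimes> b) \<otimes> x = (x \<otimes> a \<otimes> b \<ominus> b \<otimes> (x \<otimes> a)) \<oplus> (b \<otimes> x \<otimes> a \<ominus> a \<otimes> (b \<otimes> x))"
    if "x \<in> carrier A" "a \<in> carrier A" "b \<in> carrier A" for x a b
    using that by (simp add: minus_eq m_assoc a_assoc r_neg1)
  obtain \<delta> where \<delta>: "lin Om A \<delta>"
    "\<And>x a. x \<in> carrier A \<Longrightarrow> a \<in> carrier A \<Longrightarrow> \<delta> (om x a) = x \<otimes> a \<ominus> a \<otimes> x"
  proof (rule Om_map[OF kspace, of "\<lambda>x a. x \<otimes> a \<ominus> a \<otimes> x"])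
    show "lin A A (\<lambda>x. x \<otimes> a \<ominus> a \<otimes> x)" if "a \<in> carrier A" for a
      using lin_cong[OF _ kspace, of "\<lambda>x. x \<otimes> a \<ominus> a \<otimes> x" "\<lambda>x. x \<otimes> a \<oplus> ((- 1) \<odot> (a \<otimes> x))" A] that
        lin_plus[OF kspace lin_mult_right[OF that] lin_scale[OF kspace lin_mult_left[OF that]]] by (simp add: minus)
    show "lin A A (\<lambda>a. x \<otimes> a \<ominus> a \<otimes> x)" if "x \<in> carrier A" for x
      using lin_cong[OF _ kspace, of "\<lambda>a. x \<otimes> a \<ominus> a \<otimes> x" "\<lambda>a. x \<otimes> a \<oplus> ((- 1) \<odot> (a \<otimes> x))" A] that
        lin_plus[OF kspace lin_mult_left[OF that] lin_scale[OF kspace lin_mult_right[OF that]]] by (simp add: minus)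
  qed (use L in auto)
  have lD: "lin (C 1) (C 0) (D 0)" using lin_D[of 0] by simp
  \<comment> \<open>The commutator map is \<open>D 0\<close> seen through \<mu>; as \<mu> vanishes
    only at zero, both conditions cut out the same classes.\<close>
  have \<delta>\<mu>: "\<delta> (?U +>\<^bsub>C 1\<^esub> v) = \<mu> (D 0 v)" if "v \<in> carrier (C 1)" for v
  proof (rule lin_C_eq[OF kspace lin_comp[OF lin_Om_coset \<delta>(1)] lin_comp[OF lD \<mu>(1)] _ that])
    fix x as assume x: "x \<in> carrier A" and "as \<in> tuples A 1"
    then obtain a where as: "as = [a]" "a \<in> carrier A" by (cases as) (auto simp: tuples_def)
    have "[] \<in> tuples A 0" by (simp add: tuples_def)
    then show "\<delta> (?U +>\<^bsub>C 1\<^esub> el 1 x as) = \<mu> (D 0 (el 1 x as))"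
      using \<delta>(2)[OF x as(2)] D0_el[OF x as(2)] x as
      by (simp add: as om_def[symmetric] lin_add[OF \<mu>(1)] lin_smult[OF \<mu>(1)] el_closed \<mu>(2) minus
          del: One_nat_def)
  qed
  have ker: "(\<delta> (?U +>\<^bsub>C 1\<^esub> v) = \<zero>) = (D 0 v = \<zero>\<^bsub>C 0\<^esub>)" if "v \<in> carrier (C 1)" for v
    unfolding \<delta>\<mu>[OF that]
    by (rule iffI, erule \<mu>(3)[OF lin_closed[OF lD that]]) (simp only: lin_zero[OF \<mu>(1) kspace_C kspace])
  have carr: "carrier Om = (\<lambda>v. ?U +>\<^bsub>C 1\<^esub> v) ` carrier (C 1)"
    unfolding Om_def by (rule quotient_carrier[OF kspace_C boundary_subspace])
  have "{v \<in> carrier Om. \<delta> v = \<zero>} = (\<lambda>v. ?U +>\<^bsub>C 1\<^esub> v) ` ?K"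
  proof (intro subset_antisym subsetI)
    fix w assume "w \<in> {v \<in> carrier Om. \<delta> v = \<zero>}"
    then obtain v where v: "v \<in> carrier (C 1)" "w = ?U +>\<^bsub>C 1\<^esub> v" "\<delta> w = \<zero>"
      unfolding carr by blast
    then show "w \<in> (\<lambda>v. ?U +>\<^bsub>C 1\<^esub> v) ` ?K" using ker[OF v(1)] by blast
  next
    fix w assume "w \<in> (\<lambda>v. ?U +>\<^bsub>C 1\<^esub> v) ` ?K"
    then obtain v where v: "v \<in> carrier (C 1)" "w = ?U +>\<^bsub>C 1\<^esub> v" "D 0 v = \<zero>\<^bsub>C 0\<^esub>" by blast
    then show "w \<in> {v \<in> carrier Om. \<delta> v = \<zero>}" using ker[OF v(1)] unfolding carr by blast
  qed
  moreover have "HH1 A = quotient (C 1\<lparr>carrier := ?K\<rparr>) ?U"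
    by (simp add: HH1_def hochschild_H1_def homology_space_def boundaries_def numeral_2_eq_2)
  moreover have "quotient (C 1\<lparr>carrier := ?K\<rparr>) ?U = Om\<lparr>carrier := (\<lambda>v. ?U +>\<^bsub>C 1\<^esub> v) ` ?K\<rparr>"
    unfolding Om_def by (rule quotient_restrict)
  ultimately have "HH1 A = Om\<lparr>carrier := {v \<in> carrier Om. \<delta> v = \<zero>}\<rparr>" by simp
  then show ?thesis using that[OF \<delta>] by simp
qed

end

section \<open>Monomial algebras\<close>

lemma kspace_update_mult: "kspace V \<Longrightarrow> kspace (V\<lparr>mult := m, one := e\<rparr>)"
  for V :: "('k::field, 'm) module"
proof (rule kspaceI)
  fix x assume "kspace V" "x \<in> carrier (V\<lparr>mult := m, one := e\<rparr>)"
  then show "x \<oplus>\<^bsub>V\<lparr>mult := m, one := e\<rparr>\<^esub> ((- 1) \<odot>\<^bsub>V\<lparr>mult := m, one := e\<rparr>\<^esub> x) = \<zero>\<^bsub>V\<lparr>mult := m, one := e\<rparr>\<^esub>"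
    using kspace_minus_eq[of V x x] kspace_minus_self[of V x] by simp
next
  fix x y assume "kspace V" "x \<in> carrier (V\<lparr>mult := m, one := e\<rparr>)" "y \<in> carrier (V\<lparr>mult := m, one := e\<rparr>)"
  then show "x \<oplus>\<^bsub>V\<lparr>mult := m, one := e\<rparr>\<^esub> y = y \<oplus>\<^bsub>V\<lparr>mult := m, one := e\<rparr>\<^esub> x"
    using kspace_comm[of V x y] by simp
qed (simp_all add: kspace_assoc kspace_smult_smult kspace_add_smult kspace_smult_add)

context
  fixes R :: "('k::field, 'r) module" (structure) and I
  assumes R: "kalgebra R" and I: "ideal I R"
begin

interpretation R: kalgebra R by (rule R)
interpretation I: ideal I R by (rule I)

text \<open>Scaling by \<open>c\<close> is multiplication by the ring element
  \<open>c \<odot> \<one>\<close>, so a ring ideal is automatically stable under scalars.\<close>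

lemma ideal_subspace: "is_subspace R I"
proof (rule is_subspaceI)
  fix c x assume x: "x \<in> I"
  have "(c \<odot> \<one>) \<otimes> x \<in> I" using x R.kspace by (intro I.I_l_closed) auto
  then show "c \<odot> x \<in> I" using x R.smult_mult_left[of \<one> x c] I.a_subset by auto
qed (use I.a_subset in auto)

lemma quotient_mult:
  "x \<in> carrier R \<Longrightarrow> y \<in> carrier R \<Longrightarrow> (I +> x) \<otimes>\<^bsub>quotient R I\<^esub> (I +> y) = I +> (x \<otimes> y)"
  by (simp add: quotient_def ring.defs module.defs FactRing_def I.rcoset_mult_add)

lemma quotient_one: "\<one>\<^bsub>quotient R I\<^esub> = I +> \<one>"
  by (simp add: quotient_def ring.defs module.defs FactRing_def)

lemma kalgebra_quotient: "kalgebra (quotient R I)"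
proof -
  note carr = quotient_carrier[OF R.kspace ideal_subspace]
    and add = quotient_add[OF R.kspace ideal_subspace] and smult = quotient_smult[OF R.kspace ideal_subspace]
  note K = kspace_quotient[OF R.kspace ideal_subspace]
  have "ring (quotient R I)"
  proof (rule ringI)
    show "abelian_group (quotient R I)" by (rule kspace_abelian_group[OF K])
    show "Group.monoid (quotient R I)"
      by (rule monoidI) (auto simp: carr quotient_mult quotient_one R.m_assoc)
  qed (auto simp: carr quotient_mult add R.l_distr R.r_distr)
  then show ?thesis
    by (intro kalgebra.intro kalgebra_axioms.intro K)
      (use R.kspace in \<open>auto simp: carr quotient_mult smult R.smult_mult_left R.smult_mult_right\<close>)
qed

end

section \<open>Composition of paths and the path algebra\<close>

context wf_digraph
begin

lemma ptarget_conv: "ptarget G (u, p) = (if p = [] then u else head G (last p))"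
  by (simp add: ptarget_def awalk_verts_conv)

lemma ptarget_Nil [simp]: "ptarget G (u, []) = u"
  by (simp add: ptarget_conv)

lemma ptarget_append: "ptarget G (u, p @ q) = ptarget G (ptarget G (u, p), q)"
  by (simp add: ptarget_conv)

lemma paths_iff: "(u, p) \<in> paths G \<longleftrightarrow> awalk u p (ptarget G (u, p))"
  by (auto simp: paths_def ptarget_def)

lemma paths_Nil [simp]: "(u, []) \<in> paths G \<longleftrightarrow> u \<in> verts G"
  by (simp add: paths_iff awalk_Nil_iff)

lemma paths_append: "(u, p @ q) \<in> paths G \<longleftrightarrow> (u, p) \<in> paths G \<and> (ptarget G (u, p), q) \<in> paths G"
  unfolding paths_iff awalk_append_iff ptarget_append by (simp add: ptarget_def)

lemma paths_Cons: "(u, a # p) \<in> paths G \<longleftrightarrow> a \<in> arcs G \<and> u = tail G a \<and> (head G a, p) \<in> paths G"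
  by (auto simp: paths_def awalk_Cons_iff)

lemma psource_in_verts: "\<alpha> \<in> paths G \<Longrightarrow> psource \<alpha> \<in> verts G"
  by (auto simp: paths_def psource_def)

lemma ptarget_in_verts: "\<alpha> \<in> paths G \<Longrightarrow> ptarget G \<alpha> \<in> verts G"
  by (cases \<alpha>) (simp add: paths_iff awalk_last_in_verts)

definition composable :: "('a, 'b) path \<Rightarrow> ('a, 'b) path \<Rightarrow> bool" where
  "composable \<alpha> \<beta> \<longleftrightarrow> ptarget G \<beta> = psource \<alpha>"

lemma psource_pcomp [simp]: "psource (pcomp \<alpha> \<beta>) = psource \<beta>"
  by (simp add: psource_def pcomp_def)

lemma ptarget_pcomp: "composable \<alpha> \<beta> \<Longrightarrow> ptarget G (pcomp \<alpha> \<beta>) = ptarget G \<alpha>"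
  by (cases \<alpha>; cases \<beta>) (simp add: composable_def pcomp_def psource_def ptarget_append)

lemma pcomp_paths: "\<alpha> \<in> paths G \<Longrightarrow> \<beta> \<in> paths G \<Longrightarrow> composable \<alpha> \<beta> \<Longrightarrow> pcomp \<alpha> \<beta> \<in> paths G"
  by (cases \<alpha>; cases \<beta>) (simp add: composable_def pcomp_def psource_def paths_append)

lemma pcomp_assoc: "pcomp (pcomp \<alpha> \<beta>) \<gamma> = pcomp \<alpha> (pcomp \<beta> \<gamma>)"
  by (simp add: pcomp_def)

lemma composable_pcomp_left [simp]: "composable (pcomp \<alpha> \<beta>) \<gamma> \<longleftrightarrow> composable \<beta> \<gamma>"
  by (simp add: composable_def)

lemma composable_pcomp_right: "composable \<beta> \<gamma> \<Longrightarrow> composable \<alpha> (pcomp \<beta> \<gamma>) \<longleftrightarrow> composable \<alpha> \<beta>"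
  by (simp add: composable_def ptarget_pcomp)

definition splits :: "('a, 'b) path \<Rightarrow> (('a, 'b) path \<times> ('a, 'b) path) set" where
  "splits \<gamma> = {(\<alpha>, \<beta>) \<in> paths G \<times> paths G. ptarget G \<beta> = psource \<alpha> \<and> pcomp \<alpha> \<beta> = \<gamma>}"

lemma splits_iff: "(\<alpha>, \<beta>) \<in> splits \<gamma> \<longleftrightarrow> \<alpha> \<in> paths G \<and> \<beta> \<in> paths G \<and> composable \<alpha> \<beta> \<and> pcomp \<alpha> \<beta> = \<gamma>"
  by (auto simp: splits_def composable_def)

text \<open>A factorisation of a path is determined by its cut point in the word.\<close>

lemma finite_splits: "finite (splits \<gamma>)"
proof -
  let ?f = "\<lambda>i. ((ptarget G (fst \<gamma>, take i (snd \<gamma>)), drop i (snd \<gamma>)), (fst \<gamma>, take i (snd \<gamma>)))"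
  have "splits \<gamma> \<subseteq> ?f ` {..length (snd \<gamma>)}"
  proof
    fix x assume "x \<in> splits \<gamma>"
    then obtain u p v q where "x = ((v, q), (u, p))" "v = ptarget G (u, p)" "\<gamma> = (u, p @ q)"
      by (cases x) (auto simp: splits_def psource_def pcomp_def)
    then have "x = ?f (length p)" "length p \<le> length (snd \<gamma>)" by auto
    then show "x \<in> ?f ` {..length (snd \<gamma>)}" by blast
  qed
  then show ?thesis by (rule finite_subset) simp
qed

text \<open>Both sides run over the factorisations into three consecutive paths; \<open>i\<close>
  and \<open>j\<close> only move the brackets. This is associativity of the path algebra.\<close>

lemma splits_assoc:
  "(\<Sum>(\<alpha>, \<beta>) \<in> splits \<gamma>. \<Sum>(\<alpha>', \<beta>') \<in> splits \<alpha>. (F \<alpha>' \<beta>' \<beta> :: 'c :: comm_monoid_add)) =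
   (\<Sum>(\<alpha>, \<beta>) \<in> splits \<gamma>. \<Sum>(\<alpha>', \<beta>') \<in> splits \<beta>. F \<alpha> \<alpha>' \<beta>')"
proof -
  define i :: "(('a, 'b) path \<times> ('a, 'b) path) \<times> (('a, 'b) path \<times> ('a, 'b) path) \<Rightarrow> _" where
    "i x = ((pcomp (fst (fst x)) (fst (snd x)), snd (snd x)), (fst (fst x), fst (snd x)))" for x
  define j :: "(('a, 'b) path \<times> ('a, 'b) path) \<times> (('a, 'b) path \<times> ('a, 'b) path) \<Rightarrow> _" where
    "j x = ((fst (snd x), pcomp (snd (snd x)) (snd (fst x))), (snd (snd x), snd (fst x)))" for x
  have "(\<Sum>(\<alpha>, \<beta>) \<in> splits \<gamma>. \<Sum>(\<alpha>', \<beta>') \<in> splits \<alpha>. F \<alpha>' \<beta>' \<beta>) =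
      (\<Sum>x \<in> Sigma (splits \<gamma>) (\<lambda>x. splits (fst x)). F (fst (snd x)) (snd (snd x)) (snd (fst x)))"
    by (simp add: case_prod_unfold sum.Sigma finite_splits)
  also have "\<dots> = (\<Sum>x \<in> Sigma (splits \<gamma>) (\<lambda>x. splits (snd x)). F (fst (fst x)) (fst (snd x)) (snd (snd x)))"
  proof (rule sum.reindex_bij_witness[of _ i j])
    fix x assume "x \<in> Sigma (splits \<gamma>) (\<lambda>x. splits (fst x))"
    then obtain \<alpha> \<beta> \<alpha>' \<beta>' where x: "x = ((\<alpha>, \<beta>), (\<alpha>', \<beta>'))" and m: "(\<alpha>, \<beta>) \<in> splits \<gamma>" "(\<alpha>', \<beta>') \<in> splits \<alpha>"
      by (metis SigmaE fst_conv prod.exhaust)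
    have \<alpha>: "pcomp \<alpha>' \<beta>' = \<alpha>" using m by (simp add: splits_iff)
    show "i (j x) = x" by (simp add: x i_def j_def \<alpha>)
    show "j x \<in> Sigma (splits \<gamma>) (\<lambda>x. splits (snd x))"
      using m unfolding x j_def splits_iff \<alpha>[symmetric]
      by (simp add: splits_iff pcomp_assoc composable_pcomp_right pcomp_paths)
    show "F (fst (fst (j x))) (fst (snd (j x))) (snd (snd (j x))) = F (fst (snd x)) (snd (snd x)) (snd (fst x))"
      by (simp add: j_def)
  next
    fix x assume "x \<in> Sigma (splits \<gamma>) (\<lambda>x. splits (snd x))"
    then obtain \<alpha> \<beta> \<alpha>' \<beta>' where x: "x = ((\<alpha>, \<beta>), (\<alpha>', \<beta>'))" and m: "(\<alpha>, \<beta>) \<in> splits \<gamma>" "(\<alpha>', \<beta>') \<in> splits \<beta>"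
      by (metis SigmaE snd_conv prod.exhaust)
    have \<beta>: "pcomp \<alpha>' \<beta>' = \<beta>" using m by (simp add: splits_iff)
    show "j (i x) = x" by (simp add: x i_def j_def \<beta>)
    show "i x \<in> Sigma (splits \<gamma>) (\<lambda>x. splits (fst x))"
      using m unfolding x i_def splits_iff \<beta>[symmetric]
      by (auto simp: splits_iff pcomp_assoc composable_pcomp_right pcomp_paths)
  qed
  also have "\<dots> = (\<Sum>(\<alpha>, \<beta>) \<in> splits \<gamma>. \<Sum>(\<alpha>', \<beta>') \<in> splits \<beta>. F \<alpha> \<alpha>' \<beta>')"
    by (simp add: case_prod_unfold sum.Sigma finite_splits)
  finally show ?thesis .
qed

lemma path_algebra_simps [simp]:
  "carrier (path_algebra G) = carrier (free_space (paths G))"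
  "\<zero>\<^bsub>path_algebra G\<^esub> = (\<lambda>x. 0)"
  "f \<oplus>\<^bsub>path_algebra G\<^esub> g = (\<lambda>x. f x + g x)"
  "c \<odot>\<^bsub>path_algebra G\<^esub> f = (\<lambda>x. c * f x)"
  by (simp_all add: path_algebra_def)

lemma path_algebra_mult:
  "(f \<otimes>\<^bsub>path_algebra G\<^esub> g) \<gamma> = (\<Sum>(\<alpha>, \<beta>) \<in> splits \<gamma>. f \<alpha> * g \<beta>)"
  by (simp add: path_algebra_def splits_def)

lemma path_algebra_one: "\<one>\<^bsub>path_algebra G\<^esub> = (\<lambda>\<gamma>. if \<gamma> \<in> vertex_paths G then 1 else 0)"
  by (simp add: path_algebra_def)

lemma kspace_path_algebra: "kspace (path_algebra G :: ('k::field, _) module)"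
  unfolding path_algebra_def by (rule kspace_update_mult) simp

lemma vertex_paths_iff: "(u, p) \<in> vertex_paths G \<longleftrightarrow> u \<in> verts G \<and> p = []"
  by (auto simp: vertex_paths_def)

lemma path_algebra_mult_closed:
  assumes "f \<in> carrier (path_algebra G)" "g \<in> carrier (path_algebra G)"
  shows "f \<otimes>\<^bsub>path_algebra G\<^esub> g \<in> carrier (path_algebra G)"
proof -
  let ?S = "{x \<in> {\<alpha>. f \<alpha> \<noteq> 0} \<times> {\<beta>. g \<beta> \<noteq> 0}. composable (fst x) (snd x)}"
  have "finite ?S" using assms by (auto simp: free_space_carrier)
  moreover have "(\<lambda>x. pcomp (fst x) (snd x)) ` ?S \<subseteq> paths G"
    using assms by (auto simp: free_space_carrier subset_iff intro!: pcomp_paths)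
  moreover have "(f \<otimes>\<^bsub>path_algebra G\<^esub> g) \<gamma> = 0" if "\<gamma> \<notin> (\<lambda>x. pcomp (fst x) (snd x)) ` ?S" for \<gamma>
    unfolding path_algebra_mult using that
    by (intro sum.neutral) (force simp: splits_iff image_iff)
  ultimately show ?thesis
    by (auto intro!: free_space_carrierI[of "(\<lambda>x. pcomp (fst x) (snd x)) ` ?S"])
qed

lemma single_mult:
  assumes "\<alpha> \<in> paths G" "\<beta> \<in> paths G"
  shows "single \<alpha> \<otimes>\<^bsub>path_algebra G\<^esub> single \<beta> =
    (if composable \<alpha> \<beta> then single (pcomp \<alpha> \<beta>) else (\<lambda>x. 0 :: 'k::field))"
proof
  fix \<gamma>
  have "(single \<alpha> \<otimes>\<^bsub>path_algebra G\<^esub> single \<beta>) \<gamma> = (\<Sum>x \<in> splits \<gamma>. if x = (\<alpha>, \<beta>) then 1 else 0 :: 'k)"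
    unfolding path_algebra_mult by (intro sum.cong) (auto simp: single_def split: if_splits)
  also have "\<dots> = (if (\<alpha>, \<beta>) \<in> splits \<gamma> then 1 else 0)" by (simp add: finite_splits)
  also have "\<dots> = (if composable \<alpha> \<beta> then single (pcomp \<alpha> \<beta>) else (\<lambda>x. 0)) \<gamma>"
    using assms by (auto simp: splits_iff single_def)
  finally show "(single \<alpha> \<otimes>\<^bsub>path_algebra G\<^esub> single \<beta>) \<gamma> =
    (if composable \<alpha> \<beta> then single (pcomp \<alpha> \<beta>) else (\<lambda>x. 0 :: 'k)) \<gamma>" .
qed

lemma path_algebra_one_mult:
  assumes f: "f \<in> carrier (path_algebra G)"
  shows "\<one>\<^bsub>path_algebra G\<^esub> \<otimes>\<^bsub>path_algebra G\<^esub> f = f" "f \<otimes>\<^bsub>path_algebra G\<^esub> \<one>\<^bsub>path_algebra G\<^esub> = f"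
proof -
  have f0: "f \<gamma> = 0" if "\<gamma> \<notin> paths G" for \<gamma> using that f by (auto simp: free_space_carrier)
  have e: "splits \<gamma> = {}" if "\<gamma> \<notin> paths G" for \<gamma>
    using that by (auto simp: splits_iff dest: pcomp_paths)
  show "\<one>\<^bsub>path_algebra G\<^esub> \<otimes>\<^bsub>path_algebra G\<^esub> f = f"
  proof
    fix \<gamma> show "(\<one>\<^bsub>path_algebra G\<^esub> \<otimes>\<^bsub>path_algebra G\<^esub> f) \<gamma> = f \<gamma>"
    proof (cases "\<gamma> \<in> paths G")
      case True
      let ?x = "((ptarget G \<gamma>, []), \<gamma>)"
      have "(\<Sum>(\<alpha>, \<beta>) \<in> splits \<gamma>. (if \<alpha> \<in> vertex_paths G then 1 else 0) * f \<beta>) =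
          (\<Sum>x \<in> splits \<gamma>. if x = ?x then f \<gamma> else 0)"
        by (intro sum.cong) (auto simp: splits_iff vertex_paths_iff composable_def pcomp_def psource_def
            split: if_splits)
      moreover have "?x \<in> splits \<gamma>"
        using True by (cases \<gamma>) (auto simp: splits_iff composable_def psource_def pcomp_def ptarget_in_verts)
      ultimately show ?thesis by (simp add: path_algebra_mult path_algebra_one finite_splits)
    qed (simp add: path_algebra_mult e f0)
  qed
  show "f \<otimes>\<^bsub>path_algebra G\<^esub> \<one>\<^bsub>path_algebra G\<^esub> = f"
  proof
    fix \<gamma> show "(f \<otimes>\<^bsub>path_algebra G\<^esub> \<one>\<^bsub>path_algebra G\<^esub>) \<gamma> = f \<gamma>"
    proof (cases "\<gamma> \<in> paths G")
      case True
      let ?x = "(\<gamma>, (psource \<gamma>, []))"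
      have "(\<Sum>(\<alpha>, \<beta>) \<in> splits \<gamma>. f \<alpha> * (if \<beta> \<in> vertex_paths G then 1 else 0)) =
          (\<Sum>x \<in> splits \<gamma>. if x = ?x then f \<gamma> else 0)"
        by (intro sum.cong) (auto simp: splits_iff vertex_paths_iff composable_def pcomp_def psource_def
            split: if_splits)
      moreover have "?x \<in> splits \<gamma>"
        using True psource_in_verts[OF True] by (cases \<gamma>) (auto simp: splits_iff composable_def psource_def pcomp_def)
      ultimately show ?thesis by (simp add: path_algebra_mult path_algebra_one finite_splits)
    qed (simp add: path_algebra_mult e f0)
  qed
qed

lemma kalgebra_path_algebra:
  assumes "finite (verts G)"
  shows "kalgebra (path_algebra G :: ('k::field, _) module)"
proof -
  let ?P = "path_algebra G :: ('k, _) module"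
  have "ring ?P"
  proof (rule ringI)
    show "abelian_group ?P" by (rule kspace_abelian_group[OF kspace_path_algebra])
    show "Group.monoid ?P"
    proof (rule monoidI)
      \<comment> \<open>The unit is the sum of all vertices and has finite support because there are
        finitely many of them.\<close>
      have "vertex_paths G = (\<lambda>v. (v, [])) ` verts G" by (auto simp: vertex_paths_def)
      then show "\<one>\<^bsub>?P\<^esub> \<in> carrier ?P"
        using assms by (auto simp: path_algebra_one intro!: free_space_carrierI[of "vertex_paths G"])
      fix f g h
      have "(f \<otimes>\<^bsub>?P\<^esub> g \<otimes>\<^bsub>?P\<^esub> h) \<gamma> = (f \<otimes>\<^bsub>?P\<^esub> (g \<otimes>\<^bsub>?P\<^esub> h)) \<gamma>" for \<gamma>
        using splits_assoc[of "\<lambda>\<alpha> \<beta> \<beta>'. f \<alpha> * g \<beta> * h \<beta>'" \<gamma>]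
        by (simp add: path_algebra_mult sum_distrib_left sum_distrib_right case_prod_unfold mult.assoc)
      then show "f \<otimes>\<^bsub>?P\<^esub> g \<otimes>\<^bsub>?P\<^esub> h = f \<otimes>\<^bsub>?P\<^esub> (g \<otimes>\<^bsub>?P\<^esub> h)" by blast
    qed (use path_algebra_mult_closed path_algebra_one_mult in blast)+
  qed (simp_all add: fun_eq_iff path_algebra_mult case_prod_unfold distrib_left distrib_right sum.distrib)
  then show ?thesis
    by (intro kalgebra.intro kalgebra_axioms.intro kspace_path_algebra)
      (simp_all add: fun_eq_iff path_algebra_mult case_prod_unfold sum_distrib_left mult.assoc mult.left_commute)
qed

end

section \<open>The path basis of a monomial algebra\<close>

locale monomial_quiver = fin_digraph G for G :: "('v, 'a) pre_digraph" +
  fixes Z :: "('v, 'a) path set"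
  assumes Z: "monomial_relations G Z"
begin

abbreviation "B \<equiv> basis_paths G Z"

lemma B_paths: "\<beta> \<in> B \<Longrightarrow> \<beta> \<in> paths G"
  by (simp add: basis_paths_def)

lemma Z_paths: "\<zeta> \<in> Z \<Longrightarrow> \<zeta> \<in> paths G" and Z_length: "\<zeta> \<in> Z \<Longrightarrow> 2 \<le> length (snd \<zeta>)"
  using Z unfolding monomial_relations_def by blast+

lemma nonbasis_iff:
  assumes "\<gamma> \<in> paths G"
  shows "\<gamma> \<notin> B \<longleftrightarrow> (\<exists>\<zeta> \<in> Z. \<exists>\<delta> \<in> paths G. \<exists>\<epsilon> \<in> paths G. composable \<zeta> \<epsilon> \<and> composable \<delta> \<zeta> \<and> \<gamma> = pcomp \<delta> (pcomp \<zeta> \<epsilon>))"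
  using assms by (auto simp: basis_paths_def subpath_def composable_def)

text \<open>A relation inside a factor is also a relation inside the product.\<close>

lemma B_factors:
  assumes "\<alpha> \<in> paths G" "\<beta> \<in> paths G" "composable \<alpha> \<beta>" and "pcomp \<alpha> \<beta> \<in> B"
  shows "\<alpha> \<in> B" "\<beta> \<in> B"
proof -
  show "\<alpha> \<in> B"
  proof (rule ccontr)
    assume "\<alpha> \<notin> B"
    then obtain \<zeta> \<delta> \<epsilon> where *: "\<zeta> \<in> Z" "\<delta> \<in> paths G" "\<epsilon> \<in> paths G" "composable \<zeta> \<epsilon>" "composable \<delta> \<zeta>"
      "\<alpha> = pcomp \<delta> (pcomp \<zeta> \<epsilon>)" using nonbasis_iff[OF assms(1)] by blast
    have "composable \<epsilon> \<beta>" using assms(3) * by (simp add: composable_def)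
    then have "pcomp \<alpha> \<beta> = pcomp \<delta> (pcomp \<zeta> (pcomp \<epsilon> \<beta>))" "composable \<zeta> (pcomp \<epsilon> \<beta>)" "pcomp \<epsilon> \<beta> \<in> paths G"
      using * assms by (simp_all add: pcomp_assoc composable_pcomp_right pcomp_paths)
    then show False using * assms pcomp_paths[OF assms(1-3)] nonbasis_iff by blast
  qed
  show "\<beta> \<in> B"
  proof (rule ccontr)
    assume "\<beta> \<notin> B"
    then obtain \<zeta> \<delta> \<epsilon> where *: "\<zeta> \<in> Z" "\<delta> \<in> paths G" "\<epsilon> \<in> paths G" "composable \<zeta> \<epsilon>" "composable \<delta> \<zeta>"
      "\<beta> = pcomp \<delta> (pcomp \<zeta> \<epsilon>)" using nonbasis_iff[OF assms(2)] by blast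
    have "composable \<alpha> \<delta>" using assms(3) * by (simp add: composable_pcomp_right)
    then have "pcomp \<alpha> \<beta> = pcomp (pcomp \<alpha> \<delta>) (pcomp \<zeta> \<epsilon>)" "pcomp \<alpha> \<delta> \<in> paths G"
      using * assms by (simp_all add: pcomp_assoc pcomp_paths)
    then show False using * assms pcomp_paths[OF assms(1-3)] nonbasis_iff composable_pcomp_left by metis
  qed
qed

lemma Z_notin_B: "\<zeta> \<in> Z \<Longrightarrow> \<zeta> \<notin> B"
proof -
  assume z: "\<zeta> \<in> Z"
  have p: "\<zeta> \<in> paths G" using z by (rule Z_paths)
  have "subpath G \<zeta> \<zeta>"
    unfolding subpath_def using p psource_in_verts[OF p] ptarget_in_verts[OF p]
    by (intro bexI[of _ "(ptarget G \<zeta>, [])"] bexI[of _ "(psource \<zeta>, [])"])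
      (auto simp: psource_def pcomp_def)
  then show ?thesis using z by (auto simp: basis_paths_def)
qed

definition nonbasis_ideal :: "(('v, 'a) path \<Rightarrow> 'k::field) set" where
  "nonbasis_ideal = {f \<in> carrier (path_algebra G). \<forall>\<gamma> \<in> B. f \<gamma> = 0}"

lemma nonbasis_ideal_subspace: "is_subspace (path_algebra G :: ('k::field, _) module) nonbasis_ideal"
  by (rule is_subspaceI)
    (use kspace_add[OF kspace_path_algebra] kspace_smult[OF kspace_path_algebra] kspace_zero[OF kspace_path_algebra]
      in \<open>auto simp: nonbasis_ideal_def simp del: path_algebra_simps(1)\<close>)

lemma ideal_nonbasis: "ideal nonbasis_ideal (path_algebra G :: ('k::field, _) module)"
proof (rule idealI)
  let ?P = "path_algebra G :: ('k, _) module"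
  interpret P: kalgebra ?P by (rule kalgebra_path_algebra) simp
  show "ring ?P" by (rule P.ring_axioms)
  show "subgroup nonbasis_ideal (add_monoid ?P)"
    using subspace_abelian_subgroup[OF kspace_path_algebra nonbasis_ideal_subspace]
    unfolding abelian_subgroup_def additive_subgroup_def by blast
  fix f g :: "('v, 'a) path \<Rightarrow> 'k" assume f: "f \<in> nonbasis_ideal" and g: "g \<in> carrier ?P"
  have f0: "f \<gamma> = 0" if "\<gamma> \<in> B" for \<gamma> using f that by (simp add: nonbasis_ideal_def)
  have fc: "f \<in> carrier ?P" using f by (simp add: nonbasis_ideal_def)
  have "(g \<otimes>\<^bsub>?P\<^esub> f) \<gamma> = 0" "(f \<otimes>\<^bsub>?P\<^esub> g) \<gamma> = 0" if "\<gamma> \<in> B" for \<gamma>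
    unfolding path_algebra_mult using that B_factors
    by (auto simp: splits_iff intro!: sum.neutral f0)
  then show "g \<otimes>\<^bsub>?P\<^esub> f \<in> nonbasis_ideal" "f \<otimes>\<^bsub>?P\<^esub> g \<in> nonbasis_ideal"
    using P.m_closed[OF fc g] P.m_closed[OF g fc] by (simp_all add: nonbasis_ideal_def)
qed

text \<open>The functions vanishing on \<open>B\<close> form an ideal by \<open>B_factors\<close>,
  and a non-basis path is a multiple of some \<zeta> in \<open>Z\<close>. The generated ideal thus
  becomes a condition on coordinates, from which the basis can be read off.\<close>

lemma genideal_Z: "Idl\<^bsub>path_algebra G\<^esub> (single ` Z) = (nonbasis_ideal :: (_ \<Rightarrow> 'k::field) set)"
proof
  let ?P = "path_algebra G :: ('k, _) module"
  interpret P: kalgebra ?P by (rule kalgebra_path_algebra) simp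
  have ZP: "single ` Z \<subseteq> carrier ?P" by (auto simp: Z_paths)
  show "Idl\<^bsub>?P\<^esub> (single ` Z) \<subseteq> nonbasis_ideal"
    by (rule P.genideal_minimal[OF ideal_nonbasis])
      (auto simp: nonbasis_ideal_def Z_paths single_apply dest: Z_notin_B)
  interpret I: ideal "Idl\<^bsub>?P\<^esub> (single ` Z)" ?P by (rule P.genideal_ideal[OF ZP])
  note sub = ideal_subspace[OF P.kalgebra_axioms I.ideal_axioms]
  show "nonbasis_ideal \<subseteq> Idl\<^bsub>?P\<^esub> (single ` Z)"
  proof
    fix f :: "('v, 'a) path \<Rightarrow> 'k" assume f: "f \<in> nonbasis_ideal"
    have "f \<in> carrier (free_space (paths G - B))"
      using f by (auto simp: nonbasis_ideal_def free_space_carrier)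
    then show "f \<in> Idl\<^bsub>?P\<^esub> (single ` Z)"
    proof (induction rule: free_space_induct)
      case zero
      then show ?case using is_subspace_zero[OF sub] by simp
    next
      case (single \<gamma> c)
      then obtain \<zeta> \<delta> \<epsilon> where *: "\<zeta> \<in> Z" "\<delta> \<in> paths G" "\<epsilon> \<in> paths G" "composable \<zeta> \<epsilon>" "composable \<delta> \<zeta>"
        "\<gamma> = pcomp \<delta> (pcomp \<zeta> \<epsilon>)" using nonbasis_iff by blast
      have "single \<delta> \<otimes>\<^bsub>?P\<^esub> (single \<zeta> \<otimes>\<^bsub>?P\<^esub> single \<epsilon>) = single \<gamma>"
        using * Z_paths[OF *(1)] by (simp add: single_mult pcomp_paths composable_pcomp_right)
      moreover have "single \<delta> \<otimes>\<^bsub>?P\<^esub> (single \<zeta> \<otimes>\<^bsub>?P\<^esub> single \<epsilon>) \<in> Idl\<^bsub>?P\<^esub> (single ` Z)"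
        using * P.genideal_self[OF ZP] by (intro I.I_l_closed I.I_r_closed) auto
      ultimately show ?case using is_subspace_smult[OF sub, of "single \<gamma>" c] by simp
    next
      case (add f g)
      then show ?case using is_subspace_add[OF sub, of f g] by simp
    qed
  qed
qed

context
  fixes A :: "('k::field, (('v, 'a) path \<Rightarrow> 'k) set) module"
  assumes A: "A = monomial_algebra G Z"
begin

lemma A_eq: "A = quotient (path_algebra G) nonbasis_ideal"
  by (simp add: A monomial_algebra_def genideal_Z)

lemma kalgebra_path_algebra': "kalgebra (path_algebra G :: ('k, _) module)"
  by (rule kalgebra_path_algebra) simp

lemma kalgebra_A: "kalgebra A"
  unfolding A_eq by (rule kalgebra_quotient[OF kalgebra_path_algebra' ideal_nonbasis])

definition bas :: "('v, 'a) path \<Rightarrow> (('v, 'a) path \<Rightarrow> 'k) set" where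
  "bas \<gamma> = nonbasis_ideal +>\<^bsub>path_algebra G\<^esub> single \<gamma>"

lemma lin_coset_A: "lin (path_algebra G) A (\<lambda>f. nonbasis_ideal +>\<^bsub>path_algebra G\<^esub> f)"
  unfolding A_eq by (rule lin_coset[OF kspace_path_algebra nonbasis_ideal_subspace])

lemma coset_A_zero_iff:
  fixes f :: "_ \<Rightarrow> 'k"
  assumes "f \<in> carrier (path_algebra G)"
  shows "nonbasis_ideal +>\<^bsub>path_algebra G\<^esub> f = \<zero>\<^bsub>A\<^esub> \<longleftrightarrow> f \<in> nonbasis_ideal"
  unfolding A_eq
  using coset_eq_zero_iff[OF kspace_path_algebra nonbasis_ideal_subspace assms]
    quotient_zero[OF kspace_path_algebra nonbasis_ideal_subspace] by metis

lemma bas_closed: "\<gamma> \<in> paths G \<Longrightarrow> bas \<gamma> \<in> carrier A"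
  unfolding bas_def by (rule lin_closed[OF lin_coset_A]) simp

lemma bas_zero: "\<gamma> \<in> paths G \<Longrightarrow> \<gamma> \<notin> B \<Longrightarrow> bas \<gamma> = \<zero>\<^bsub>A\<^esub>"
  unfolding bas_def by (subst coset_A_zero_iff) (auto simp: nonbasis_ideal_def single_apply)

lemma bas_mult:
  assumes "\<alpha> \<in> paths G" "\<beta> \<in> paths G"
  shows "bas \<alpha> \<otimes>\<^bsub>A\<^esub> bas \<beta> = (if composable \<alpha> \<beta> then bas (pcomp \<alpha> \<beta>) else \<zero>\<^bsub>A\<^esub>)"
proof -
  have "bas \<alpha> \<otimes>\<^bsub>A\<^esub> bas \<beta> = nonbasis_ideal +>\<^bsub>path_algebra G\<^esub> (single \<alpha> \<otimes>\<^bsub>path_algebra G\<^esub> single \<beta> :: _ \<Rightarrow> 'k)"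
    unfolding bas_def A_eq by (rule quotient_mult[OF kalgebra_path_algebra' ideal_nonbasis]) (use assms in auto)
  also have "\<dots> = (if composable \<alpha> \<beta> then bas (pcomp \<alpha> \<beta>) else \<zero>\<^bsub>A\<^esub>)"
    using lin_zero[OF lin_coset_A kspace_path_algebra kalgebra.kspace[OF kalgebra_A]]
    unfolding bas_def single_mult[OF assms] by simp
  finally show ?thesis .
qed

lemma A_induct [consumes 1, case_names bas add smult zero]:
  assumes "x \<in> carrier A"
    and "\<And>\<beta>. \<beta> \<in> B \<Longrightarrow> P (bas \<beta>)"
    and "\<And>x y. x \<in> carrier A \<Longrightarrow> y \<in> carrier A \<Longrightarrow> P x \<Longrightarrow> P y \<Longrightarrow> P (x \<oplus>\<^bsub>A\<^esub> y)"
    and "\<And>c x. x \<in> carrier A \<Longrightarrow> P x \<Longrightarrow> P (c \<odot>\<^bsub>A\<^esub> x)"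
    and "P \<zero>\<^bsub>A\<^esub>"
  shows "P x"
proof -
  let ?q = "\<lambda>f. nonbasis_ideal +>\<^bsub>path_algebra G\<^esub> (f :: _ \<Rightarrow> 'k)"
  obtain f where f: "f \<in> carrier (path_algebra G)" "x = ?q f"
    using assms(1) unfolding A_eq quotient_carrier[OF kspace_path_algebra nonbasis_ideal_subspace] by blast
  have "P (?q f)" using f(1)[unfolded path_algebra_simps]
  proof (induction rule: free_space_induct)
    case zero
    then show ?case using assms(5) lin_zero[OF lin_coset_A kspace_path_algebra kalgebra.kspace[OF kalgebra_A]] by simp
  next
    case (single \<gamma> c)
    have "P (bas \<gamma>)" using assms(2,5) bas_zero single by (cases "\<gamma> \<in> B") auto
    then show ?case using lin_smult[OF lin_coset_A, of "single \<gamma>" c] assms(4)[OF bas_closed] single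
      by (simp add: bas_def)
  next
    case (add f g)
    then show ?case using lin_add[OF lin_coset_A, of f g] lin_closed[OF lin_coset_A] assms(3) by simp
  qed
  then show ?thesis using f by simp
qed

definition coord :: "(('v, 'a) path \<Rightarrow> 'k) set \<Rightarrow> ('v, 'a) path \<Rightarrow> 'k" where
  "coord x = the_elem ((\<lambda>f \<beta>. if \<beta> \<in> B then f \<beta> else 0) ` x)"

text \<open>Elements of the ideal vanish on \<open>B\<close>, so the values of a representative on
  \<open>B\<close> depend only on its coset; they vanish only for the zero coset.\<close>

lemma coord:
  shows lin_coord: "lin A (free_space B) coord"
    and coord_bas: "\<beta> \<in> B \<Longrightarrow> coord (bas \<beta>) = single \<beta>"
    and coord_eq_zero: "x \<in> carrier A \<Longrightarrow> coord x = (\<lambda>\<beta>. 0) \<Longrightarrow> x = \<zero>\<^bsub>A\<^esub>"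
proof -
  let ?r = "\<lambda>(f :: _ \<Rightarrow> 'k) \<beta>. if \<beta> \<in> B then f \<beta> else 0"
  have l: "lin (path_algebra G) (free_space B) ?r"
  proof (rule linI)
    fix f :: "_ \<Rightarrow> 'k" assume "f \<in> carrier (path_algebra G)"
    then show "?r f \<in> carrier (free_space B)"
      by (intro free_space_carrierI[of "{x. f x \<noteq> 0} \<inter> B"]) (auto simp: free_space_carrier)
  qed auto
  have kill: "?r f = \<zero>\<^bsub>free_space B\<^esub>" if "f \<in> nonbasis_ideal" for f
    using that by (auto simp: nonbasis_ideal_def)
  note * = the_elem_image_coset[OF kspace_path_algebra nonbasis_ideal_subspace kspace_free_space l kill]
  show "lin A (free_space B) coord"
    unfolding A_eq coord_def[abs_def]
    by (rule lin_quotient_map[OF kspace_path_algebra nonbasis_ideal_subspace kspace_free_space l kill])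
  show "coord (bas \<beta>) = single \<beta>" if "\<beta> \<in> B"
    unfolding bas_def coord_def using that B_paths by (subst *) (auto simp: single_apply)
  show "x = \<zero>\<^bsub>A\<^esub>" if x: "x \<in> carrier A" and 0: "coord x = (\<lambda>\<beta>. 0)"
  proof -
    obtain f where f: "f \<in> carrier (path_algebra G)" "x = nonbasis_ideal +>\<^bsub>path_algebra G\<^esub> f"
      using x unfolding A_eq quotient_carrier[OF kspace_path_algebra nonbasis_ideal_subspace] by blast
    have "?r f = (\<lambda>\<beta>. 0)" using 0 *[OF _ f(1)] f(2) by (simp add: coord_def)
    then have "f \<in> nonbasis_ideal" using f(1) by (auto simp: nonbasis_ideal_def fun_eq_iff split: if_splits)
    then show ?thesis using coset_A_zero_iff[OF f(1)] f(2) by blast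
  qed
qed

text \<open>The coordinates of a finite spanning set have finite supports, whose union must contain
  every basis path because each \<open>bas \<beta>\<close> has coordinate 1 at \<beta>.\<close>

lemma finite_B:
  assumes "vectorspace.fin_dim class_ring A"
  shows "finite B"
proof -
  have kA: "kspace A" by (rule kalgebra.kspace[OF kalgebra_A])
  interpret V: vectorspace class_ring A by (rule kA)
  obtain S where S: "finite S" "S \<subseteq> carrier A" "V.span S = carrier A"
    using assms unfolding V.fin_dim_def by blast
  note c = lin_coord coord_bas
  define Y where "Y = (\<Union>s \<in> S. {\<beta>. coord s \<beta> \<noteq> 0})"
  have "finite Y" using S lin_closed[OF c(1)] by (auto simp: Y_def free_space_carrier)
  let ?U = "{x \<in> carrier A. \<forall>\<beta>. \<beta> \<notin> Y \<longrightarrow> coord x \<beta> = 0}"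
  have U: "is_subspace A ?U"
    by (rule is_subspaceI)
      (use kA lin_zero[OF c(1) kA] in \<open>auto simp: lin_add[OF c(1)] lin_smult[OF c(1)]\<close>)
  have "x \<in> ?U" if "x \<in> carrier A" for x
    by (rule span_induct[OF kA S(2) _ U]) (use S that in \<open>auto simp: Y_def\<close>)
  then have "coord (bas \<beta>) \<beta> = 0" if "\<beta> \<in> B" "\<beta> \<notin> Y" for \<beta>
    using that bas_closed[OF B_paths] by blast
  then have "B \<subseteq> Y" by (auto simp: c(2) single_apply)
  then show ?thesis using \<open>finite Y\<close> by (rule finite_subset)
qed

end

end

section \<open>Cyclic words and circuits\<close>

lemma image_quotient_eq: "equiv S r \<Longrightarrow> X \<in> S // r \<Longrightarrow> x \<in> X \<Longrightarrow> X = r `` {x}"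
  by (metis Image_singleton_iff equiv_class_eq quotientE)

context wf_digraph
begin

text \<open>The empty word is excluded because it does not remember its vertex and admits no
  rotation; trivial cycles are treated apart.\<close>

definition cyclic_word :: "'b list \<Rightarrow> bool" where
  "cyclic_word w \<longleftrightarrow> w \<noteq> [] \<and> (tail G (hd w), w) \<in> cycles G"

definition word_path :: "'b list \<Rightarrow> ('a, 'b) path" where
  "word_path w = (tail G (hd w), w)"

lemma path_start: "(u, p) \<in> paths G \<Longrightarrow> p \<noteq> [] \<Longrightarrow> u = tail G (hd p)"
  by (cases p) (auto simp: paths_Cons)

lemma cycles_iff: "(u, p) \<in> cycles G \<longleftrightarrow> (u, p) \<in> paths G \<and> ptarget G (u, p) = u"
  by (auto simp: cycles_def psource_def)

lemma cycle_word: "(u, w) \<in> cycles G \<Longrightarrow> w \<noteq> [] \<Longrightarrow> cyclic_word w \<and> (u, w) = word_path w"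
  unfolding cyclic_word_def word_path_def cycles_iff using path_start by blast

lemma cyclic_word_path: "cyclic_word w \<Longrightarrow> word_path w \<in> cycles G"
  by (simp add: cyclic_word_def word_path_def)

lemma cyclic_word_Cons: "cyclic_word (a # p) \<longleftrightarrow> a \<in> arcs G \<and> (head G a, p) \<in> paths G \<and> ptarget G (head G a, p) = tail G a"
  using ptarget_append[of "tail G a" "[a]" p]
  by (auto simp: cyclic_word_def cycles_iff paths_Cons ptarget_conv[of "tail G a" "[a]"])

lemma cyclic_word_rotate1:
  assumes "cyclic_word w"
  shows "cyclic_word (rotate1 w)" "word_path (rotate1 w) = (head G (hd w), rotate1 w)"
proof -
  obtain a p where w: "w = a # p" using assms by (cases w) (auto simp: cyclic_word_def)
  have a: "a \<in> arcs G" "(head G a, p) \<in> paths G" "ptarget G (head G a, p) = tail G a"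
    using assms by (auto simp: w cyclic_word_Cons)
  have "(head G a, p @ [a]) \<in> cycles G"
    unfolding cycles_iff paths_append ptarget_append using a
    by (auto simp: paths_Cons ptarget_conv)
  then show "cyclic_word (rotate1 w)" "word_path (rotate1 w) = (head G (hd w), rotate1 w)"
    using cycle_word by (auto simp: w)
qed

lemma cyclic_word_rotate: "cyclic_word w \<Longrightarrow> cyclic_word (rotate j w)"
  by (induction j) (auto intro: cyclic_word_rotate1)

text \<open>A nonempty word determines its source, so rotating cycles amounts to
  \<open>rotate1\<close> on lists of arrows.\<close>

lemma rotation_eq: "rotation G = {(word_path w, word_path (rotate1 w)) | w. cyclic_word w}"
proof (intro subset_antisym subsetI)
  fix x assume "x \<in> rotation G"
  then obtain u a p where x: "x = ((u, a # p), (head G a, p @ [a]))" "(u, a # p) \<in> cycles G"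
    by (auto simp: rotation_def)
  then have "cyclic_word (a # p)" "(u, a # p) = word_path (a # p)" using cycle_word by blast+
  moreover from this have "(head G a, p @ [a]) = word_path (rotate1 (a # p))"
    using cyclic_word_rotate1(2)[of "a # p"] by simp
  ultimately show "x \<in> {(word_path w, word_path (rotate1 w)) | w. cyclic_word w}"
    unfolding x(1) by blast
next
  fix x assume "x \<in> {(word_path w, word_path (rotate1 w)) | w. cyclic_word w}"
  then obtain w where w: "x = (word_path w, word_path (rotate1 w))" "cyclic_word w" by blast
  then obtain a p where "w = a # p" by (cases w) (auto simp: cyclic_word_def)
  then show "x \<in> rotation G"
    using w cyclic_word_rotate1(2)[OF w(2)] cyclic_word_path[OF w(2)]
    by (auto simp: rotation_def word_path_def)
qed

definition conj_rel :: "('a, 'b) path rel" where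
  "conj_rel = (rotation G \<union> (rotation G)\<inverse>)\<^sup>*"

definition circuit :: "('a, 'b) path \<Rightarrow> ('a, 'b) path set" where
  "circuit \<gamma> = Restr conj_rel (cycles G) `` {\<gamma>}"

lemma equiv_conj_rel: "equiv (cycles G) (Restr conj_rel (cycles G))"
proof -
  have "sym (rotation G \<union> (rotation G)\<inverse>)" by (auto simp: sym_def)
  then have "sym conj_rel" unfolding conj_rel_def by (rule sym_rtrancl)
  moreover have "trans conj_rel" unfolding conj_rel_def by (rule trans_rtrancl)
  moreover have "refl conj_rel" unfolding conj_rel_def by (rule refl_rtrancl)
  ultimately have "equiv UNIV conj_rel" by (intro equivI) auto
  then show ?thesis
    by (intro equivI) (auto simp: equiv_def refl_on_def sym_def intro: transI elim: transE)
qed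

lemma circuits_eq: "circuits G = circuit ` cycles G"
  by (auto simp: circuits_def circuit_def conj_rel_def Equiv_Relations.quotient_def)

lemma circuit_eqI: "C \<in> circuits G \<Longrightarrow> \<gamma> \<in> C \<Longrightarrow> C = circuit \<gamma>"
  unfolding circuit_def using image_quotient_eq[OF equiv_conj_rel]
  by (auto simp: circuits_def conj_rel_def)

lemma circuit_self: "\<gamma> \<in> cycles G \<Longrightarrow> \<gamma> \<in> circuit \<gamma>"
  unfolding circuit_def using equiv_class_self[OF equiv_conj_rel] by blast

lemma circuit_in_circuits: "\<gamma> \<in> cycles G \<Longrightarrow> circuit \<gamma> \<in> circuits G"
  by (simp add: circuits_eq)

lemma circuit_subset: "C \<in> circuits G \<Longrightarrow> C \<subseteq> cycles G"
  by (auto simp: circuits_eq circuit_def)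

lemma circuit_nonempty: "C \<in> circuits G \<Longrightarrow> C \<noteq> {}"
  using circuit_self by (auto simp: circuits_eq)

lemma mem_circuit_iff:
  "\<gamma> \<in> cycles G \<Longrightarrow> \<gamma>' \<in> cycles G \<Longrightarrow> \<gamma>' \<in> circuit \<gamma> \<longleftrightarrow> circuit \<gamma>' = circuit \<gamma>"
  using circuit_eqI[OF circuit_in_circuits] circuit_self by metis

lemma mem_circuit_conj_rel: "\<gamma>' \<in> circuit \<gamma> \<Longrightarrow> (\<gamma>, \<gamma>') \<in> conj_rel"
  by (simp add: circuit_def)

lemma circuit_rotate1:
  assumes "cyclic_word w"
  shows "circuit (word_path (rotate1 w)) = circuit (word_path w)"
proof -
  have "(word_path w, word_path (rotate1 w)) \<in> conj_rel"
    unfolding conj_rel_def rotation_eq using assms by (intro r_into_rtrancl) blast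
  then have "word_path (rotate1 w) \<in> circuit (word_path w)"
    using cyclic_word_path[OF assms] cyclic_word_path[OF cyclic_word_rotate1(1)[OF assms]]
    by (simp add: circuit_def)
  then show ?thesis
    using cyclic_word_path[OF assms] cyclic_word_path[OF cyclic_word_rotate1(1)[OF assms]]
    by (simp add: mem_circuit_iff)
qed

lemma circuit_rotate: "cyclic_word w \<Longrightarrow> circuit (word_path (rotate j w)) = circuit (word_path w)"
  by (induction j) (auto simp: circuit_rotate1 cyclic_word_rotate)

lemma conj_rel_induct [consumes 1, case_names refl rotate unrotate]:
  assumes "(\<gamma>, \<gamma>') \<in> conj_rel" and "Q \<gamma>"
    and "\<And>w. cyclic_word w \<Longrightarrow> Q (word_path w) \<Longrightarrow> Q (word_path (rotate1 w))"
    and "\<And>w. cyclic_word w \<Longrightarrow> Q (word_path (rotate1 w)) \<Longrightarrow> Q (word_path w)"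
  shows "Q \<gamma>'"
  using assms(1) unfolding conj_rel_def
proof (induction rule: rtrancl_induct)
  case base
  show ?case by (rule assms(2))
next
  case (step \<beta> \<gamma>)
  then show ?case using assms(3,4) by (auto simp: rotation_eq)
qed

text \<open>No rotation starts or ends at an empty word, so the circuit of a vertex contains nothing
  else.\<close>

lemma trivial_circuit_iff:
  assumes "C \<in> circuits G"
  shows "trivial_circuit G C \<longleftrightarrow> (\<exists>v \<in> verts G. (v, []) \<in> C)"
proof
  assume "\<exists>v \<in> verts G. (v, []) \<in> C"
  then obtain v where v: "v \<in> verts G" "(v, []) \<in> C" by blast
  have "\<gamma> = (v, [])" if "(((v, []) :: ('a, 'b) path), \<gamma>) \<in> conj_rel" for \<gamma>
    using that
    by (induction rule: conj_rel_induct) (auto simp: word_path_def cyclic_word_def)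
  then have "C = {(v, [])}"
    using circuit_eqI[OF assms v(2)] v mem_circuit_conj_rel by blast
  then show "trivial_circuit G C" using v by (auto simp: trivial_circuit_def)
qed (auto simp: trivial_circuit_def)

end

section \<open>Words avoiding the relations and sums over their rotations\<close>

context monomial_quiver
begin

text \<open>Membership in \<open>B\<close> depends on the list of arrows alone: a nonempty list
  fixes its source, and all vertices lie in \<open>B\<close>.\<close>

definition basis_word :: "'a list \<Rightarrow> bool" where
  "basis_word p \<longleftrightarrow> p = [] \<or> (tail G (hd p), p) \<in> B"

lemma vertex_in_B: "v \<in> verts G \<Longrightarrow> (v, []) \<in> B"
  using Z_length by (fastforce simp: basis_paths_def subpath_def pcomp_def)

lemma basis_word_iff: "(u, p) \<in> paths G \<Longrightarrow> (u, p) \<in> B \<longleftrightarrow> basis_word p"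
  using path_start[of u p] vertex_in_B by (cases "p = []") (auto simp: basis_word_def)

lemma basis_word_infix:
  assumes "basis_word (p @ q @ r)"
  shows "basis_word q"
proof (cases "q = []")
  case False
  let ?u = "tail G (hd (p @ q @ r))"
  let ?v = "ptarget G (?u, p)"
  have b: "(?u, p @ q @ r) \<in> B" using assms False by (auto simp: basis_word_def)
  have p: "(?u, p) \<in> paths G" "(?v, q @ r) \<in> paths G" "(?v, q) \<in> paths G" "(ptarget G (?v, q), r) \<in> paths G"
    using B_paths[OF b] unfolding paths_append by auto
  have "(?v, q @ r) \<in> B"
    by (rule B_factors(1)[OF p(2,1)]) (use b in \<open>auto simp: composable_def psource_def pcomp_def\<close>)
  then have "(?v, q) \<in> B"
    by (intro B_factors(2)[OF p(4,3)]) (auto simp: composable_def psource_def pcomp_def)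
  then show ?thesis using basis_word_iff p(3) by blast
qed (simp add: basis_word_def)

lemma not_basis_word_Z:
  assumes "\<zeta> \<in> Z"
  shows "\<not> basis_word (snd \<zeta>)"
  using basis_word_iff[of "fst \<zeta>" "snd \<zeta>"] Z_notin_B[OF assms] Z_paths[OF assms] by simp

lemma not_basis_word:
  assumes "(u, p) \<in> paths G" "\<not> basis_word p"
  obtains \<zeta> r s where "\<zeta> \<in> Z" "p = r @ snd \<zeta> @ s" "(ptarget G (u, r), snd \<zeta> @ s) \<in> paths G"
    "ptarget G (u, r) = fst \<zeta>"
proof -
  have "(u, p) \<notin> B" using assms basis_word_iff by blast
  then obtain \<zeta> \<delta> \<epsilon> where *: "\<zeta> \<in> Z" "\<delta> \<in> paths G" "\<epsilon> \<in> paths G" "composable \<zeta> \<epsilon>" "composable \<delta> \<zeta>"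
    "(u, p) = pcomp \<delta> (pcomp \<zeta> \<epsilon>)" using nonbasis_iff[OF assms(1)] by blast
  then have "p = snd \<epsilon> @ snd \<zeta> @ snd \<delta>" "u = fst \<epsilon>" by (auto simp: pcomp_def)
  moreover from this have "ptarget G (u, snd \<epsilon>) = fst \<zeta>" using *(4) by (simp add: composable_def psource_def)
  ultimately show ?thesis
    using that[of \<zeta> "snd \<epsilon>" "snd \<delta>"] *(1) assms(1) by (simp add: paths_append)
qed

definition P :: "(('v, 'a) path \<times> ('v, 'a) path) set" where
  "P = odot G (arrow_paths G) B"

text \<open>Encodes the pair (a, \<beta>) by the word that traverses a and then \<beta>. Its two
  products are then the word itself and its rotation by one.\<close>

definition uncons :: "'a list \<Rightarrow> ('v, 'a) path \<times> ('v, 'a) path" where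
  "uncons w = ((tail G (hd w), [hd w]), (head G (hd w), tl w))"

lemma uncons_inj: "w \<noteq> [] \<Longrightarrow> w' \<noteq> [] \<Longrightarrow> uncons w = uncons w' \<longleftrightarrow> w = w'"
  by (cases w; cases w') (auto simp: uncons_def)

lemma P_iff: "x \<in> P \<longleftrightarrow> (\<exists>w. cyclic_word w \<and> basis_word (tl w) \<and> x = uncons w)"
proof
  assume "x \<in> P"
  then obtain a v p where x: "x = ((tail G a, [a]), (v, p))" "a \<in> arcs G" "(v, p) \<in> B"
    "ptarget G (v, p) = tail G a" "v = head G a"
    by (auto simp: P_def odot_def arrow_paths_def psource_def ptarget_conv[of _ "[_]"])
  then have "cyclic_word (a # p)" "basis_word p" using B_paths[OF x(3)] basis_word_iff
    by (auto simp: cyclic_word_Cons)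
  then show "\<exists>w. cyclic_word w \<and> basis_word (tl w) \<and> x = uncons w"
    using x by (intro exI[of _ "a # p"]) (simp add: uncons_def)
next
  assume "\<exists>w. cyclic_word w \<and> basis_word (tl w) \<and> x = uncons w"
  then obtain w where w: "cyclic_word w" "basis_word (tl w)" "x = uncons w" by blast
  then obtain a p where "w = a # p" by (cases w) (auto simp: cyclic_word_def)
  then show "x \<in> P"
    using w basis_word_iff[of "head G a" p]
    by (auto simp: P_def odot_def arrow_paths_def psource_def ptarget_conv[of _ "[_]"] uncons_def cyclic_word_Cons)
qed

lemma uncons_P: "cyclic_word w \<Longrightarrow> uncons w \<in> P \<longleftrightarrow> basis_word (tl w)"
  unfolding P_iff using uncons_inj by (metis cyclic_word_def)

lemma pcomp_uncons: "cyclic_word w \<Longrightarrow> pcomp (fst (uncons w)) (snd (uncons w)) = word_path (rotate1 w)"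
  using cyclic_word_rotate1(2)[of w]
  by (cases w) (auto simp: uncons_def pcomp_def cyclic_word_def)

definition pair_circuit :: "('v, 'a) path \<times> ('v, 'a) path \<Rightarrow> ('v, 'a) path set" where
  "pair_circuit x = circuit (pcomp (fst x) (snd x))"

lemma pair_circuit_uncons: "cyclic_word w \<Longrightarrow> pair_circuit (uncons w) = circuit (word_path w)"
  by (simp add: pair_circuit_def pcomp_uncons circuit_rotate1)

lemma P_cycle: "x \<in> P \<Longrightarrow> pcomp (fst x) (snd x) \<in> cycles G"
  unfolding P_iff using pcomp_uncons cyclic_word_path[OF cyclic_word_rotate1(1)] by metis

lemma odot_at_P: "C \<in> circuits G \<Longrightarrow> odot_at G (arrow_paths G) B C = {x \<in> P. pair_circuit x = C}"
proof (intro subset_antisym subsetI)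
  fix x assume C: "C \<in> circuits G" and "x \<in> odot_at G (arrow_paths G) B C"
  then have "x \<in> P" "pcomp (fst x) (snd x) \<in> C" by (auto simp: odot_at_def P_def)
  then show "x \<in> {x \<in> P. pair_circuit x = C}" using circuit_eqI[OF C] by (simp add: pair_circuit_def)
next
  fix x assume "x \<in> {x \<in> P. pair_circuit x = C}"
  then have "x \<in> P" "pcomp (fst x) (snd x) \<in> C"
    using circuit_self[OF P_cycle, of x] by (auto simp: pair_circuit_def)
  then show "x \<in> odot_at G (arrow_paths G) B C" by (auto simp: odot_at_def P_def case_prod_unfold)
qed

lemma useful_iff: "C \<in> circuits G \<Longrightarrow> useful G Z C \<longleftrightarrow> (\<exists>x \<in> P. pair_circuit x = C)"
  by (auto simp: useful_def odot_at_P)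

text \<open>A cycle \<open>pcomp \<zeta> \<beta>\<close> in the circuit has the factor \<zeta> and
  is therefore not a basis path, so the circuit cannot be strong.\<close>

lemma efficient_iff:
  assumes "C \<in> circuits G"
  shows "efficient G Z C \<longleftrightarrow> (\<exists>x \<in> P. pair_circuit x = C) \<and> odot_at G Z B C \<noteq> {}"
proof -
  have "\<not> strong G Z C" if ne: "odot_at G Z B C \<noteq> {}"
  proof
    assume s: "strong G Z C"
    obtain \<zeta> \<beta> where *: "\<zeta> \<in> Z" "\<beta> \<in> B" "composable \<zeta> \<beta>" "pcomp \<zeta> \<beta> \<in> C"
      using ne by (auto simp: odot_at_def odot_def composable_def)
    then have "pcomp \<zeta> \<beta> \<in> B" using s by (auto simp: strong_def)
    then show False
      using B_factors(1)[OF Z_paths[OF *(1)] B_paths[OF *(2)] *(3)] Z_notin_B[OF *(1)] by blast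
  qed
  then show ?thesis by (auto simp: efficient_def useful_iff[OF assms])
qed

text \<open>\<open>cyc_term (a # \<beta>)\<close> stands for \<open>\<beta> da\<close>, which is zero in the algebra unless \<open>\<beta>\<close> is a basis path.\<close>

definition cyc_term :: "'a list \<Rightarrow> ('v, 'a) path \<times> ('v, 'a) path \<Rightarrow> 'k::field" where
  "cyc_term w = (if basis_word (tl w) then single (uncons w) else (\<lambda>x. 0))"

text \<open>For \<open>w\<close> equal to \<gamma> followed by \<beta>, and \<open>k\<close> the
  length of \<gamma>, this is the Leibniz expansion of \<beta> d\<gamma>: rotation by
  \<open>j\<close> brings one arrow of \<gamma> to the front and leaves its complement in the cyclic
  word behind it.\<close>

definition partial_sum :: "nat \<Rightarrow> 'a list \<Rightarrow> ('v, 'a) path \<times> ('v, 'a) path \<Rightarrow> 'k::field" where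
  "partial_sum k w x = (\<Sum>j<k. cyc_term (rotate j w) x)"

abbreviation cyclic_sum :: "'a list \<Rightarrow> ('v, 'a) path \<times> ('v, 'a) path \<Rightarrow> 'k::field" where
  "cyclic_sum w \<equiv> partial_sum (length w) w"

lemma cyc_term_carrier: "cyclic_word w \<Longrightarrow> cyc_term w \<in> carrier (free_space P)"
  using kspace_zero[OF kspace_free_space, of P] by (auto simp: cyc_term_def uncons_P[symmetric])

lemma partial_sum_Suc: "partial_sum (Suc k) w = (\<lambda>x. partial_sum k w x + cyc_term (rotate k w) x)"
  by (simp add: partial_sum_def fun_eq_iff)

lemma partial_sum_carrier: "cyclic_word w \<Longrightarrow> partial_sum k w \<in> carrier (free_space P)"
proof (induction k)
  case 0
  then show ?case using kspace_zero[OF kspace_free_space, of P] by (simp add: partial_sum_def[abs_def])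
next
  case (Suc k)
  then show ?case
    using kspace_add[OF kspace_free_space Suc.IH cyc_term_carrier[OF cyclic_word_rotate]] Suc.prems
    by (simp add: partial_sum_Suc)
qed

text \<open>The combinatorial Leibniz rule: positions in \<open>p @ q\<close> are positions in
  \<open>p\<close> or in \<open>q\<close>, and rotation by \<open>length p\<close> brings the second
  kind to the front.\<close>

lemma partial_sum_append:
  fixes x :: "('v, 'a) path \<times> ('v, 'a) path"
  shows "(partial_sum (length p + length q) (p @ q @ r) x :: 'k::field) =
     partial_sum (length p) (p @ q @ r) x + partial_sum (length q) (q @ r @ p) x"
proof -
  have "rotate (length p + j) (p @ q @ r) = rotate j (q @ r @ p)" for j
  proof -
    have "rotate (length p + j) (p @ q @ r) = rotate j (rotate (length p) (p @ q @ r))"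
      by (simp only: rotate_rotate add.commute)
    then show ?thesis by (simp add: rotate_append)
  qed
  moreover have "(\<Sum>j<m + n. f j) = (\<Sum>j<m. f j) + (\<Sum>j<n. f (m + j))" for m n and f :: "nat \<Rightarrow> 'k"
    by (induction n) (simp_all add: add.assoc)
  ultimately show ?thesis by (simp only: partial_sum_def)
qed

text \<open>The complement of a position in \<open>q\<close> contains all of \<open>p\<close>, hence
  is not a basis word.\<close>

lemma cyc_term_outside:
  assumes "\<not> basis_word p" "length p \<le> j" "j < length (p @ q)"
  shows "cyc_term (rotate j (p @ q)) = (\<lambda>x. 0 :: 'k::field)"
proof -
  define i where "i = j - length p"
  have i: "j = length p + i" "i < length q" using assms(2,3) by (auto simp: i_def)
  have "rotate j (p @ q) = rotate i (q @ p)"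
  proof -
    have "rotate j (p @ q) = rotate i (rotate (length p) (p @ q))"
      by (simp only: i(1) rotate_rotate add.commute)
    then show ?thesis by (simp add: rotate_append)
  qed
  also have "\<dots> = drop i q @ p @ take i q" using i by (simp add: rotate_drop_take)
  also have "\<dots> = q ! i # drop (Suc i) q @ p @ take i q" using i by (simp add: Cons_nth_drop_Suc)
  finally show ?thesis
    using assms(1) basis_word_infix[of "drop (Suc i) q" p "take i q"] by (auto simp: cyc_term_def)
qed

lemma partial_sum_outside:
  assumes "\<not> basis_word p"
  shows "partial_sum (length p) (p @ q) = (cyclic_sum (p @ q) :: _ \<Rightarrow> 'k::field)"
proof
  fix x
  show "partial_sum (length p) (p @ q) x = (cyclic_sum (p @ q) x :: 'k)"
    unfolding partial_sum_def
    by (rule sum.mono_neutral_left) (auto simp: not_less cyc_term_outside[OF assms])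
qed

text \<open>The complement of each position in \<open>p\<close> contains \<open>q\<close>. In terms
  of forms, \<beta> d\<gamma> expands to zero whenever \<beta> is zero in the algebra.\<close>

lemma partial_sum_eq_zero:
  assumes "\<not> basis_word q"
  shows "partial_sum (length p) (p @ q) = (\<lambda>x. 0 :: 'k::field)"
proof
  fix x
  have "cyc_term (rotate j (p @ q)) x = (0 :: 'k)" if "j < length p" for j
  proof -
    have "rotate j (p @ q) = drop j p @ q @ take j p" using that by (simp add: rotate_drop_take)
    also have "\<dots> = p ! j # drop (Suc j) p @ q @ take j p" using that by (simp add: Cons_nth_drop_Suc)
    finally show ?thesis
      using assms basis_word_infix[of "drop (Suc j) p" q "take j p"] by (auto simp: cyc_term_def)
  qed
  then show "partial_sum (length p) (p @ q) x = (0 :: 'k)" by (simp add: partial_sum_def)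
qed

text \<open>Rotation shifts the index by one; the term leaving at 0 returns at
  \<open>length w\<close>, because rotation by the full length is the identity.\<close>

lemma cyclic_sum_rotate1: "partial_sum (length w) (rotate1 w) x = (partial_sum (length w) w x :: 'k::field)"
proof -
  let ?f = "\<lambda>j. cyc_term (rotate j w) x :: 'k"
  have "rotate j (rotate1 w) = rotate (Suc j) w" for j by (simp add: rotate1_rotate_swap)
  then have "partial_sum (length w) (rotate1 w) x = (\<Sum>j<length w. ?f (Suc j))"
    by (simp add: partial_sum_def)
  moreover have "(\<Sum>j<Suc (length w). ?f j) = ?f 0 + (\<Sum>j<length w. ?f (Suc j))"
    by (rule sum.lessThan_Suc_shift)
  moreover have "?f (length w) = ?f 0" by simp
  ultimately show ?thesis by (simp add: partial_sum_def)
qed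

text \<open>The order of the stabiliser of \<open>w\<close> among its rotations. For nonempty
  \<open>w\<close> it exceeds one exactly when \<open>w\<close> is a proper power.\<close>

definition period_count :: "'a list \<Rightarrow> nat" where
  "period_count w = card {j. j < length w \<and> rotate j w = w}"

lemma period_count_pos: "w \<noteq> [] \<Longrightarrow> 0 < period_count w"
  unfolding period_count_def by (subst card_gt_0_iff) (auto intro: exI[of _ 0])

lemma period_count_rotate1: "period_count (rotate1 w) = period_count w"
proof -
  have "rotate j (rotate1 w) = rotate1 w \<longleftrightarrow> rotate j w = w" for j
    by (metis inj_rotate1 injD rotate1_rotate_swap)
  then show ?thesis by (simp add: period_count_def)
qed

lemma cyclic_sum_uncons_self:
  assumes "w \<noteq> []" "basis_word (tl w)"
  shows "cyclic_sum w (uncons w) = (of_nat (period_count w) :: 'k::field)"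
proof -
  have "cyc_term (rotate j w) (uncons w) = (if rotate j w = w then 1 else 0 :: 'k)" for j
    using assms uncons_inj[of w "rotate j w"]
    by (cases "rotate j w = w") (simp_all add: cyc_term_def single_apply)
  then have "cyclic_sum w (uncons w) = (\<Sum>j<length w. if rotate j w = w then 1 else 0 :: 'k)"
    by (simp add: partial_sum_def)
  also have "\<dots> = of_nat (card ({..<length w} \<inter> {j. rotate j w = w}))"
    by (simp add: sum.If_cases)
  also have "{..<length w} \<inter> {j. rotate j w = w} = {j. j < length w \<and> rotate j w = w}" by auto
  finally show ?thesis by (simp add: period_count_def)
qed

lemma cyclic_sum_support:
  assumes "cyclic_word w" "cyclic_sum w x \<noteq> (0 :: 'k::field)"
  shows "x \<in> P \<and> pair_circuit x = circuit (word_path w)"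
proof -
  obtain j where "cyc_term (rotate j w) x \<noteq> (0 :: 'k)"
    using assms(2) unfolding partial_sum_def by (rule sum.not_neutral_contains_not_neutral)
  then have j: "basis_word (tl (rotate j w))" "x = uncons (rotate j w)"
    by (auto simp: cyc_term_def single_apply split: if_splits)
  then show ?thesis
    using cyclic_word_rotate[OF assms(1), of j] pair_circuit_uncons[OF cyclic_word_rotate[OF assms(1)], of j]
      circuit_rotate[OF assms(1), of j] unfolding P_iff by auto
qed

text \<open>All entries of the cyclic sum of a circuit agree, being the order of the rotation symmetry of
  the word. This makes each relation a multiple of the indicator function of a circuit.\<close>

lemma cyclic_sum_eq:
  assumes w: "cyclic_word w" and x: "x \<in> P" "pair_circuit x = circuit (word_path w)"
  shows "cyclic_sum w x = (of_nat (period_count w) :: 'k::field)"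
proof -
  obtain w' where w': "cyclic_word w'" "basis_word (tl w')" "x = uncons w'" using x(1) by (auto simp: P_iff)
  have "word_path w' \<in> circuit (word_path w)"
    using x(2) w' w by (simp add: pair_circuit_uncons mem_circuit_iff cyclic_word_path)
  then have "(word_path w, word_path w') \<in> conj_rel" by (rule mem_circuit_conj_rel)
  \<comment> \<open>The induction transports the whole function \<open>cyclic_sum\<close> and the
    count from \<open>w\<close> to \<open>w'\<close>, where the value at \<open>uncons w'\<close> is
    known.\<close>
  then have "snd (word_path w') \<noteq> [] \<and>
      (\<forall>y. cyclic_sum (snd (word_path w')) y = (cyclic_sum w y :: 'k)) \<and>
      period_count (snd (word_path w')) = period_count w"
  proof (induction rule: conj_rel_induct)
    case refl
    then show ?case using w by (simp add: word_path_def cyclic_word_def)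
  next
    case (rotate v)
    then show ?case by (simp add: word_path_def cyclic_sum_rotate1 period_count_rotate1)
  next
    case (unrotate v)
    then show ?case by (simp add: word_path_def cyclic_sum_rotate1 period_count_rotate1)
  qed
  then have "\<And>y. cyclic_sum w' y = (cyclic_sum w y :: 'k)" "w' \<noteq> []" "period_count w' = period_count w"
    unfolding word_path_def snd_conv by blast+
  then show ?thesis
    using cyclic_sum_uncons_self[of w', where 'k = 'k] w' by metis
qed

text \<open>A nonzero entry belongs to an arrow inside \<zeta>, and its complement contains
  \<open>r\<close>. So \<open>r\<close> is a basis word and yields an element of Z \<odot> B. If
  instead \<open>r\<close> contains a relation, then every complement of an arrow contains one and
  the sum is zero.\<close>

lemma efficient_of_factor:
  assumes w: "cyclic_word (snd \<zeta> @ r)" and z: "\<zeta> \<in> Z" and x: "cyclic_sum (snd \<zeta> @ r) x \<noteq> (0 :: 'k::field)"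
  shows "efficient G Z (circuit (word_path (snd \<zeta> @ r)))"
proof -
  let ?w = "snd \<zeta> @ r"
  let ?C = "circuit (word_path ?w)"
  have C: "?C \<in> circuits G" by (intro circuit_in_circuits cyclic_word_path w)
  have zne: "snd \<zeta> \<noteq> []" using Z_length[OF z] by auto
  obtain j where j: "j < length ?w" "cyc_term (rotate j ?w) x \<noteq> (0 :: 'k)"
    using x unfolding partial_sum_def by (rule sum.not_neutral_contains_not_neutral) auto
  have "j < length (snd \<zeta>)"
    using cyc_term_outside[OF not_basis_word_Z[OF z], of j r] j by (metis not_le)
  then have "rotate j ?w = snd \<zeta> ! j # drop (Suc j) (snd \<zeta>) @ r @ take j (snd \<zeta>)"
    by (simp add: rotate_drop_take Cons_nth_drop_Suc[symmetric])
  moreover have "basis_word (tl (rotate j ?w))"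
    using j(2) by (auto simp: cyc_term_def split: if_splits)
  ultimately have r: "basis_word r" using basis_word_infix by force
  have path: "(tail G (hd ?w), ?w) \<in> paths G" "ptarget G (tail G (hd ?w), ?w) = tail G (hd ?w)"
    using w by (auto simp: cyclic_word_def cycles_iff)
  have u: "tail G (hd ?w) = fst \<zeta>"
    using path_start[of "fst \<zeta>" "snd \<zeta>"] Z_paths[OF z] zne by simp
  let ?\<rho> = "(ptarget G \<zeta>, r)"
  have \<rho>: "?\<rho> \<in> paths G" "ptarget G ?\<rho> = fst \<zeta>"
    using path unfolding u paths_append ptarget_append by auto
  then have "?\<rho> \<in> B" using basis_word_iff r by blast
  \<comment> \<open>\<open>pcomp\<close> traverses \<open>r\<close> first, so the witness is the
    word rotated past \<zeta>.\<close>
  moreover have "pcomp \<zeta> ?\<rho> = word_path (rotate (length (snd \<zeta>)) ?w)"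
  proof -
    have rot: "rotate (length (snd \<zeta>)) ?w = r @ snd \<zeta>" by (rule rotate_append)
    have "cyclic_word (r @ snd \<zeta>)" using cyclic_word_rotate[OF w, of "length (snd \<zeta>)"] by (simp add: rot)
    moreover have "ptarget G \<zeta> = tail G (hd (r @ snd \<zeta>))"
    proof (cases "r = []")
      case True
      then show ?thesis using path u by simp
    next
      case False
      then show ?thesis using path_start[OF \<rho>(1)] by simp
    qed
    ultimately show ?thesis by (simp add: rot word_path_def pcomp_def)
  qed
  then have "pcomp \<zeta> ?\<rho> \<in> ?C"
    using circuit_self[OF cyclic_word_path[OF cyclic_word_rotate[OF w]], of "length (snd \<zeta>)"]
    by (simp only: circuit_rotate[OF w])
  ultimately have "(\<zeta>, ?\<rho>) \<in> odot_at G Z B ?C"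
    using z \<rho> by (auto simp: odot_at_def odot_def psource_def)
  then show ?thesis
    using efficient_iff[OF C] cyclic_sum_support[OF w x] by auto
qed

end

section \<open>The expansion of one-forms in arrow forms, modulo circuit sums\<close>

context monomial_quiver
begin

text \<open>The coefficients of \<beta> d\<gamma> on the arrow forms. Pairs that do not close up get
  zero, because their forms reduce to forms \<beta>' de at vertices.\<close>

definition bracket :: "('v, 'a) path \<Rightarrow> ('v, 'a) path \<Rightarrow> ('v, 'a) path \<times> ('v, 'a) path \<Rightarrow> 'k::field" where
  "bracket \<beta> \<gamma> = (if composable \<beta> \<gamma> \<and> composable \<gamma> \<beta> then partial_sum (length (snd \<gamma>)) (snd \<gamma> @ snd \<beta>) else (\<lambda>x. 0))"

lemma cyclic_word_pcomp:
  assumes "\<beta> \<in> paths G" "\<gamma> \<in> paths G" "composable \<beta> \<gamma>" "composable \<gamma> \<beta>" "snd \<gamma> @ snd \<beta> \<noteq> []"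
  shows "cyclic_word (snd \<gamma> @ snd \<beta>)" "word_path (snd \<gamma> @ snd \<beta>) = pcomp \<beta> \<gamma>"
proof -
  have "pcomp \<beta> \<gamma> \<in> cycles G"
    using assms pcomp_paths[OF assms(1-3)] by (simp add: cycles_def ptarget_pcomp) (simp add: composable_def)
  then show "cyclic_word (snd \<gamma> @ snd \<beta>)" "word_path (snd \<gamma> @ snd \<beta>) = pcomp \<beta> \<gamma>"
    using cycle_word[of "fst \<gamma>" "snd \<gamma> @ snd \<beta>"] assms(5) by (simp_all add: pcomp_def)
qed

lemma bracket_carrier:
  assumes "\<beta> \<in> paths G" "\<gamma> \<in> paths G"
  shows "(bracket \<beta> \<gamma> :: _ \<Rightarrow> 'k::field) \<in> carrier (free_space P)"
proof (cases "composable \<beta> \<gamma> \<and> composable \<gamma> \<beta> \<and> snd \<gamma> \<noteq> []")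
  case True
  then show ?thesis
    using partial_sum_carrier[OF cyclic_word_pcomp(1)[OF assms]] by (simp add: bracket_def)
next
  case False
  then show ?thesis using kspace_zero[OF kspace_free_space, of P]
    by (auto simp: bracket_def partial_sum_def[abs_def])
qed

lemma bracket_nonbasis:
  assumes "\<beta> \<in> paths G" "\<beta> \<notin> B"
  shows "bracket \<beta> \<gamma> = (\<lambda>x. 0)"
  using assms basis_word_iff[of "fst \<beta>" "snd \<beta>"] by (simp add: bracket_def partial_sum_eq_zero)

lemma bracket_vertex: "bracket \<beta> (v, []) = (\<lambda>x. 0)"
  by (simp add: bracket_def partial_sum_def[abs_def])

text \<open>The Leibniz rule before any relation is imposed: no path here has to lie in
  \<open>B\<close>. In the algebra it can therefore fail only where the product \<beta>\<gamma>
  becomes zero.\<close>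

lemma bracket_pcomp:
  assumes "composable \<alpha> \<beta>" "composable \<beta> \<gamma>" "composable \<gamma> \<alpha>"
  shows "bracket \<alpha> (pcomp \<beta> \<gamma>) = (\<lambda>x. bracket (pcomp \<alpha> \<beta>) \<gamma> x + bracket (pcomp \<gamma> \<alpha>) \<beta> x :: 'k::field)"
  using assms partial_sum_append[of "snd \<gamma>" "snd \<beta>" "snd \<alpha>", where 'k = 'k]
  by (simp add: bracket_def composable_pcomp_right fun_eq_iff) (simp add: pcomp_def)

text \<open>The functions that are constant along each efficient circuit and zero elsewhere. Written
  as pointwise conditions, membership of a cyclic sum can be checked entry by entry.\<close>

definition relation_space :: "(('v, 'a) path \<times> ('v, 'a) path \<Rightarrow> 'k::field) set" where
  "relation_space = {y \<in> carrier (free_space P).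
     (\<forall>x \<in> P. \<forall>x' \<in> P. pair_circuit x = pair_circuit x' \<longrightarrow> y x = y x') \<and>
     (\<forall>x \<in> P. \<not> efficient G Z (pair_circuit x) \<longrightarrow> y x = 0)}"

lemma relation_spaceI:
  assumes "y \<in> carrier (free_space P)"
    and "\<And>x x'. x \<in> P \<Longrightarrow> x' \<in> P \<Longrightarrow> pair_circuit x = pair_circuit x' \<Longrightarrow> y x = y x'"
    and "\<And>x. x \<in> P \<Longrightarrow> \<not> efficient G Z (pair_circuit x) \<Longrightarrow> y x = 0"
  shows "y \<in> relation_space"
  using assms unfolding relation_space_def by blast

lemma relation_spaceD:
  assumes "y \<in> relation_space"
  shows "y \<in> carrier (free_space P)"
    and "x \<in> P \<Longrightarrow> x' \<in> P \<Longrightarrow> pair_circuit x = pair_circuit x' \<Longrightarrow> y x = y x'"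
    and "x \<in> P \<Longrightarrow> \<not> efficient G Z (pair_circuit x) \<Longrightarrow> y x = 0"
  using assms unfolding relation_space_def by blast+

lemma relation_space_subspace: "is_subspace (free_space P :: ('k::field, _) module) relation_space"
proof (rule is_subspaceI)
  fix y z :: "_ \<Rightarrow> 'k" assume y: "y \<in> relation_space" and z: "z \<in> relation_space"
  note D = relation_spaceD[OF y] relation_spaceD[OF z]
  show "y \<oplus>\<^bsub>free_space P\<^esub> z \<in> relation_space"
  proof (rule relation_spaceI)
    show "y \<oplus>\<^bsub>free_space P\<^esub> z \<in> carrier (free_space P)" by (rule kspace_add[OF kspace_free_space D(1,4)])
    show "(y \<oplus>\<^bsub>free_space P\<^esub> z) x = (y \<oplus>\<^bsub>free_space P\<^esub> z) x'"
      if "x \<in> P" "x' \<in> P" "pair_circuit x = pair_circuit x'" for x x'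
      using D(2)[OF that] D(5)[OF that] by simp
  qed (simp add: D(3,6))
next
  fix y :: "_ \<Rightarrow> 'k" and c assume y: "y \<in> relation_space"
  note D = relation_spaceD[OF y]
  show "c \<odot>\<^bsub>free_space P\<^esub> y \<in> relation_space"
  proof (rule relation_spaceI)
    show "c \<odot>\<^bsub>free_space P\<^esub> y \<in> carrier (free_space P)" by (rule kspace_smult[OF kspace_free_space D(1)])
    show "(c \<odot>\<^bsub>free_space P\<^esub> y) x = (c \<odot>\<^bsub>free_space P\<^esub> y) x'"
      if "x \<in> P" "x' \<in> P" "pair_circuit x = pair_circuit x'" for x x'
      using D(2)[OF that] by simp
  qed (simp add: D(3))
next
  show "\<zero>\<^bsub>free_space P\<^esub> \<in> (relation_space :: (_ \<Rightarrow> 'k) set)"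
    by (rule relation_spaceI[OF kspace_zero[OF kspace_free_space]]) simp_all
qed (rule relation_spaceD(1))

lemma cyclic_sum_rotate: "cyclic_sum (rotate j w) = (cyclic_sum w :: _ \<Rightarrow> 'k::field)"
  by (induction j) (simp_all add: fun_eq_iff del: length_rotate, metis cyclic_sum_rotate1 length_rotate)

lemma cyclic_sum_in_relation_space:
  assumes w: "cyclic_word (snd \<zeta> @ r)" and z: "\<zeta> \<in> Z"
  shows "(cyclic_sum (snd \<zeta> @ r) :: _ \<Rightarrow> 'k::field) \<in> relation_space"
proof -
  let ?w = "snd \<zeta> @ r"
  let ?f = "cyclic_sum ?w :: _ \<Rightarrow> 'k"
  have "?f x = ?f x'" if "x \<in> P" "x' \<in> P" "pair_circuit x = pair_circuit x'" for x x'
  proof (cases "pair_circuit x = circuit (word_path ?w)")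
    case True
    then show ?thesis using cyclic_sum_eq[OF w that(1), where 'k = 'k] cyclic_sum_eq[OF w that(2), where 'k = 'k] that(3) by simp
  next
    case False
    then have "?f x = 0" "?f x' = 0"
      using cyclic_sum_support[OF w, of x, where 'k = 'k] cyclic_sum_support[OF w, of x', where 'k = 'k] that(3)
      by metis+
    then show ?thesis by simp
  qed
  moreover have "?f x = 0" if "x \<in> P" "\<not> efficient G Z (pair_circuit x)" for x
    using efficient_of_factor[OF w z, of x, where 'k = 'k] cyclic_sum_support[OF w, of x, where 'k = 'k] that by metis
  ultimately show ?thesis
    by (intro relation_spaceI partial_sum_carrier w)
qed

text \<open>A relation inside \<gamma> extends the sum over \<gamma> to the sum over the whole
  cyclic word. That sum is invariant under rotation, so the relation may be moved to the
  front.\<close>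

lemma bracket_in_relation_space:
  assumes p: "\<alpha> \<in> paths G" "\<gamma> \<in> paths G" and c: "composable \<alpha> \<gamma>" "composable \<gamma> \<alpha>" and n: "\<gamma> \<notin> B"
  shows "(bracket \<alpha> \<gamma> :: _ \<Rightarrow> 'k::field) \<in> relation_space"
proof -
  have nb: "\<not> basis_word (snd \<gamma>)" using basis_word_iff[of "fst \<gamma>" "snd \<gamma>"] p n by simp
  then obtain \<zeta> r s where *: "\<zeta> \<in> Z" "snd \<gamma> = r @ snd \<zeta> @ s"
    using not_basis_word[of "fst \<gamma>" "snd \<gamma>"] p(2) by (metis prod.collapse)
  let ?w = "snd \<gamma> @ snd \<alpha>"
  have w: "cyclic_word ?w" using nb by (intro cyclic_word_pcomp p c) (auto simp: basis_word_def)
  have rot: "rotate (length r) ?w = snd \<zeta> @ (s @ snd \<alpha> @ r)"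
    using rotate_append[of r "snd \<zeta> @ s @ snd \<alpha>"] by (simp add: *)
  have "bracket \<alpha> \<gamma> = (cyclic_sum ?w :: _ \<Rightarrow> 'k)"
    using c partial_sum_outside[OF nb] by (simp add: bracket_def)
  also have "\<dots> = cyclic_sum (rotate (length r) ?w)" by (rule cyclic_sum_rotate[symmetric])
  also have "\<dots> \<in> relation_space"
    unfolding rot by (rule cyclic_sum_in_relation_space[OF _ *(1)]) (use cyclic_word_rotate[OF w, of "length r"] rot in simp)
  finally show ?thesis .
qed

lemma finite_P:
  assumes finB: "finite B"
  shows "finite P"
proof -
  have "arrow_paths G = (\<lambda>a. (tail G a, [a])) ` arcs G" by (auto simp: arrow_paths_def)
  then have "finite (arrow_paths G)" by simp
  then show ?thesis unfolding P_def odot_def using finB by (rule_tac finite_subset[of _ "arrow_paths G \<times> B"]) auto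
qed

text \<open>The target in which arrow forms are detected: a map from \<open>Om\<close> to this space
  shows that they satisfy no relations beyond \<open>relation_space\<close>.\<close>

abbreviation "reduced_space \<equiv> quotient (free_space P :: ('k::field, _) module) relation_space"

definition red :: "(('v, 'a) path \<times> ('v, 'a) path \<Rightarrow> 'k::field) \<Rightarrow> (('v, 'a) path \<times> ('v, 'a) path \<Rightarrow> 'k) set" where
  "red y = relation_space +>\<^bsub>free_space P\<^esub> y"

lemma kspace_reduced_space: "kspace (reduced_space :: ('k::field, _) module)"
  by (rule kspace_quotient[OF kspace_free_space relation_space_subspace])

lemma lin_red: "lin (free_space P) reduced_space red"
  unfolding red_def[abs_def] by (rule lin_coset[OF kspace_free_space relation_space_subspace])

lemma red_zero_iff: "y \<in> carrier (free_space P) \<Longrightarrow> red y = \<zero>\<^bsub>reduced_space\<^esub> \<longleftrightarrow> y \<in> relation_space"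
  unfolding red_def quotient_zero[OF kspace_free_space relation_space_subspace]
  by (rule coset_eq_zero_iff[OF kspace_free_space relation_space_subspace])

context
  fixes A :: "('k::field, (('v, 'a) path \<Rightarrow> 'k) set) module" (structure)
  assumes A: "A = monomial_algebra G Z" and finB: "finite B"
begin

interpretation K: kalgebra A by (rule kalgebra_A[OF A])

lemma lin_A_eq:
  assumes V: "kspace V" and f: "lin A V f" and g: "lin A V g"
    and eq: "\<And>\<beta>. \<beta> \<in> B \<Longrightarrow> f (bas \<beta>) = g (bas \<beta>)" and x: "x \<in> carrier A"
  shows "f x = g x"
proof (rule A_induct[OF A x])
  show "f \<zero> = g \<zero>" using lin_zero[OF f K.kspace V] lin_zero[OF g K.kspace V] by simp
qed (use f g eq in \<open>simp_all add: lin_add lin_smult\<close>)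

definition bracket_map :: "(('v, 'a) path \<Rightarrow> 'k) set \<Rightarrow> (('v, 'a) path \<Rightarrow> 'k) set \<Rightarrow> ('v, 'a) path \<times> ('v, 'a) path \<Rightarrow> 'k" where
  "bracket_map x a = (\<lambda>p. \<Sum>\<beta> \<in> B. \<Sum>\<gamma> \<in> B. coord x \<beta> * coord a \<gamma> * bracket \<beta> \<gamma> p)"

lemma bracket_map_carrier: "bracket_map x a \<in> carrier (free_space P)"
proof (rule free_space_carrierI[OF finite_P[OF finB]])
  fix p assume "p \<notin> P"
  have "bracket \<beta> \<gamma> p = (0 :: 'k)" if "\<beta> \<in> B" "\<gamma> \<in> B" for \<beta> \<gamma>
  proof -
    have "(bracket \<beta> \<gamma> :: _ \<Rightarrow> 'k) \<in> carrier (free_space P)"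
      by (rule bracket_carrier[OF B_paths[OF that(1)] B_paths[OF that(2)]])
    then show ?thesis using \<open>p \<notin> P\<close> by (auto simp: free_space_carrier)
  qed
  then show "bracket_map x a p = 0" by (simp add: bracket_map_def)
qed simp

lemma lin_bracket_map_left: "lin A (free_space P) (\<lambda>x. bracket_map x a)"
  by (rule linI)
    (auto simp: bracket_map_carrier, auto simp: bracket_map_def lin_add[OF lin_coord[OF A]] lin_smult[OF lin_coord[OF A]]
      distrib_right sum.distrib sum_distrib_left mult.assoc)

lemma lin_bracket_map_right: "lin A (free_space P) (bracket_map x)"
  by (rule linI)
    (auto simp: bracket_map_carrier, auto simp: bracket_map_def lin_add[OF lin_coord[OF A]] lin_smult[OF lin_coord[OF A]]
      distrib_right distrib_left sum.distrib sum_distrib_left mult_ac)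

lemma bracket_map_zero: "bracket_map \<zero> a = (\<lambda>p. 0)" "bracket_map x \<zero> = (\<lambda>p. 0)"
  using lin_zero[OF lin_bracket_map_left K.kspace kspace_free_space] lin_zero[OF lin_bracket_map_right K.kspace kspace_free_space]
  by simp_all

text \<open>The case split is one-sided: for \<beta> outside \<open>B\<close> the bracket is already
  zero, whereas for \<gamma> outside \<open>B\<close> it may be a nonzero circuit sum.\<close>

lemma bracket_map_bas:
  assumes "\<beta> \<in> paths G" "\<gamma> \<in> paths G"
  shows "bracket_map (bas \<beta>) (bas \<gamma>) = (if \<gamma> \<in> B then bracket \<beta> \<gamma> else (\<lambda>p. 0))"
proof -
  have "bracket_map (bas \<beta>) (bas \<gamma>) = bracket \<beta> \<gamma>" if "\<beta> \<in> B" "\<gamma> \<in> B"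
  proof
    fix p
    have "bracket_map (bas \<beta>) (bas \<gamma>) p = (\<Sum>\<beta>' \<in> B. \<Sum>\<gamma>' \<in> B. if \<gamma>' = \<gamma> then (if \<beta>' = \<beta> then bracket \<beta> \<gamma> p else 0) else 0)"
      unfolding bracket_map_def using that by (intro sum.cong refl) (auto simp: coord_bas[OF A] single_apply)
    also have "\<dots> = bracket \<beta> \<gamma> p" using that finB by simp
    finally show "bracket_map (bas \<beta>) (bas \<gamma>) p = bracket \<beta> \<gamma> p" .
  qed
  then show ?thesis
    using assms by (cases "\<beta> \<in> B"; cases "\<gamma> \<in> B") (simp_all add: bracket_map_zero bas_zero[OF A] bracket_nonbasis)
qed

text \<open>The one case not settled by \<open>bracket_pcomp\<close> is a product \<beta>\<gamma>
  that is zero in the algebra. The right side is then the bracket of \<alpha> with a non-basis path,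
  which \<open>red\<close> kills.\<close>

lemma bracket_map_Leibniz_bas:
  assumes B: "\<alpha> \<in> B" "\<beta> \<in> B" "\<gamma> \<in> B"
  shows "red (bracket_map (bas \<alpha>) (bas \<beta> \<otimes> bas \<gamma>)) =
    red (bracket_map (bas \<alpha> \<otimes> bas \<beta>) (bas \<gamma>)) \<oplus>\<^bsub>reduced_space\<^esub> red (bracket_map (bas \<gamma> \<otimes> bas \<alpha>) (bas \<beta>))"
proof -
  note p = B[THEN B_paths]
  have red0: "red (\<lambda>p. 0 :: 'k) = \<zero>\<^bsub>reduced_space\<^esub>"
    using lin_zero[OF lin_red kspace_free_space kspace_reduced_space] by simp
  have t1: "bracket_map (bas \<alpha> \<otimes> bas \<beta>) (bas \<gamma>) = (if composable \<alpha> \<beta> then bracket (pcomp \<alpha> \<beta>) \<gamma> else (\<lambda>p. 0))"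
    using p B by (simp add: bas_mult[OF A] bracket_map_bas pcomp_paths bracket_map_zero)
  have t2: "bracket_map (bas \<gamma> \<otimes> bas \<alpha>) (bas \<beta>) = (if composable \<gamma> \<alpha> then bracket (pcomp \<gamma> \<alpha>) \<beta> else (\<lambda>p. 0))"
    using p B by (simp add: bas_mult[OF A] bracket_map_bas pcomp_paths bracket_map_zero)
  have t3: "bracket_map (bas \<alpha>) (bas \<beta> \<otimes> bas \<gamma>) =
      (if composable \<beta> \<gamma> \<and> pcomp \<beta> \<gamma> \<in> B then bracket \<alpha> (pcomp \<beta> \<gamma>) else (\<lambda>p. 0))"
    using p B by (simp add: bas_mult[OF A] bracket_map_bas pcomp_paths bracket_map_zero)
  show ?thesis
  proof (cases "composable \<alpha> \<beta> \<and> composable \<beta> \<gamma> \<and> composable \<gamma> \<alpha>")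
    case True
    let ?u = "bracket (pcomp \<alpha> \<beta>) \<gamma> :: _ \<Rightarrow> 'k" and ?v = "bracket (pcomp \<gamma> \<alpha>) \<beta> :: _ \<Rightarrow> 'k"
    have eq: "bracket \<alpha> (pcomp \<beta> \<gamma>) = ?u \<oplus>\<^bsub>free_space P\<^esub> ?v" using bracket_pcomp[of \<alpha> \<beta> \<gamma>] True by simp
    have cl: "?u \<in> carrier (free_space P)" "?v \<in> carrier (free_space P)"
      using True p by (auto intro!: bracket_carrier pcomp_paths)
    have "red (bracket_map (bas \<alpha>) (bas \<beta> \<otimes> bas \<gamma>)) = red (bracket \<alpha> (pcomp \<beta> \<gamma>))"
    proof (cases "pcomp \<beta> \<gamma> \<in> B")
      case False
      have pbc: "pcomp \<beta> \<gamma> \<in> paths G" using True p by (intro pcomp_paths) auto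
      have "(bracket \<alpha> (pcomp \<beta> \<gamma>) :: _ \<Rightarrow> 'k) \<in> relation_space"
        using True p False by (intro bracket_in_relation_space pbc) (auto simp: composable_pcomp_right)
      then show ?thesis
        using False red_zero_iff[OF bracket_carrier[OF p(1) pbc, where 'k = 'k]] red0 by (simp add: t3)
    qed (use True in \<open>simp add: t3\<close>)
    also have "\<dots> = red ?u \<oplus>\<^bsub>reduced_space\<^esub> red ?v" unfolding eq by (rule lin_add[OF lin_red cl])
    finally show ?thesis using True by (simp add: t1 t2)
  next
    case False
    \<comment> \<open>Each of the three terms needs all three junctions of the cyclic triple, so one
      mismatch makes them all zero.\<close>
    have "bracket_map (bas \<alpha> \<otimes> bas \<beta>) (bas \<gamma>) = (\<lambda>p. 0)" "bracket_map (bas \<gamma> \<otimes> bas \<alpha>) (bas \<beta>) = (\<lambda>p. 0)"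
      "bracket_map (bas \<alpha>) (bas \<beta> \<otimes> bas \<gamma>) = (\<lambda>p. 0)"
      using False unfolding t1 t2 t3 by (auto simp: bracket_def composable_pcomp_right)
    then show ?thesis using red0 kspace_add_zero(1)[OF kspace_reduced_space[where 'k = 'k] kspace_zero[OF kspace_reduced_space]] by simp
  qed
qed

text \<open>Both sides are linear in each variable; the identity is extended from basis paths first
  in \<open>b\<close>, then in \<open>a\<close>, then in \<open>x\<close>.\<close>

lemma bracket_map_Leibniz:
  assumes x: "x \<in> carrier A" and a: "a \<in> carrier A" and b: "b \<in> carrier A"
  shows "red (bracket_map x (a \<otimes> b)) = red (bracket_map (x \<otimes> a) b) \<oplus>\<^bsub>reduced_space\<^esub> red (bracket_map (b \<otimes> x) a)"
proof -
  note L = lin_comp[OF lin_bracket_map_left lin_red] and R = lin_comp[OF lin_bracket_map_right lin_red]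
  note ml = K.lin_mult_left and mr = K.lin_mult_right
  have 1: "red (bracket_map (bas \<alpha>) (bas \<beta> \<otimes> b)) =
      red (bracket_map (bas \<alpha> \<otimes> bas \<beta>) b) \<oplus>\<^bsub>reduced_space\<^esub> red (bracket_map (b \<otimes> bas \<alpha>) (bas \<beta>))"
    if "\<alpha> \<in> B" "\<beta> \<in> B" for \<alpha> \<beta>
    by (rule lin_A_eq[where f = "\<lambda>b. red (bracket_map (bas \<alpha>) (bas \<beta> \<otimes> b))" and
          g = "\<lambda>b. red (bracket_map (bas \<alpha> \<otimes> bas \<beta>) b) \<oplus>\<^bsub>reduced_space\<^esub> red (bracket_map (b \<otimes> bas \<alpha>) (bas \<beta>))",
          OF kspace_reduced_space _ _ bracket_map_Leibniz_bas[OF that] b])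
      (intro lin_plus kspace_reduced_space lin_comp[OF ml R] R lin_comp[OF mr L] bas_closed[OF A] B_paths that)+
  have 2: "red (bracket_map (bas \<alpha>) (a \<otimes> b)) =
      red (bracket_map (bas \<alpha> \<otimes> a) b) \<oplus>\<^bsub>reduced_space\<^esub> red (bracket_map (b \<otimes> bas \<alpha>) a)"
    if "\<alpha> \<in> B" for \<alpha>
    by (rule lin_A_eq[where f = "\<lambda>a. red (bracket_map (bas \<alpha>) (a \<otimes> b))" and
          g = "\<lambda>a. red (bracket_map (bas \<alpha> \<otimes> a) b) \<oplus>\<^bsub>reduced_space\<^esub> red (bracket_map (b \<otimes> bas \<alpha>) a)",
          OF kspace_reduced_space _ _ 1[OF that] a])
      (intro lin_plus kspace_reduced_space lin_comp[OF mr R] R lin_comp[OF ml L] bas_closed[OF A] B_paths that b)+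
  show ?thesis
    by (rule lin_A_eq[where f = "\<lambda>x. red (bracket_map x (a \<otimes> b))" and
          g = "\<lambda>x. red (bracket_map (x \<otimes> a) b) \<oplus>\<^bsub>reduced_space\<^esub> red (bracket_map (b \<otimes> x) a)",
          OF kspace_reduced_space _ _ 2 x])
      (intro lin_plus kspace_reduced_space L lin_comp[OF mr L] lin_comp[OF ml L] a b)+
qed

end

end

section \<open>The dimension count\<close>

lemma free_space_basis:
  fixes X :: "'x set"
  assumes fin: "finite X"
  shows fin_dim_free_space: "vectorspace.fin_dim class_ring (free_space X :: ('k::field, 'x \<Rightarrow> 'k) module)"
    and dim_free_space: "vectorspace.dim class_ring (free_space X :: ('k::field, 'x \<Rightarrow> 'k) module) = card X"
proof -
  let ?F = "free_space X :: ('k, 'x \<Rightarrow> 'k) module"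
  let ?S = "single ` X :: ('x \<Rightarrow> 'k) set"
  interpret V: vectorspace class_ring ?F by (rule kspace_free_space)
  have inj: "inj_on (single :: 'x \<Rightarrow> 'x \<Rightarrow> 'k) X"
    by (rule inj_onI) (metis single_apply zero_neq_one)
  have SF: "?S \<subseteq> carrier ?F" by auto
  have sub: "is_subspace ?F (V.span ?S)" by (rule is_subspace_span[OF kspace_free_space SF])
  have "v \<in> V.span ?S" if "v \<in> carrier ?F" for v
    using that
  proof (induction rule: free_space_induct)
    case zero
    then show ?case using is_subspace_zero[OF sub] by simp
  next
    case (single x c)
    then show ?case
      using is_subspace_smult[OF sub span_superset[OF kspace_free_space SF, of "single x"], of c] by simp
  next
    case (add f g)
    then show ?case using is_subspace_add[OF sub, of f g] by simp
  qed
  then have gen: "V.span ?S = carrier ?F" using is_subspace_carrier[OF sub] by blast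
  have "V.lin_indpt ?S"
  proof (rule V.finite_lin_indpt2)
    fix a assume "a \<in> ?S \<rightarrow> carrier (class_ring :: 'k ring)" and 0: "V.lincomb a ?S = \<zero>\<^bsub>?F\<^esub>"
    have sum: "(\<Oplus>\<^bsub>?F\<^esub> v \<in> Y. a v \<odot>\<^bsub>?F\<^esub> v) = (\<lambda>x. \<Sum>v \<in> Y. a v * v x)"
      if "finite Y" "Y \<subseteq> carrier ?F" for Y
      using that
    proof (induction Y)
      case empty
      then show ?case using finsum_empty_kspace[OF kspace_free_space[of X]] by simp
    next
      case (insert w Y)
      have "a v \<odot>\<^bsub>?F\<^esub> v \<in> carrier ?F" if "v \<in> insert w Y" for v
        using insert.prems that by (intro kspace_smult[OF kspace_free_space]) auto
      then show ?case
        using insert finsum_insert_kspace[OF kspace_free_space, of Y w "\<lambda>v. a v \<odot>\<^bsub>?F\<^esub> v" X] by simp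
    qed
    show "\<forall>v \<in> ?S. a v = \<zero>\<^bsub>class_ring\<^esub>"
    proof
      fix v assume "v \<in> ?S"
      then obtain x where x: "v = single x" "x \<in> X" by blast
      have "0 = (\<Sum>v \<in> ?S. a v * v x)"
        using 0 sum[of ?S] fin SF by (simp add: V.lincomb_def fun_eq_iff)
      also have "\<dots> = (\<Sum>y \<in> X. a (single y) * single y x)" by (simp add: sum.reindex[OF inj])
      also have "\<dots> = (\<Sum>y \<in> X. if y = x then a (single y) else 0)"
        by (intro sum.cong) (auto simp: single_apply)
      also have "\<dots> = a v" using fin x by simp
      finally show "a v = \<zero>\<^bsub>class_ring\<^esub>" by simp
    qed
  qed (use fin in auto)
  then have basis: "V.basis ?S" using gen SF by (simp add: V.basis_def)
  show "V.fin_dim" using gen SF fin unfolding V.fin_dim_def by blast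
  show "V.dim = card X" using V.dim_basis[OF _ basis] fin by (simp add: card_image[OF inj])
qed

lemma rank_nullity_kspace:
  assumes V: "kspace V" and W: "kspace W" and f: "lin V W f" and fd: "vectorspace.fin_dim class_ring V"
  shows "vectorspace.dim class_ring V = vectorspace.dim class_ring (W\<lparr>carrier := f ` carrier V\<rparr>) +
    vectorspace.dim class_ring (V\<lparr>carrier := {v \<in> carrier V. f v = \<zero>\<^bsub>W\<^esub>}\<rparr>)"
proof -
  interpret linear_map class_ring V W f by (rule lin_linear_map[OF V W f])
  show ?thesis using rank_nullity[OF fd] by (simp add: im_def ker_def)
qed

lemma fin_dim_image:
  assumes V: "kspace V" and W: "kspace W" and f: "lin V W f" and fd: "vectorspace.fin_dim class_ring V"
  shows "vectorspace.fin_dim class_ring (W\<lparr>carrier := f ` carrier V\<rparr>)"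
proof -
  let ?W = "W\<lparr>carrier := f ` carrier V\<rparr>"
  have W': "kspace ?W" by (rule kspace_restrict[OF W is_subspace_im[OF V W f]])
  have "lin V ?W f" by (rule linI) (simp_all add: lin_add[OF f] lin_smult[OF f])
  then interpret linear_map class_ring V ?W f by (rule lin_linear_map[OF V W'])
  show ?thesis using rank_nullity_main(2)[OF fd] by simp
qed

lemma dim_zero_space:
  assumes V: "kspace V"
  shows "vectorspace.dim class_ring (V\<lparr>carrier := {\<zero>\<^bsub>V\<^esub>}\<rparr>) = 0"
proof -
  have "is_subspace V {\<zero>\<^bsub>V\<^esub>}" by (rule is_subspaceI) (use V in auto)
  then interpret V0: vectorspace class_ring "V\<lparr>carrier := {\<zero>\<^bsub>V\<^esub>}\<rparr>" by (rule kspace_restrict[OF V])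
  have "V0.span {\<zero>\<^bsub>V\<^esub>} = {\<zero>\<^bsub>V\<^esub>}"
    using V0.span_closed[of "{\<zero>\<^bsub>V\<^esub>}"] V0.span_zero[of "{\<zero>\<^bsub>V\<^esub>}"] by auto
  then show ?thesis by (intro V0.dim0I) simp
qed

section \<open>Strong circuits and the rank of the commutator map\<close>

context monomial_quiver
begin

definition basis_cycles :: "('v, 'a) path set" where
  "basis_cycles = B \<inter> cycles G"

definition proj :: "('v, 'a) path \<Rightarrow> ('v, 'a) path \<Rightarrow> 'k::field" where
  "proj c = (if c \<in> B then single c else (\<lambda>x. 0))"

lemma proj_carrier: "c \<in> cycles G \<Longrightarrow> (proj c :: _ \<Rightarrow> 'k::field) \<in> carrier (free_space basis_cycles)"
  using kspace_zero[OF kspace_free_space, of basis_cycles] by (auto simp: proj_def basis_cycles_def)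

definition strong_circuits :: "('v, 'a) path set set" where
  "strong_circuits = {C \<in> circuits G. strong G Z C}"

lemma strong_subset: "C \<in> strong_circuits \<Longrightarrow> C \<subseteq> basis_cycles"
  using circuit_subset by (auto simp: strong_circuits_def strong_def basis_cycles_def)

lemma finite_circuits_of:
  assumes "finite S" "S \<subseteq> cycles G"
  shows "finite {C \<in> circuits G. C \<inter> S \<noteq> {}}"
proof (rule finite_subset)
  show "{C \<in> circuits G. C \<inter> S \<noteq> {}} \<subseteq> circuit ` S" using circuit_eqI by blast
qed (simp add: assms)

lemma vertex_cycle: "v \<in> verts G \<Longrightarrow> (v, []) \<in> cycles G"
  by (simp add: cycles_iff)

lemma trivial_strong_circuits:
  "{C \<in> strong_circuits. trivial_circuit G C} = (\<lambda>v. {(v, [])}) ` verts G"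
proof (intro subset_antisym subsetI)
  fix C assume "C \<in> {C \<in> strong_circuits. trivial_circuit G C}"
  then show "C \<in> (\<lambda>v. {(v, [])}) ` verts G" by (auto simp: trivial_circuit_def)
next
  fix C :: "('v, 'a) path set" assume "C \<in> (\<lambda>v. {(v, [])}) ` verts G"
  then obtain v where v: "v \<in> verts G" "C = {(v, [])}" by blast
  have C: "circuit (v, []) \<in> circuits G" "(v, []) \<in> circuit (v, [])"
    using circuit_in_circuits[OF vertex_cycle[OF v(1)]] circuit_self[OF vertex_cycle[OF v(1)]] .
  then have "trivial_circuit G (circuit (v, []))" using trivial_circuit_iff[OF C(1)] v(1) by blast
  then obtain v' where "circuit (v, []) = {(v', [])}" unfolding trivial_circuit_def by blast
  then have "circuit (v, []) = C" using C(2) v(2) by simp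
  with C(1) have "C \<in> circuits G" by (simp only:)
  moreover have "strong G Z C" using vertex_in_B[OF v(1)] v(2) by (simp add: strong_def)
  moreover have "trivial_circuit G C" using v unfolding trivial_circuit_def by blast
  ultimately show "C \<in> {C \<in> strong_circuits. trivial_circuit G C}" by (simp add: strong_circuits_def)
qed

text \<open>Vertices lie in \<open>B\<close>, so every trivial circuit is strong. This is the origin
  of the number of vertices in the dimension formula.\<close>

lemma card_strong_circuits:
  assumes "finite strong_circuits"
  shows "card strong_circuits = card (verts G) + card {C \<in> circuits G. \<not> trivial_circuit G C \<and> strong G Z C}"
proof -
  have "strong_circuits = {C \<in> strong_circuits. trivial_circuit G C} \<union> {C \<in> circuits G. \<not> trivial_circuit G C \<and> strong G Z C}"
    by (auto simp: strong_circuits_def)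
  then have "card strong_circuits = card {C \<in> strong_circuits. trivial_circuit G C} +
      card {C \<in> circuits G. \<not> trivial_circuit G C \<and> strong G Z C}"
    using assms by (metis (no_types, lifting) card_Un_disjoint finite_Un disjoint_iff mem_Collect_eq)
  also have "card {C \<in> strong_circuits. trivial_circuit G C} = card (verts G)"
    unfolding trivial_strong_circuits by (rule card_image) (auto simp: inj_on_def)
  finally show ?thesis .
qed

text \<open>The vertex in a pair is forced to be the base point of the cycle.\<close>

lemma card_odot_vertices: "card (odot G (vertex_paths G) B) = card basis_cycles"
proof -
  have "odot G (vertex_paths G) B = (\<lambda>\<beta>. ((psource \<beta>, []), \<beta>)) ` basis_cycles"
  proof (intro subset_antisym subsetI)
    fix x :: "('v, 'a) path \<times> ('v, 'a) path" assume "x \<in> odot G (vertex_paths G) B"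
    then obtain v \<beta> where "x = ((v, []), \<beta>)" "\<beta> \<in> B" "ptarget G \<beta> = v" "v = psource \<beta>"
      by (auto simp: odot_def vertex_paths_def psource_def)
    moreover from this have "\<beta> \<in> basis_cycles" using B_paths by (simp add: basis_cycles_def cycles_def)
    ultimately show "x \<in> (\<lambda>\<beta>. ((psource \<beta>, []), \<beta>)) ` basis_cycles" by blast
  next
    fix x :: "('v, 'a) path \<times> ('v, 'a) path" assume "x \<in> (\<lambda>\<beta>. ((psource \<beta>, []), \<beta>)) ` basis_cycles"
    then obtain \<beta> where "x = ((psource \<beta>, []), \<beta>)" "\<beta> \<in> B" "psource \<beta> = ptarget G \<beta>"
      by (auto simp: basis_cycles_def cycles_def)
    then show "x \<in> odot G (vertex_paths G) B"
      using psource_in_verts[OF B_paths, of \<beta>] by (auto simp: odot_def vertex_paths_def psource_def)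
  qed
  then show ?thesis by (simp add: card_image inj_on_def)
qed

text \<open>The commutator \<beta>a - a\<beta> attached to the form \<beta> da, in coordinates on
  basis cycles. For the pair \<open>uncons w\<close> it is the word minus its rotation.\<close>

definition boundary_map :: "(('v, 'a) path \<times> ('v, 'a) path \<Rightarrow> 'k::field) \<Rightarrow> ('v, 'a) path \<Rightarrow> 'k" where
  "boundary_map = linear_extension (free_space basis_cycles)
     (\<lambda>x c. proj (pcomp (snd x) (fst x)) c - proj (pcomp (fst x) (snd x)) c)"

lemma pcomp_uncons': "cyclic_word w \<Longrightarrow> pcomp (snd (uncons w)) (fst (uncons w)) = word_path w"
  by (cases w) (auto simp: uncons_def pcomp_def word_path_def cyclic_word_def)

lemma P_cycle': "x \<in> P \<Longrightarrow> pcomp (snd x) (fst x) \<in> cycles G"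
  unfolding P_iff using pcomp_uncons' cyclic_word_path by metis

lemma boundary_map_carrier:
  assumes "x \<in> P"
  shows "(\<lambda>c. proj (pcomp (snd x) (fst x)) c - proj (pcomp (fst x) (snd x)) c :: 'k::field) \<in> carrier (free_space basis_cycles)"
proof -
  note cl = proj_carrier[OF P_cycle'[OF assms], where 'k = 'k] proj_carrier[OF P_cycle[OF assms], where 'k = 'k]
  show ?thesis using kspace_minus[OF kspace_free_space cl] by (simp add: free_space_minus[OF cl])
qed

lemma lin_boundary_map: "lin (free_space P) (free_space basis_cycles) (boundary_map :: _ \<Rightarrow> _ \<Rightarrow> 'k::field)"
  unfolding boundary_map_def by (rule lin_linear_extension[OF kspace_free_space boundary_map_carrier])

lemma boundary_map_single:
  "x \<in> P \<Longrightarrow> boundary_map (single x) = (\<lambda>c. proj (pcomp (snd x) (fst x)) c - proj (pcomp (fst x) (snd x)) c :: 'k::field)"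
  unfolding boundary_map_def by (rule linear_extension_single[OF kspace_free_space boundary_map_carrier])

text \<open>The functionals that cut out the image of the commutator map, one for each strong
  circuit. A circuit with a non-basis cycle imposes no condition, so its value is set to 0.\<close>

definition circuit_sum :: "(('v, 'a) path \<Rightarrow> 'k::field) \<Rightarrow> ('v, 'a) path set \<Rightarrow> 'k" where
  "circuit_sum f C = (if C \<in> strong_circuits then \<Sum>c \<in> C. f c else 0)"

context
  assumes finB: "finite B"
begin

lemma finite_basis_cycles: "finite basis_cycles"
  using finB by (simp add: basis_cycles_def)

lemma finite_strong_circuits: "finite strong_circuits"
proof (rule finite_subset)
  show "strong_circuits \<subseteq> {C \<in> circuits G. C \<inter> basis_cycles \<noteq> {}}"
    using strong_subset circuit_nonempty by (fastforce simp: strong_circuits_def)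
  show "finite {C \<in> circuits G. C \<inter> basis_cycles \<noteq> {}}"
    by (rule finite_circuits_of[OF finite_basis_cycles]) (simp add: basis_cycles_def)
qed

lemma finite_strong: "C \<in> strong_circuits \<Longrightarrow> finite C"
  using strong_subset finite_basis_cycles finite_subset by blast

lemma lin_circuit_sum: "lin (free_space basis_cycles) (free_space strong_circuits) (circuit_sum :: _ \<Rightarrow> _ \<Rightarrow> 'k::field)"
proof (rule linI)
  fix f :: "_ \<Rightarrow> 'k" assume "f \<in> carrier (free_space basis_cycles)"
  show "circuit_sum f \<in> carrier (free_space strong_circuits)"
    by (rule free_space_carrierI[OF finite_strong_circuits]) (auto simp: circuit_sum_def)
qed (auto simp: circuit_sum_def fun_eq_iff sum.distrib sum_distrib_left)

lemma circuit_sum_single: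
  assumes "c \<in> cycles G"
  shows "circuit_sum (single c) = (if circuit c \<in> strong_circuits then single (circuit c) else (\<lambda>C. 0 :: 'k::field))"
proof
  fix C
  show "circuit_sum (single c) C = (if circuit c \<in> strong_circuits then single (circuit c) else (\<lambda>C. 0 :: 'k)) C"
  proof (cases "C \<in> strong_circuits")
    case True
    have "circuit_sum (single c) C = (\<Sum>d \<in> C. if d = c then 1 else 0 :: 'k)"
      using True by (simp add: circuit_sum_def single_apply)
    also have "\<dots> = (if c \<in> C then 1 else 0)" using finite_strong[OF True] by simp
    also have "c \<in> C \<longleftrightarrow> C = circuit c"
      using True circuit_eqI[of C c] circuit_self[OF assms] by (auto simp: strong_circuits_def)
    finally show ?thesis using True by (auto simp: single_apply[of "circuit c"])
  qed (auto simp: circuit_sum_def single_apply)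
qed

lemma circuit_sum_proj:
  assumes "c \<in> cycles G"
  shows "circuit_sum (proj c) = (if circuit c \<in> strong_circuits then single (circuit c) else (\<lambda>C. 0 :: 'k::field))"
proof (cases "c \<in> B")
  case True
  then show ?thesis using circuit_sum_single[OF assms] by (simp add: proj_def)
next
  case False
  then have "circuit c \<notin> strong_circuits"
    using circuit_self[OF assms] by (auto simp: strong_circuits_def strong_def)
  then show ?thesis using False by (simp add: proj_def circuit_sum_def fun_eq_iff)
qed

text \<open>If the tail of \<open>w\<close> is a basis word, then \<open>w\<close> and its rotation
  differ by a commutator; otherwise both contain that tail and project to zero. A circuit can thus
  be walked along freely, even through its non-basis cycles.\<close>

lemma proj_diff_in_image:
  assumes "(c, c') \<in> conj_rel" and "c \<in> cycles G"
  shows "(\<lambda>d. proj c d - proj c' d :: 'k::field) \<in> boundary_map ` carrier (free_space P)"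
proof -
  let ?M = "boundary_map ` carrier (free_space P) :: (_ \<Rightarrow> 'k) set"
  have M: "is_subspace (free_space basis_cycles) ?M"
    by (rule is_subspace_im[OF kspace_free_space kspace_free_space lin_boundary_map])
  have step: "(\<lambda>d. proj (word_path w) d - proj (word_path (rotate1 w)) d) \<in> ?M" if w: "cyclic_word w" for w
  proof (cases "basis_word (tl w)")
    case True
    then have "uncons w \<in> P" using w by (simp add: uncons_P)
    then have "boundary_map (single (uncons w)) \<in> ?M" by simp
    then show ?thesis using boundary_map_single[OF \<open>uncons w \<in> P\<close>, where 'k = 'k] w
      by (simp add: pcomp_uncons pcomp_uncons')
  next
    case False
    obtain a p where ap: "w = a # p" using w by (cases w) (auto simp: cyclic_word_def)
    have "\<not> basis_word w" "\<not> basis_word (rotate1 w)"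
      using False basis_word_infix[of "[a]" p "[]"] basis_word_infix[of "[]" p "[a]"] by (auto simp: ap)
    moreover have "word_path w \<in> paths G" "word_path (rotate1 w) \<in> paths G"
      using cyclic_word_path[OF w] cyclic_word_path[OF cyclic_word_rotate1(1)[OF w]] by (auto simp: cycles_def)
    ultimately have "word_path w \<notin> B" "word_path (rotate1 w) \<notin> B"
      unfolding word_path_def using basis_word_iff by blast+
    then show ?thesis using is_subspace_zero[OF M] by (simp add: proj_def)
  qed
  show ?thesis using assms(1)
  proof (induction rule: conj_rel_induct)
    case refl
    then show ?case using is_subspace_zero[OF M] by simp
  next
    case (rotate w)
    then show ?case using is_subspace_add[OF M rotate(2) step[OF rotate(1)]] by simp
  next
    case (unrotate w)
    then show ?case
      using is_subspace_minus[OF kspace_free_space M unrotate(2) step[OF unrotate(1)]]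
        free_space_minus[OF is_subspace_carrier[OF M unrotate(2)] is_subspace_carrier[OF M step[OF unrotate(1)]]]
      by simp
  qed
qed

text \<open>Modulo the image, a basis cycle equals a chosen representative of its circuit if the
  circuit is strong. If not, a walk along the circuit reaches a non-basis cycle, which projects to
  zero, so the cycle itself lies in the image.\<close>

lemma image_boundary_map:
  "boundary_map ` carrier (free_space P) =
     {f \<in> carrier (free_space basis_cycles). circuit_sum f = (\<lambda>C. 0 :: 'k::field)}"
proof (intro subset_antisym subsetI)
  let ?M = "boundary_map ` carrier (free_space P) :: (_ \<Rightarrow> 'k) set"
  fix f :: "_ \<Rightarrow> 'k" assume "f \<in> ?M"
  then obtain y where y: "y \<in> carrier (free_space P)" "f = boundary_map y" by blast
  have "circuit_sum (boundary_map y) = \<zero>\<^bsub>free_space strong_circuits\<^esub>"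
  proof (rule lin_free_space_eq[OF kspace_free_space lin_comp[OF lin_boundary_map lin_circuit_sum]
        lin_const_zero[OF kspace_free_space] _ y(1)])
    fix x assume x: "x \<in> P"
    let ?c = "pcomp (snd x) (fst x)" and ?d = "pcomp (fst x) (snd x)"
    note cl = proj_carrier[OF P_cycle'[OF x], where 'k = 'k] proj_carrier[OF P_cycle[OF x], where 'k = 'k]
    have "circuit ?c = circuit ?d"
    proof -
      obtain w where w: "cyclic_word w" "x = uncons w" using x by (auto simp: P_iff)
      then show ?thesis by (simp add: pcomp_uncons pcomp_uncons' circuit_rotate1)
    qed
    then have "circuit_sum (proj ?c) = (circuit_sum (proj ?d) :: _ \<Rightarrow> 'k)"
      by (simp add: circuit_sum_proj[OF P_cycle[OF x]] circuit_sum_proj[OF P_cycle'[OF x]])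
    moreover have "boundary_map (single x) = proj ?c \<ominus>\<^bsub>free_space basis_cycles\<^esub> (proj ?d :: _ \<Rightarrow> 'k)"
      using boundary_map_single[OF x] free_space_minus[OF cl] by simp
    ultimately show "circuit_sum (boundary_map (single x)) = (\<zero>\<^bsub>free_space strong_circuits\<^esub> :: _ \<Rightarrow> 'k)"
      using lin_minus[OF lin_circuit_sum kspace_free_space kspace_free_space cl]
        kspace_minus_self[OF kspace_free_space lin_closed[OF lin_circuit_sum cl(2)]] by (simp only:)
  qed
  then show "f \<in> {f \<in> carrier (free_space basis_cycles). circuit_sum f = (\<lambda>C. 0)}"
    using y lin_closed[OF lin_boundary_map y(1)] by simp
next
  let ?M = "boundary_map ` carrier (free_space P) :: (_ \<Rightarrow> 'k) set"
  have M: "is_subspace (free_space basis_cycles) ?M"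
    by (rule is_subspace_im[OF kspace_free_space kspace_free_space lin_boundary_map])
  fix f :: "_ \<Rightarrow> 'k" assume f: "f \<in> {f \<in> carrier (free_space basis_cycles). circuit_sum f = (\<lambda>C. 0)}"
  define rep where "rep C = (SOME c. c \<in> C)" for C :: "('v, 'a) path set"
  have rep: "rep C \<in> C" if "C \<in> circuits G" for C
    using circuit_nonempty[OF that] unfolding rep_def by (auto intro: someI)
  define r where "r = linear_extension (free_space basis_cycles) (\<lambda>C. single (rep C) :: _ \<Rightarrow> 'k)"
  have rc: "(single (rep C) :: _ \<Rightarrow> 'k) \<in> carrier (free_space basis_cycles)" if "C \<in> strong_circuits" for C
    using that strong_subset[OF that] rep[of C] by (intro single_carrier) (auto simp: strong_circuits_def)
  have lr: "lin (free_space strong_circuits) (free_space basis_cycles) r"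
    unfolding r_def by (rule lin_linear_extension[OF kspace_free_space rc])
  have rs: "r (single C) = single (rep C)" if "C \<in> strong_circuits" for C
    unfolding r_def by (rule linear_extension_single[OF kspace_free_space rc that])
  have r0: "r (\<lambda>C. 0) = (\<lambda>c. 0)" using lin_zero[OF lr] by simp
  \<comment> \<open>The correction by representatives makes the claim hold for every
    \<open>f\<close>, so that it can be proved by linearity on single cycles; on the kernel of
    \<open>circuit_sum\<close> the correction disappears.\<close>
  have "(\<lambda>c. f c - r (circuit_sum f) c) \<in> ?M" if "f \<in> carrier (free_space basis_cycles)" for f :: "_ \<Rightarrow> 'k"
    using that
  proof (induction rule: free_space_induct)
    case zero
    then show ?case
    proof -
      have "circuit_sum (\<lambda>x. 0 :: 'k) = (\<lambda>C. 0)" by (simp add: circuit_sum_def fun_eq_iff)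
      then show ?thesis using is_subspace_zero[OF M] r0 by simp
    qed
  next
    case (single c a)
    have c: "c \<in> cycles G" "c \<in> B" using single by (auto simp: basis_cycles_def)
    have "(\<lambda>d. single c d - r (circuit_sum (single c)) d) \<in> ?M"
    proof (cases "circuit c \<in> strong_circuits")
      case True
      have "rep (circuit c) \<in> circuit c" by (rule rep[OF circuit_in_circuits[OF c(1)]])
      moreover from this have "rep (circuit c) \<in> B" using strong_subset[OF True] by (auto simp: basis_cycles_def)
      ultimately show ?thesis
        using proj_diff_in_image[OF mem_circuit_conj_rel c(1), of "rep (circuit c)", where 'k = 'k] True c
        by (simp add: circuit_sum_single rs proj_def)
    next
      case False
      then obtain c' where "c' \<in> circuit c" "c' \<notin> B"
        using circuit_in_circuits[OF c(1)] by (auto simp: strong_circuits_def strong_def)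
      then show ?thesis
        using proj_diff_in_image[OF mem_circuit_conj_rel c(1), of c', where 'k = 'k] False c
        by (simp add: circuit_sum_single r0 proj_def)
    qed
    then have "(\<lambda>d. a * (single c d - r (circuit_sum (single c)) d)) \<in> ?M"
      using is_subspace_smult[OF M, of _ a] by fastforce
    moreover have "r (circuit_sum (\<lambda>y. a * single c y)) = (\<lambda>d. a * r (circuit_sum (single c)) d)"
      using lin_smult[OF lin_comp[OF lin_circuit_sum lr], of "single c" a] single by simp
    ultimately show ?case by (simp add: right_diff_distrib)
  next
    case (add f g)
    have "r (circuit_sum (\<lambda>x. f x + g x)) = (\<lambda>d. r (circuit_sum f) d + r (circuit_sum g) d)"
      using lin_add[OF lin_comp[OF lin_circuit_sum lr] add(1,2)] by simp
    then show ?case using is_subspace_add[OF M add(3,4)] by (simp add: algebra_simps)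
  qed
  from this[of f] show "f \<in> ?M" using f r0 by simp
qed

text \<open>Rank-nullity for \<open>circuit_sum\<close>: its kernel is the image of the commutator
  map, and it is onto because any cycle of a strong circuit hits the corresponding basis
  vector.\<close>

lemma dim_image_boundary_map:
  "card basis_cycles = vectorspace.dim class_ring
     (free_space basis_cycles\<lparr>carrier := boundary_map ` carrier (free_space P :: ('k::field, _) module)\<rparr>) + card strong_circuits"
proof -
  have surj: "circuit_sum ` carrier (free_space basis_cycles) = carrier (free_space strong_circuits :: ('k, _) module)"
  proof (intro subset_antisym subsetI)
    fix g :: "_ \<Rightarrow> 'k" assume "g \<in> carrier (free_space strong_circuits)"
    then show "g \<in> circuit_sum ` carrier (free_space basis_cycles)"
    proof (induction rule: free_space_induct)
      case zero
      then show ?case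
        using is_subspace_zero[OF is_subspace_im[OF kspace_free_space kspace_free_space lin_circuit_sum]] by simp
    next
      case (single C a)
      then obtain c where c: "c \<in> C" using circuit_nonempty[of C] unfolding strong_circuits_def by blast
      have "C = circuit c" using single c circuit_eqI by (auto simp: strong_circuits_def)
      moreover have "c \<in> basis_cycles" using strong_subset single c by blast
      ultimately have "circuit_sum (single c) = (single C :: _ \<Rightarrow> 'k)" "single c \<in> carrier (free_space basis_cycles :: ('k, _) module)"
        using single by (auto simp: circuit_sum_single basis_cycles_def)
      then have "single C \<in> circuit_sum ` carrier (free_space basis_cycles :: ('k, _) module)" by (metis imageI)
      then show ?case
        using is_subspace_smult[OF is_subspace_im[OF kspace_free_space kspace_free_space lin_circuit_sum], of "single C" a] by simp
    next
      case (add f g)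
      then show ?case
        using is_subspace_add[OF is_subspace_im[OF kspace_free_space kspace_free_space lin_circuit_sum], of f g] by simp
    qed
  qed (auto intro: lin_closed[OF lin_circuit_sum])
  have "vectorspace.dim class_ring (free_space basis_cycles :: ('k, _) module) = card basis_cycles"
    "vectorspace.dim class_ring (free_space strong_circuits :: ('k, _) module) = card strong_circuits"
    by (rule dim_free_space[OF finite_basis_cycles], rule dim_free_space[OF finite_strong_circuits])
  then show ?thesis
    using rank_nullity_kspace[of "free_space basis_cycles :: ('k, _) module" "free_space strong_circuits :: ('k, _) module",
        OF kspace_free_space kspace_free_space lin_circuit_sum fin_dim_free_space[OF finite_basis_cycles]]
    by (simp add: image_boundary_map surj)
qed

end

end

lemma is_subspace_sum_images:
  assumes V: "kspace V" and V': "kspace V'" and W: "kspace W" and f: "lin V W f" and g: "lin V' W g"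
  shows "is_subspace W {f v \<oplus>\<^bsub>W\<^esub> g v' | v v'. v \<in> carrier V \<and> v' \<in> carrier V'}" (is "is_subspace W ?S")
proof (rule is_subspaceI)
  interpret W: vectorspace class_ring W by (rule W)
  show "\<zero>\<^bsub>W\<^esub> \<in> ?S"
    using lin_zero[OF f V W] lin_zero[OF g V' W] V V' W by (force intro!: exI[of _ "\<zero>\<^bsub>V\<^esub>"] exI[of _ "\<zero>\<^bsub>V'\<^esub>"])
  fix x assume x: "x \<in> ?S"
  then obtain v v' where v: "x = f v \<oplus>\<^bsub>W\<^esub> g v'" "v \<in> carrier V" "v' \<in> carrier V'" by blast
  note c = lin_closed[OF f v(2)] lin_closed[OF g v(3)]
  show "x \<in> carrier W" using c v(1) by simp
  show "a \<odot>\<^bsub>W\<^esub> x \<in> ?S" for a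
    using v c V V' W lin_smult[OF f v(2), of a] lin_smult[OF g v(3), of a]
    by (auto simp: kspace_smult_add intro!: exI[of _ "a \<odot>\<^bsub>V\<^esub> v"] exI[of _ "a \<odot>\<^bsub>V'\<^esub> v'"])
  fix y assume "y \<in> ?S"
  then obtain u u' where u: "y = f u \<oplus>\<^bsub>W\<^esub> g u'" "u \<in> carrier V" "u' \<in> carrier V'" by blast
  note d = lin_closed[OF f u(2)] lin_closed[OF g u(3)]
  have "x \<oplus>\<^bsub>W\<^esub> y = f (v \<oplus>\<^bsub>V\<^esub> u) \<oplus>\<^bsub>W\<^esub> g (v' \<oplus>\<^bsub>V'\<^esub> u')"
    using v u c d by (simp add: lin_add[OF f] lin_add[OF g] W.M.add.m_ac)
  moreover have "v \<oplus>\<^bsub>V\<^esub> u \<in> carrier V" "v' \<oplus>\<^bsub>V'\<^esub> u' \<in> carrier V'" using v u V V' by simp_all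
  ultimately show "x \<oplus>\<^bsub>W\<^esub> y \<in> ?S" by blast
qed

lemma lin_free_space_mono:
  fixes X Y :: "'x set" and f :: "'m \<Rightarrow> 'x \<Rightarrow> 'k::field"
  assumes "lin V (free_space X) f" "X \<subseteq> Y"
  shows "lin V (free_space Y) f"
proof -
  have "g \<in> carrier (free_space Y)" if "g \<in> carrier (free_space X)" for g :: "'x \<Rightarrow> 'k"
    using that assms(2) by (auto simp: free_space_carrier)
  then show ?thesis using assms(1) unfolding lin_def by simp
qed

section \<open>Generators and relations of the one-forms, and the final count\<close>

context monomial_quiver
begin

lemma P_D:
  assumes "x \<in> P"
  shows "fst x \<in> paths G" "snd x \<in> B" "composable (fst x) (snd x)" "composable (snd x) (fst x)"
    "length (snd (fst x)) = 1"
  using assms by (auto simp: P_def odot_def arrow_paths_def composable_def paths_Cons psource_def)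

text \<open>Relations have length at least two. In particular the arrow of a pair in
  \<open>P\<close> is nonzero in the algebra.\<close>

lemma short_in_B:
  assumes "\<gamma> \<in> paths G" "length (snd \<gamma>) \<le> 1"
  shows "\<gamma> \<in> B"
proof (rule ccontr)
  assume "\<gamma> \<notin> B"
  then obtain \<zeta> \<delta> \<epsilon> where "\<zeta> \<in> Z" "\<gamma> = pcomp \<delta> (pcomp \<zeta> \<epsilon>)" using nonbasis_iff[OF assms(1)] by blast
  then show False using assms(2) Z_length[of \<zeta>] by (simp add: pcomp_def)
qed

lemma bracket_arrow:
  assumes \<alpha>: "(u, [a]) \<in> paths G" and \<beta>: "\<beta> \<in> paths G"
    and c: "composable \<beta> (u, [a])" "composable (u, [a]) \<beta>"
  shows "\<beta> \<in> B \<Longrightarrow> ((u, [a]), \<beta>) \<in> P"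
    and "bracket \<beta> (u, [a]) = (if \<beta> \<in> B then single ((u, [a]), \<beta>) else (\<lambda>x. 0 :: 'k::field))"
proof -
  have u: "u = tail G a" using \<alpha> by (simp add: paths_Cons)
  have w: "cyclic_word (a # snd \<beta>)" using cyclic_word_pcomp(1)[OF \<beta> \<alpha> c] by simp
  have un: "uncons (a # snd \<beta>) = ((u, [a]), \<beta>)"
    using c(1) u by (cases \<beta>) (simp add: uncons_def composable_def psource_def ptarget_conv)
  have b: "basis_word (snd \<beta>) \<longleftrightarrow> \<beta> \<in> B" using basis_word_iff[of "fst \<beta>" "snd \<beta>"] \<beta> by simp
  show "((u, [a]), \<beta>) \<in> P" if "\<beta> \<in> B" using uncons_P[OF w] un b that by simp
  show "bracket \<beta> (u, [a]) = (if \<beta> \<in> B then single ((u, [a]), \<beta>) else (\<lambda>x. 0 :: 'k))"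
    using c un b by (simp add: bracket_def partial_sum_def fun_eq_iff cyc_term_def)
qed

lemma bracket_P: "x \<in> P \<Longrightarrow> bracket (snd x) (fst x) = (single x :: _ \<Rightarrow> 'k::field)"
proof -
  assume x: "x \<in> P"
  obtain u a where ua: "fst x = (u, [a])" using P_D(5)[OF x] by (cases "fst x") (auto simp: length_Suc_conv)
  show ?thesis
    using bracket_arrow(2)[of u a "snd x", where 'k = 'k] P_D[OF x] B_paths[OF P_D(2)[OF x]] ua
    by (metis prod.collapse)
qed

definition efficient_circuits :: "('v, 'a) path set set" where
  "efficient_circuits = {C \<in> circuits G. efficient G Z C}"

text \<open>Pulls a function on circuits back to pairs. It identifies \<open>relation_space\<close>
  with the free space on the efficient circuits, which gives its dimension.\<close>

definition spread :: "(('v, 'a) path set \<Rightarrow> 'k::field) \<Rightarrow> ('v, 'a) path \<times> ('v, 'a) path \<Rightarrow> 'k" where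
  "spread h x = (if x \<in> P then h (pair_circuit x) else 0)"

context
  fixes A :: "('k::field_char_0, (('v, 'a) path \<Rightarrow> 'k) set) module" (structure)
  assumes A: "A = monomial_algebra G Z" and finB: "finite B"
begin

interpretation K: kalgebra A by (rule kalgebra_A[OF A])

abbreviation "Om \<equiv> K.Om"
abbreviation "om \<equiv> K.om"

lemma om_zero: "a \<in> carrier A \<Longrightarrow> om \<zero> a = \<zero>\<^bsub>Om\<^esub>" "x \<in> carrier A \<Longrightarrow> om x \<zero> = \<zero>\<^bsub>Om\<^esub>"
  using lin_zero[OF K.lin_om_left K.kspace K.kspace_Om] lin_zero[OF K.lin_om_right K.kspace K.kspace_Om] by auto

lemma om_bas_closed: "\<beta> \<in> paths G \<Longrightarrow> \<gamma> \<in> paths G \<Longrightarrow> om (bas \<beta>) (bas \<gamma>) \<in> carrier Om"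
  by (intro K.om_closed bas_closed[OF A])

text \<open>A product is kept as \<open>bas\<close> of the concatenated path even if that path is
  zero in the algebra, so the rule can also be used to take a relation apart.\<close>

lemma om_bas_Leibniz:
  assumes "\<alpha> \<in> paths G" "\<beta> \<in> paths G" "\<gamma> \<in> paths G"
  shows "om (bas \<alpha>) (if composable \<beta> \<gamma> then bas (pcomp \<beta> \<gamma>) else \<zero>) =
    om (if composable \<alpha> \<beta> then bas (pcomp \<alpha> \<beta>) else \<zero>) (bas \<gamma>) \<oplus>\<^bsub>Om\<^esub>
    om (if composable \<gamma> \<alpha> then bas (pcomp \<gamma> \<alpha>) else \<zero>) (bas \<beta>)"
  using K.om_Leibniz[OF bas_closed[OF A assms(1)] bas_closed[OF A assms(2)] bas_closed[OF A assms(3)]]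
  by (simp add: bas_mult[OF A] assms)

definition arrow_forms where "arrow_forms = linear_extension Om (\<lambda>x. om (bas (snd x)) (bas (fst x)))"

lemma om_P_closed: "x \<in> P \<Longrightarrow> om (bas (snd x)) (bas (fst x)) \<in> carrier Om"
  by (rule om_bas_closed[OF B_paths[OF P_D(2)] P_D(1)])

lemma lin_arrow_forms: "lin (free_space P) Om arrow_forms"
  unfolding arrow_forms_def
  by (rule lin_linear_extension[OF K.kspace_Om om_P_closed])

lemma arrow_forms_single: "x \<in> P \<Longrightarrow> arrow_forms (single x) = om (bas (snd x)) (bas (fst x))"
  unfolding arrow_forms_def
  by (rule linear_extension_single[OF K.kspace_Om om_P_closed])

lemma arrow_forms_zero: "arrow_forms (\<lambda>x. 0) = \<zero>\<^bsub>Om\<^esub>"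
  using lin_zero[OF lin_arrow_forms kspace_free_space K.kspace_Om] by simp

lemma pcomp_vertex: "pcomp \<beta> (psource \<beta>, []) = \<beta>" "pcomp (v, []) \<beta> = \<beta>"
  by (simp_all add: pcomp_def psource_def)

lemma composable_vertex: "composable \<beta> (v, []) \<longleftrightarrow> v = psource \<beta>" "composable (v, []) \<beta> \<longleftrightarrow> v = ptarget G \<beta>"
  by (auto simp: composable_def psource_def)

lemma path_Cons_decompose:
  assumes "(u, a # p) \<in> paths G"
  shows "(u, [a]) \<in> paths G" "(head G a, p) \<in> paths G" "composable (head G a, p) (u, [a])"
    "(u, a # p) = pcomp (head G a, p) (u, [a])" "ptarget G (u, a # p) = ptarget G (head G a, p)"
proof -
  show a: "(u, [a]) \<in> paths G" "(head G a, p) \<in> paths G"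
    using assms wellformed(2) by (auto simp: paths_Cons)
  show c: "composable (head G a, p) (u, [a])" by (simp add: composable_def psource_def ptarget_conv)
  show e: "(u, a # p) = pcomp (head G a, p) (u, [a])" by (simp add: pcomp_def)
  show "ptarget G (u, a # p) = ptarget G (head G a, p)" unfolding e by (rule ptarget_pcomp[OF c])
qed

text \<open>The Leibniz rule splits an arrow off \<open>\<gamma>\<close>, which expresses \<open>\<beta> d\<gamma>\<close> through the \<open>\<rho> da\<close> with
  \<open>a\<close> an arrow. No condition that \<open>\<gamma>\<close> is a basis path is needed, so this also evaluates \<open>\<beta> d\<zeta> = 0\<close>
  for a relation \<open>\<zeta>\<close>.\<close>

lemma om_bas_cyclic:
  assumes "\<beta> \<in> paths G" "(u, p) \<in> paths G" "composable \<beta> (u, p)" "composable (u, p) \<beta>"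
  shows "om (bas \<beta>) (bas (u, p)) = arrow_forms (bracket \<beta> (u, p))"
  using assms
proof (induction p arbitrary: \<beta> u)
  case Nil
  have u: "u = psource \<beta>" "u = ptarget G \<beta>" using Nil by (auto simp: composable_vertex)
  \<comment> \<open>The vertex is idempotent, so \<beta> de equals the sum of itself with itself and
    therefore vanishes.\<close>
  have "om (bas \<beta>) (bas (u, [])) = om (bas \<beta>) (bas (u, [])) \<oplus>\<^bsub>Om\<^esub> om (bas \<beta>) (bas (u, []))"
    using om_bas_Leibniz[OF Nil(1,2,2)] u
    by (simp add: composable_vertex pcomp_vertex) (simp add: psource_def pcomp_def)
  then have "om (bas \<beta>) (bas (u, [])) = \<zero>\<^bsub>Om\<^esub>"
    using kspace_add_eq_self[OF K.kspace_Om om_bas_closed[OF Nil(1,2)] om_bas_closed[OF Nil(1,2)]] by simp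
  then show ?case by (simp add: bracket_vertex arrow_forms_zero)
next
  case (Cons a p)
  let ?\<alpha> = "(u, [a])" and ?\<gamma> = "(head G a, p)"
  note d = path_Cons_decompose[OF Cons.prems(2)]
  have c: "composable \<beta> ?\<gamma>" "composable ?\<alpha> \<beta>"
    using Cons.prems(3,4) d(5) by (auto simp: composable_def psource_def)
  let ?\<beta>\<gamma> = "pcomp \<beta> ?\<gamma>" and ?\<alpha>\<beta> = "pcomp ?\<alpha> \<beta>"
  have p: "?\<beta>\<gamma> \<in> paths G" "?\<alpha>\<beta> \<in> paths G" using c d Cons.prems by (auto intro!: pcomp_paths)
  have c': "composable ?\<beta>\<gamma> ?\<alpha>" "composable ?\<alpha> ?\<beta>\<gamma>" "composable ?\<alpha>\<beta> ?\<gamma>" "composable ?\<gamma> ?\<alpha>\<beta>"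
    using c d(3) by (simp_all add: composable_pcomp_right)
  have arrow: "om (bas ?\<beta>\<gamma>) (bas ?\<alpha>) = arrow_forms (bracket ?\<beta>\<gamma> ?\<alpha>)"
  proof (cases "?\<beta>\<gamma> \<in> B")
    case True
    then show ?thesis
      using arrow_forms_single[OF bracket_arrow(1)[OF d(1) p(1) c'(1,2)]] by (simp add: bracket_arrow(2)[OF d(1) p(1) c'(1,2)])
  next
    case False
    then show ?thesis
      using om_zero(1)[OF bas_closed[OF A d(1)]] bas_zero[OF A p(1)] arrow_forms_zero by (simp add: bracket_nonbasis p)
  qed
  have "om (bas \<beta>) (bas (u, a # p)) = om (bas ?\<beta>\<gamma>) (bas ?\<alpha>) \<oplus>\<^bsub>Om\<^esub> om (bas ?\<alpha>\<beta>) (bas ?\<gamma>)"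
    using om_bas_Leibniz[OF Cons.prems(1) d(2,1)] c d(3) by (simp add: d(4)[symmetric])
  also have "\<dots> = arrow_forms (bracket ?\<beta>\<gamma> ?\<alpha>) \<oplus>\<^bsub>Om\<^esub> arrow_forms (bracket ?\<alpha>\<beta> ?\<gamma>)"
    using arrow Cons.IH[OF p(2) d(2) c'(3,4)] by simp
  also have "\<dots> = arrow_forms (bracket ?\<beta>\<gamma> ?\<alpha> \<oplus>\<^bsub>free_space P\<^esub> bracket ?\<alpha>\<beta> ?\<gamma>)"
    by (rule lin_add[OF lin_arrow_forms bracket_carrier[OF p(1) d(1)] bracket_carrier[OF p(2) d(2)], symmetric])
  also have "bracket ?\<beta>\<gamma> ?\<alpha> \<oplus>\<^bsub>free_space P\<^esub> bracket ?\<alpha>\<beta> ?\<gamma> = (bracket \<beta> (u, a # p) :: _ \<Rightarrow> 'k)"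
    unfolding d(4) using bracket_pcomp[OF c(1) d(3) c(2), where 'k = 'k] by simp
  finally show ?case .
qed

context
  fixes U
  assumes U: "is_subspace Om U"
    and gen: "\<And>\<beta>. \<beta> \<in> B \<Longrightarrow> psource \<beta> \<noteq> ptarget G \<beta> \<Longrightarrow> om (bas \<beta>) (bas (psource \<beta>, [])) \<in> U"
begin

lemma U_zero: "\<zero>\<^bsub>Om\<^esub> \<in> U"
  by (rule is_subspace_zero[OF U])

text \<open>If the vertex e is at neither end of \<beta>, both Leibniz terms of \<beta> d(ee)
  vanish. If e is only the target, the zero product of the source vertex s with e gives \<beta> de =
  - \<beta> ds, which trades the target for the source.\<close>

lemma om_vertex_in_U:
  assumes \<beta>: "\<beta> \<in> paths G" and u: "(u, []) \<in> paths G" and nc: "\<not> (composable \<beta> (u, []) \<and> composable (u, []) \<beta>)"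
  shows "om (bas \<beta>) (bas (u, [])) \<in> U"
proof -
  let ?s = "(psource \<beta>, []) :: ('v, 'a) path" and ?u = "(u, []) :: ('v, 'a) path"
  have s: "?s \<in> paths G" using psource_in_verts[OF \<beta>] by simp
  note cl = bas_closed[OF A \<beta>] bas_closed[OF A u] bas_closed[OF A s]
  have uu: "composable ?u ?u" "pcomp ?u ?u = ?u" by (simp_all add: composable_vertex psource_def pcomp_def)
  show ?thesis
  proof (cases "u = psource \<beta>")
    case True
    then have "psource \<beta> \<noteq> ptarget G \<beta>" using nc by (auto simp: composable_vertex)
    then show ?thesis
      using gen[of \<beta>] bas_zero[OF A \<beta>] om_zero(1)[OF cl(2)] U_zero True by (cases "\<beta> \<in> B") auto
  next
    case ns: False
    show ?thesis
    proof (cases "u = ptarget G \<beta>")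
      case False
      then have "om (bas \<beta>) (bas ?u) = om \<zero> (bas ?u) \<oplus>\<^bsub>Om\<^esub> om \<zero> (bas ?u)"
        using om_bas_Leibniz[OF \<beta> u u] ns uu by (simp add: composable_vertex)
      then show ?thesis using om_zero(1)[OF cl(2)] U_zero K.kspace_Om by simp
    next
      case True
      have s_in: "om (bas \<beta>) (bas ?s) \<in> U"
        using gen[of \<beta>] bas_zero[OF A \<beta>] om_zero(1)[OF cl(3)] U_zero ns True by (cases "\<beta> \<in> B") auto
      have "\<not> composable ?s ?u" using ns by (simp add: composable_vertex) (simp add: psource_def)
      then have "om (bas \<beta>) \<zero> = om (bas \<beta>) (bas ?u) \<oplus>\<^bsub>Om\<^esub> om (bas \<beta>) (bas ?s)"
        using om_bas_Leibniz[OF \<beta> s u] True by (simp add: composable_vertex pcomp_vertex)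
      then have 0: "\<zero>\<^bsub>Om\<^esub> = om (bas \<beta>) (bas ?u) \<oplus>\<^bsub>Om\<^esub> om (bas \<beta>) (bas ?s)" using om_zero(2)[OF cl(1)] by simp
      have "\<zero>\<^bsub>Om\<^esub> \<ominus>\<^bsub>Om\<^esub> om (bas \<beta>) (bas ?s) = om (bas \<beta>) (bas ?u)"
        using kspace_minus_iff[OF K.kspace_Om kspace_zero[OF K.kspace_Om] om_bas_closed[OF \<beta> s] om_bas_closed[OF \<beta> u]]
          0 kspace_comm[OF K.kspace_Om om_bas_closed[OF \<beta> s] om_bas_closed[OF \<beta> u]] by simp
      then show ?thesis using is_subspace_minus[OF K.kspace_Om U U_zero s_in] by simp
    qed
  qed
qed

text \<open>Write \<alpha> as its product with the vertex e at an end of \<alpha> that fails to meet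
  \<beta>. The Leibniz term in d\<alpha> vanishes, and the other one is zero or a form \<rho> de in
  which \<rho> does not close up with e.\<close>

lemma om_arrow_in_U:
  assumes \<beta>: "\<beta> \<in> paths G" and \<alpha>: "\<alpha> \<in> paths G" and nc: "\<not> (composable \<beta> \<alpha> \<and> composable \<alpha> \<beta>)"
  shows "om (bas \<beta>) (bas \<alpha>) \<in> U"
proof (cases "composable \<beta> \<alpha>")
  case False
  let ?v = "(ptarget G \<alpha>, []) :: ('v, 'a) path"
  have v: "?v \<in> paths G" using ptarget_in_verts[OF \<alpha>] by simp
  have nv: "\<not> composable \<beta> ?v" using False by (auto simp: composable_vertex) (simp add: composable_def)
  have "om (bas \<beta>) (bas \<alpha>) = om \<zero> (bas \<alpha>) \<oplus>\<^bsub>Om\<^esub> om (if composable \<alpha> \<beta> then bas (pcomp \<alpha> \<beta>) else \<zero>) (bas ?v)"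
    using om_bas_Leibniz[OF \<beta> v \<alpha>] nv by (simp add: composable_vertex pcomp_vertex)
  also have "\<dots> = om (if composable \<alpha> \<beta> then bas (pcomp \<alpha> \<beta>) else \<zero>) (bas ?v)"
    using K.kspace_Om om_zero(1) bas_closed[OF A] \<beta> \<alpha> v
    by (auto simp: pcomp_paths intro!: kspace_add_zero om_bas_closed)
  also have "\<dots> \<in> U"
  proof (cases "composable \<alpha> \<beta>")
    case True
    then show ?thesis
      using nv by (auto simp: composable_vertex intro!: om_vertex_in_U pcomp_paths \<alpha> \<beta> v)
  qed (use om_zero(1)[OF bas_closed[OF A v]] U_zero in simp)
  finally show ?thesis .
next
  case True
  then have nc': "\<not> composable \<alpha> \<beta>" using nc by simp
  let ?u = "(psource \<alpha>, []) :: ('v, 'a) path"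
  have u: "?u \<in> paths G" using psource_in_verts[OF \<alpha>] by simp
  have nu: "\<not> composable ?u \<beta>" using nc' by (auto simp: composable_vertex) (simp add: composable_def)
  have p: "pcomp \<beta> \<alpha> \<in> paths G" by (rule pcomp_paths[OF \<beta> \<alpha> True])
  have "om (bas \<beta>) (bas \<alpha>) = om (bas (pcomp \<beta> \<alpha>)) (bas ?u) \<oplus>\<^bsub>Om\<^esub> om \<zero> (bas \<alpha>)"
    using om_bas_Leibniz[OF \<beta> \<alpha> u] nu True by (simp add: composable_vertex pcomp_vertex)
  also have "\<dots> = om (bas (pcomp \<beta> \<alpha>)) (bas ?u)"
    using K.kspace_Om om_zero(1)[OF bas_closed[OF A \<alpha>]] om_bas_closed[OF p u] by simp
  also have "\<dots> \<in> U"
    using nu ptarget_pcomp[OF True] by (intro om_vertex_in_U p u) (auto simp: composable_vertex)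
  finally show ?thesis .
qed

end

text \<open>Splitting off an arrow leaves the mismatch with \<beta> in place: each Leibniz term that
  is not zero for lack of composability is again a form on a pair that does not close up.\<close>

lemma om_bas_noncyclic:
  assumes U: "is_subspace Om U"
    and gen: "\<And>\<beta>. \<beta> \<in> B \<Longrightarrow> psource \<beta> \<noteq> ptarget G \<beta> \<Longrightarrow> om (bas \<beta>) (bas (psource \<beta>, [])) \<in> U"
    and "\<beta> \<in> paths G" "(u, p) \<in> paths G" "\<not> (composable \<beta> (u, p) \<and> composable (u, p) \<beta>)"
  shows "om (bas \<beta>) (bas (u, p)) \<in> U"
  using assms(3-)
proof (induction p arbitrary: \<beta> u)
  case Nil
  show ?case by (rule om_vertex_in_U[OF U gen Nil])
next
  case (Cons a p)
  let ?\<alpha> = "(u, [a])" and ?\<gamma> = "(head G a, p)"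
  note d = path_Cons_decompose[OF Cons.prems(2)]
  note cl = bas_closed[OF A d(1)] bas_closed[OF A d(2)]
  have c: "composable \<beta> (u, a # p) \<longleftrightarrow> composable \<beta> ?\<gamma>" "composable (u, a # p) \<beta> \<longleftrightarrow> composable ?\<alpha> \<beta>"
    using d(5) by (simp_all add: composable_def psource_def)
  have "om (if composable \<beta> ?\<gamma> then bas (pcomp \<beta> ?\<gamma>) else \<zero>) (bas ?\<alpha>) \<in> U"
  proof (cases "composable \<beta> ?\<gamma>")
    case True
    then have "om (bas (pcomp \<beta> ?\<gamma>)) (bas ?\<alpha>) \<in> U"
      using Cons.prems c d(3)
      by (intro om_arrow_in_U[OF U gen] pcomp_paths d) (auto simp: composable_pcomp_right)
    then show ?thesis using True by simp
  qed (use om_zero(1)[OF cl(1)] is_subspace_zero[OF U] in simp)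
  moreover have "om (if composable ?\<alpha> \<beta> then bas (pcomp ?\<alpha> \<beta>) else \<zero>) (bas ?\<gamma>) \<in> U"
  proof (cases "composable ?\<alpha> \<beta>")
    case True
    then have "om (bas (pcomp ?\<alpha> \<beta>)) (bas ?\<gamma>) \<in> U"
      using Cons.prems c d(3)
      by (intro Cons.IH pcomp_paths d) (auto simp: composable_pcomp_right)
    then show ?thesis using True by simp
  qed (use om_zero(1)[OF cl(2)] is_subspace_zero[OF U] in simp)
  moreover have "om (bas \<beta>) (bas (u, a # p)) =
      om (if composable \<beta> ?\<gamma> then bas (pcomp \<beta> ?\<gamma>) else \<zero>) (bas ?\<alpha>) \<oplus>\<^bsub>Om\<^esub>
      om (if composable ?\<alpha> \<beta> then bas (pcomp ?\<alpha> \<beta>) else \<zero>) (bas ?\<gamma>)"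
    using om_bas_Leibniz[OF Cons.prems(1) d(2,1)] d(3) by (simp add: d(4)[symmetric])
  ultimately show ?case using is_subspace_add[OF U] by simp
qed

abbreviation "noncycles \<equiv> B - cycles G"

text \<open>Cycles are left out because \<beta> de vanishes when \<beta> is a cycle at e.\<close>

definition vertex_forms where "vertex_forms = linear_extension Om (\<lambda>\<beta>. om (bas \<beta>) (bas (psource \<beta>, [])))"

lemma om_noncycle_closed: "\<beta> \<in> noncycles \<Longrightarrow> om (bas \<beta>) (bas (psource \<beta>, [])) \<in> carrier Om"
  using B_paths psource_in_verts by (intro om_bas_closed) auto

lemma lin_vertex_forms: "lin (free_space noncycles) Om vertex_forms"
  unfolding vertex_forms_def by (rule lin_linear_extension[OF K.kspace_Om om_noncycle_closed])

lemma vertex_forms_single: "\<beta> \<in> noncycles \<Longrightarrow> vertex_forms (single \<beta>) = om (bas \<beta>) (bas (psource \<beta>, []))"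
  unfolding vertex_forms_def by (rule linear_extension_single[OF K.kspace_Om om_noncycle_closed])

text \<open>Only spanning is shown here. The two parts are told apart later by the commutator map,
  whose values on them are supported on cycles and on noncycles respectively.\<close>

lemma Om_decompose:
  assumes v: "v \<in> carrier Om"
  obtains y n where "y \<in> carrier (free_space P)" "n \<in> carrier (free_space noncycles)" "v = arrow_forms y \<oplus>\<^bsub>Om\<^esub> vertex_forms n"
proof -
  define S where "S = {arrow_forms y \<oplus>\<^bsub>Om\<^esub> vertex_forms n | y n. y \<in> carrier (free_space P) \<and> n \<in> carrier (free_space noncycles)}"
  let ?U = "vertex_forms ` carrier (free_space noncycles)"
  have S: "is_subspace Om S"
    unfolding S_def by (rule is_subspace_sum_images[OF kspace_free_space kspace_free_space K.kspace_Om lin_arrow_forms lin_vertex_forms])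
  have U: "is_subspace Om ?U"
    by (rule is_subspace_im[OF kspace_free_space K.kspace_Om lin_vertex_forms])
  have arrow_formsS: "arrow_forms y \<in> S" if "y \<in> carrier (free_space P)" for y
  proof -
    have "arrow_forms y = arrow_forms y \<oplus>\<^bsub>Om\<^esub> vertex_forms \<zero>\<^bsub>free_space noncycles\<^esub>"
      using lin_zero[OF lin_vertex_forms kspace_free_space K.kspace_Om] lin_closed[OF lin_arrow_forms that] by simp
    then show ?thesis using that kspace_zero[OF kspace_free_space] unfolding S_def by blast
  qed
  have vertex_formsS: "vertex_forms n \<in> S" if "n \<in> carrier (free_space noncycles)" for n
  proof -
    have "vertex_forms n = arrow_forms \<zero>\<^bsub>free_space P\<^esub> \<oplus>\<^bsub>Om\<^esub> vertex_forms n"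
      using lin_zero[OF lin_arrow_forms kspace_free_space K.kspace_Om] lin_closed[OF lin_vertex_forms that] by simp
    then show ?thesis using that kspace_zero[OF kspace_free_space] unfolding S_def by blast
  qed
  have gen: "om (bas \<beta>) (bas (psource \<beta>, [])) \<in> ?U" if "\<beta> \<in> B" "psource \<beta> \<noteq> ptarget G \<beta>" for \<beta>
    using that vertex_forms_single[of \<beta>] by (auto simp: cycles_def intro!: image_eqI[of _ _ "single \<beta>"])
  have 1: "om (bas \<beta>) (bas \<gamma>) \<in> S" if "\<beta> \<in> B" "\<gamma> \<in> B" for \<beta> \<gamma>
  proof (cases "composable \<beta> \<gamma> \<and> composable \<gamma> \<beta>")
    case True
    then have "om (bas \<beta>) (bas \<gamma>) = arrow_forms (bracket \<beta> \<gamma>)"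
      using om_bas_cyclic[of \<beta> "fst \<gamma>" "snd \<gamma>"] that B_paths by simp
    then show ?thesis using arrow_formsS[OF bracket_carrier[OF B_paths[OF that(1)] B_paths[OF that(2)]]] by simp
  next
    case False
    then have "om (bas \<beta>) (bas \<gamma>) \<in> ?U"
      using om_bas_noncyclic[OF U gen, of \<beta> "fst \<gamma>" "snd \<gamma>"] that B_paths by simp
    then obtain n where "n \<in> carrier (free_space noncycles)" "om (bas \<beta>) (bas \<gamma>) = vertex_forms n" by blast
    then show ?thesis using vertex_formsS by simp
  qed
  have 2: "om (bas \<beta>) a \<in> S" if \<beta>: "\<beta> \<in> B" and a: "a \<in> carrier A" for \<beta> a
    using a
  proof (induction rule: A_induct[OF A, consumes 1, case_names bas add smult zero])
    case bas
    then show ?case by (rule 1[OF \<beta>])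
  next
    case add
    then show ?case
      using is_subspace_add[OF S] lin_add[OF K.lin_om_right[OF bas_closed[OF A B_paths[OF \<beta>]]]] by simp
  next
    case smult
    then show ?case
      using is_subspace_smult[OF S] lin_smult[OF K.lin_om_right[OF bas_closed[OF A B_paths[OF \<beta>]]]] by simp
  next
    case zero
    show ?case using om_zero(2)[OF bas_closed[OF A B_paths[OF \<beta>]]] is_subspace_zero[OF S] by simp
  qed
  have 3: "om x a \<in> S" if a: "a \<in> carrier A" and x: "x \<in> carrier A" for x a
    using x
  proof (induction rule: A_induct[OF A, consumes 1, case_names bas add smult zero])
    case bas
    then show ?case by (rule 2[OF _ a])
  next
    case add
    then show ?case using is_subspace_add[OF S] lin_add[OF K.lin_om_left[OF a]] by simp
  next
    case smult
    then show ?case using is_subspace_smult[OF S] lin_smult[OF K.lin_om_left[OF a]] by simp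
  next
    case zero
    show ?case using om_zero(1)[OF a] is_subspace_zero[OF S] by simp
  qed
  have "v \<in> S" using v
  proof (induction rule: K.Om_induct)
    case om
    then show ?case by (intro 3)
  next
    case add
    then show ?case by (intro is_subspace_add[OF S])
  next
    case smult
    then show ?case by (intro is_subspace_smult[OF S])
  next
    case zero
    show ?case by (rule is_subspace_zero[OF S])
  qed
  then show ?thesis using that unfolding S_def by blast
qed

lemma efficient_circuits_P: "C \<in> efficient_circuits \<Longrightarrow> \<exists>x \<in> P. pair_circuit x = C"
  using efficient_iff by (auto simp: efficient_circuits_def)

lemma finite_efficient_circuits: "finite efficient_circuits"
proof (rule finite_subset)
  show "efficient_circuits \<subseteq> pair_circuit ` P" using efficient_circuits_P by blast
qed (simp add: finite_P[OF finB])

lemma pair_circuit_in_circuits: "x \<in> P \<Longrightarrow> pair_circuit x \<in> circuits G"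
  unfolding pair_circuit_def by (rule circuit_in_circuits[OF P_cycle])

lemma lin_spread: "lin (free_space efficient_circuits) (free_space P) (spread :: _ \<Rightarrow> _ \<Rightarrow> 'k)"
  by (rule linI)
    (auto simp: spread_def fun_eq_iff intro!: free_space_carrierI[OF finite_P[OF finB]])

lemma spread_image: "(spread ` carrier (free_space efficient_circuits) :: (_ \<Rightarrow> 'k) set) = relation_space"
proof (intro subset_antisym subsetI)
  fix y :: "_ \<Rightarrow> 'k" assume "y \<in> spread ` carrier (free_space efficient_circuits)"
  then obtain h where h: "h \<in> carrier (free_space efficient_circuits)" "y = spread h" by blast
  show "y \<in> relation_space"
  proof (rule relation_spaceI)
    show "y \<in> carrier (free_space P)" unfolding h(2) by (rule lin_closed[OF lin_spread h(1)])
    show "y x = 0" if "x \<in> P" "\<not> efficient G Z (pair_circuit x)" for x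
      using h that by (auto simp: spread_def free_space_carrier efficient_circuits_def)
  qed (simp add: h(2) spread_def)
next
  fix y :: "_ \<Rightarrow> 'k" assume y: "y \<in> relation_space"
  \<comment> \<open>\<open>y\<close> is constant on the pairs of a circuit, so any pair gives its
    value; the default 0 confines the support of \<open>h\<close> to the efficient circuits.\<close>
  define h where "h C = (if C \<in> efficient_circuits then y (SOME x. x \<in> P \<and> pair_circuit x = C) else 0)" for C
  have "h \<in> carrier (free_space efficient_circuits)"
    by (rule free_space_carrierI[OF finite_efficient_circuits]) (auto simp: h_def)
  moreover have "spread h x = y x" for x
  proof (cases "x \<in> P")
    case True
    let ?x = "SOME x'. x' \<in> P \<and> pair_circuit x' = pair_circuit x"
    have "?x \<in> P \<and> pair_circuit ?x = pair_circuit x" 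
      by (rule someI[of "\<lambda>x'. x' \<in> P \<and> pair_circuit x' = pair_circuit x" x]) (simp add: True)
    then have "y ?x = y x" using relation_spaceD(2)[OF y, of ?x x] True by blast
    then show ?thesis
      using True relation_spaceD(3)[OF y True] pair_circuit_in_circuits[OF True]
      by (auto simp: spread_def h_def efficient_circuits_def)
  next
    case False
    then show ?thesis using relation_spaceD(1)[OF y] by (auto simp: spread_def free_space_carrier)
  qed
  ultimately show "y \<in> spread ` carrier (free_space efficient_circuits)"
    by (intro image_eqI[of _ _ h]) auto
qed

text \<open>An efficient circuit is useful, so some pair in \<open>P\<close> displays the value of
  \<open>h\<close> at it.\<close>

lemma spread_inj:
  assumes h: "h \<in> carrier (free_space efficient_circuits)" and 0: "spread h = (\<lambda>x. 0 :: 'k)"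
  shows "h = (\<lambda>C. 0)"
proof
  fix C
  show "h C = 0"
  proof (cases "C \<in> efficient_circuits")
    case True
    then obtain x where "x \<in> P" "pair_circuit x = C" using efficient_circuits_P by blast
    then show ?thesis using fun_cong[OF 0, of x] by (simp add: spread_def)
  next
    case False
    then show ?thesis using h by (auto simp: free_space_carrier)
  qed
qed

text \<open>This is where characteristic zero enters: for a relation \<open>\<zeta>\<close> the identity \<open>\<beta> d\<zeta> = 0\<close> only says
  that a positive multiple of the indicator function of the circuit dies.\<close>

lemma arrow_forms_spread_single:
  assumes C: "C \<in> efficient_circuits"
  shows "arrow_forms (spread (single C)) = \<zero>\<^bsub>Om\<^esub>"
proof -
  have Cc: "C \<in> circuits G" using C by (simp add: efficient_circuits_def)
  obtain \<zeta> \<beta> where z: "\<zeta> \<in> Z" and b: "\<beta> \<in> B" and c: "composable \<zeta> \<beta>" "composable \<beta> \<zeta>" "pcomp \<zeta> \<beta> \<in> C"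
    using C efficient_iff[OF Cc] by (auto simp: efficient_circuits_def odot_at_def odot_def composable_def)
  note p = Z_paths[OF z] B_paths[OF b]
  have ne: "snd \<zeta> \<noteq> []" using Z_length[OF z] by auto
  let ?w = "snd \<zeta> @ snd \<beta>"
  have w: "cyclic_word ?w" using ne by (intro cyclic_word_pcomp(1) p c) simp
  \<comment> \<open>In \<open>?w\<close> the relation is traversed first, in
    \<open>pcomp \<zeta> \<beta>\<close> last; the two cycles are rotations of each other and hence
    in the same circuit.\<close>
  have "circuit (word_path ?w) = circuit (word_path (rotate (length (snd \<zeta>)) ?w))"
    by (rule circuit_rotate[OF w, symmetric])
  also have "rotate (length (snd \<zeta>)) ?w = snd \<beta> @ snd \<zeta>" by (rule rotate_append)
  also have "word_path (snd \<beta> @ snd \<zeta>) = pcomp \<zeta> \<beta>" using ne by (intro cyclic_word_pcomp(2) p c) simp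
  finally have circ: "circuit (word_path ?w) = C" using circuit_eqI[OF Cc c(3)] by simp
  let ?m = "of_nat (period_count ?w) :: 'k"
  have m: "?m \<noteq> 0" using period_count_pos[of ?w] ne by simp
  have "cyclic_sum ?w x = ?m * spread (single C) x" for x
  proof (cases "x \<in> P \<and> pair_circuit x = C")
    case True
    then show ?thesis using cyclic_sum_eq[OF w, of x, where 'k = 'k] circ by (simp add: spread_def single_apply)
  next
    case False
    then show ?thesis
      using cyclic_sum_support[OF w, of x, where 'k = 'k] circ by (auto simp: spread_def single_apply)
  qed
  then have eq: "bracket \<beta> \<zeta> = ?m \<odot>\<^bsub>free_space P\<^esub> spread (single C)"
    using c partial_sum_outside[OF not_basis_word_Z[OF z], of "snd \<beta>", where 'k = 'k] by (simp add: bracket_def fun_eq_iff)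
  have sc: "spread (single C) \<in> carrier (free_space P :: ('k, _) module)"
    using C by (intro lin_closed[OF lin_spread]) simp
  have "?m \<odot>\<^bsub>Om\<^esub> arrow_forms (spread (single C)) = arrow_forms (bracket \<beta> \<zeta>)"
    unfolding eq by (rule lin_smult[OF lin_arrow_forms sc, symmetric])
  also have "\<dots> = om (bas \<beta>) (bas \<zeta>)"
    using om_bas_cyclic[of \<beta> "fst \<zeta>" "snd \<zeta>"] p c by simp
  also have "\<dots> = \<zero>\<^bsub>Om\<^esub>"
    using bas_zero[OF A p(1) Z_notin_B[OF z]] om_zero(2)[OF bas_closed[OF A p(2)]] by simp
  finally have "inverse ?m \<odot>\<^bsub>Om\<^esub> (?m \<odot>\<^bsub>Om\<^esub> arrow_forms (spread (single C))) = \<zero>\<^bsub>Om\<^esub>"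
    using kspace_smult_zero(2)[OF K.kspace_Om] by simp
  then show ?thesis
    using m lin_closed[OF lin_arrow_forms sc] K.kspace_Om by (simp add: kspace_smult_smult)
qed

text \<open>One inclusion comes from a map out of \<open>Om\<close> that recovers coefficients
  modulo \<open>relation_space\<close>, so that no further relation can hold. For the other,
  \<open>relation_space\<close> is the image of \<open>spread\<close>, and the indicator of each
  efficient circuit is killed.\<close>

lemma kernel_arrow_forms: "{y \<in> carrier (free_space P). arrow_forms y = \<zero>\<^bsub>Om\<^esub>} = relation_space"
proof (intro subset_antisym subsetI)
  fix y assume "y \<in> {y \<in> carrier (free_space P). arrow_forms y = \<zero>\<^bsub>Om\<^esub>}"
  then have y: "y \<in> carrier (free_space P)" "arrow_forms y = \<zero>\<^bsub>Om\<^esub>" by simp_all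
  obtain F where F: "lin Om reduced_space F" "\<And>x a. x \<in> carrier A \<Longrightarrow> a \<in> carrier A \<Longrightarrow> F (om x a) = red (bracket_map x a)"
  proof -
    show thesis
      by (rule K.Om_map[where \<phi> = "\<lambda>x a. red (bracket_map x a)", OF kspace_reduced_space lin_comp[OF lin_bracket_map_left[OF A finB] lin_red]
            lin_comp[OF lin_bracket_map_right[OF A finB] lin_red] bracket_map_Leibniz[OF A finB]])
        (assumption | rule that)+
  qed
  have "F (arrow_forms y) = red y"
  proof (rule lin_free_space_eq[OF kspace_reduced_space lin_comp[OF lin_arrow_forms F(1)] lin_red _ y(1)])
    fix x assume x: "x \<in> P"
    have "bracket_map (bas (snd x)) (bas (fst x)) = (single x :: _ \<Rightarrow> 'k)"
      using bracket_map_bas[OF A finB B_paths[OF P_D(2)[OF x]] P_D(1)[OF x]] short_in_B[OF P_D(1)[OF x]] P_D(5)[OF x] bracket_P[OF x, where 'k = 'k]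
      by simp
    then show "F (arrow_forms (single x)) = red (single x)"
      using F(2)[OF bas_closed[OF A B_paths[OF P_D(2)[OF x]]] bas_closed[OF A P_D(1)[OF x]]] arrow_forms_single[OF x] by simp
  qed
  then have "red y = \<zero>\<^bsub>reduced_space\<^esub>" using y(2) lin_zero[OF F(1) K.kspace_Om kspace_reduced_space] by simp
  then show "y \<in> relation_space" using red_zero_iff[OF y(1)] by simp
next
  fix y :: "_ \<Rightarrow> 'k" assume y: "y \<in> relation_space"
  then obtain h where h: "h \<in> carrier (free_space efficient_circuits)" "y = spread h"
    unfolding spread_image[symmetric] by blast
  have "arrow_forms (spread h) = \<zero>\<^bsub>Om\<^esub>"
    by (rule lin_free_space_eq[OF K.kspace_Om lin_comp[OF lin_spread lin_arrow_forms] lin_const_zero[OF K.kspace_Om]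
          arrow_forms_spread_single h(1)])
  then show "y \<in> {y \<in> carrier (free_space P). arrow_forms y = \<zero>\<^bsub>Om\<^esub>}"
    using h relation_spaceD(1)[OF y] by simp
qed

lemma coord_bas_proj: "\<gamma> \<in> paths G \<Longrightarrow> coord (bas \<gamma>) = (proj \<gamma> :: _ \<Rightarrow> 'k)"
  using coord_bas[OF A] bas_zero[OF A] lin_zero[OF lin_coord[OF A] K.kspace kspace_free_space]
  by (simp add: proj_def)

text \<open>Rank-nullity is applied to \<open>arrow_forms\<close>, to \<open>spread\<close> and to
  the commutator map on the image of \<open>arrow_forms\<close>; the rank of the last is that of
  \<open>boundary_map\<close>. The additive form keeps the count within the natural numbers.\<close>

lemma dim_HH1:
  "vectorspace.dim class_ring (HH1 A) + card basis_cycles + card efficient_circuits = card P + card strong_circuits"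
proof -
  obtain \<delta> where \<delta>: "lin Om A \<delta>"
    and \<delta>_om: "\<And>x a. x \<in> carrier A \<Longrightarrow> a \<in> carrier A \<Longrightarrow> \<delta> (om x a) = x \<otimes> a \<ominus> a \<otimes> x"
    and HH1: "HH1 A = Om\<lparr>carrier := {v \<in> carrier Om. \<delta> v = \<zero>}\<rparr>"
  proof -
    show thesis by (rule K.HH1_eq) (rule that)
  qed
  let ?VB = "free_space B :: ('k, _) module"
  define d where "d v = coord (\<delta> v)" for v
  have d: "lin Om ?VB d" unfolding d_def by (rule lin_comp[OF \<delta> lin_coord[OF A]])
  have d_zero: "d v = \<zero>\<^bsub>?VB\<^esub> \<longleftrightarrow> \<delta> v = \<zero>" if "v \<in> carrier Om" for v
    using coord_eq_zero[OF A lin_closed[OF \<delta> that]] lin_zero[OF lin_coord[OF A] K.kspace kspace_free_space]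
    by (auto simp: d_def)
  have d_om: "d (om (bas \<beta>) (bas \<gamma>)) = (\<lambda>c. coord (bas \<beta> \<otimes> bas \<gamma>) c - coord (bas \<gamma> \<otimes> bas \<beta>) c)"
    if "\<beta> \<in> paths G" "\<gamma> \<in> paths G" for \<beta> \<gamma>
  proof -
    note cl = K.m_closed[OF bas_closed[OF A that(1)] bas_closed[OF A that(2)]]
      K.m_closed[OF bas_closed[OF A that(2)] bas_closed[OF A that(1)]]
    have "d (om (bas \<beta>) (bas \<gamma>)) = coord (bas \<beta> \<otimes> bas \<gamma>) \<ominus>\<^bsub>?VB\<^esub> coord (bas \<gamma> \<otimes> bas \<beta>)"
      unfolding d_def \<delta>_om[OF bas_closed[OF A that(1)] bas_closed[OF A that(2)]]
      by (rule lin_minus[OF lin_coord[OF A] K.kspace kspace_free_space cl])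
    then show ?thesis
      using free_space_minus[OF lin_closed[OF lin_coord[OF A] cl(1)] lin_closed[OF lin_coord[OF A] cl(2)]] by simp
  qed
  have darrow_forms: "d (arrow_forms y) = boundary_map y" if "y \<in> carrier (free_space P)" for y
  proof (rule lin_free_space_eq[OF kspace_free_space lin_comp[OF lin_arrow_forms d] lin_free_space_mono[OF lin_boundary_map] _ that])
    show "basis_cycles \<subseteq> B" by (simp add: basis_cycles_def)
    fix x assume x: "x \<in> P"
    note p = P_D(1)[OF x] B_paths[OF P_D(2)[OF x]]
    show "d (arrow_forms (single x)) = boundary_map (single x)"
      using P_D(3,4)[OF x] p
      by (simp add: arrow_forms_single[OF x] boundary_map_single[OF x] d_om bas_mult[OF A] coord_bas_proj pcomp_paths)
  qed
  \<comment> \<open>With e the source of a noncycle \<beta>, the product \<beta>e is \<beta> while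
    e\<beta> is zero, so the commutator returns \<beta> itself.\<close>
  have dvertex_forms: "d (vertex_forms n) = n" if "n \<in> carrier (free_space noncycles)" for n
  proof (rule lin_free_space_eq[OF kspace_free_space lin_comp[OF lin_vertex_forms d] _ _ that])
    have "lin (free_space noncycles) (free_space noncycles) (\<lambda>n :: _ \<Rightarrow> 'k. n)" by (rule linI) auto
    then show "lin (free_space noncycles) ?VB (\<lambda>n. n)" by (rule lin_free_space_mono) auto
    fix \<beta> assume \<beta>: "\<beta> \<in> noncycles"
    then have p: "\<beta> \<in> paths G" "(psource \<beta>, []) \<in> paths G" using B_paths psource_in_verts by auto
    have "psource \<beta> \<noteq> ptarget G \<beta>" using \<beta> p(1) by (simp add: cycles_def)
    then have "bas (psource \<beta>, []) \<otimes> bas \<beta> = \<zero>" "bas \<beta> \<otimes> bas (psource \<beta>, []) = bas \<beta>"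
      using p by (simp_all add: bas_mult[OF A] composable_vertex pcomp_vertex)
    then show "d (vertex_forms (single \<beta>)) = single \<beta>"
      using \<beta> lin_zero[OF lin_coord[OF A] K.kspace kspace_free_space]
      by (simp add: vertex_forms_single[OF \<beta>] d_om[OF p] coord_bas[OF A])
  qed
  let ?im = "arrow_forms ` carrier (free_space P)"
  \<comment> \<open>Commutators of arrow forms are supported on cycles, whereas the vertex part is
    returned unchanged on noncycles. An element of the kernel therefore has no vertex part.\<close>
  have kernel: "{v \<in> ?im. d v = \<zero>\<^bsub>?VB\<^esub>} = {v \<in> carrier Om. \<delta> v = \<zero>}"
  proof (intro subset_antisym subsetI)
    fix v assume "v \<in> {v \<in> ?im. d v = \<zero>\<^bsub>?VB\<^esub>}"
    then show "v \<in> {v \<in> carrier Om. \<delta> v = \<zero>}" using d_zero lin_closed[OF lin_arrow_forms] by blast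
  next
    fix v assume "v \<in> {v \<in> carrier Om. \<delta> v = \<zero>}"
    then have v: "v \<in> carrier Om" "d v = \<zero>\<^bsub>?VB\<^esub>" using d_zero by auto
    obtain y n where yn: "y \<in> carrier (free_space P)" "n \<in> carrier (free_space noncycles)" "v = arrow_forms y \<oplus>\<^bsub>Om\<^esub> vertex_forms n"
      by (rule Om_decompose[OF v(1)])
    have "d v = (\<lambda>c. boundary_map y c + n c)"
      unfolding yn(3) using lin_add[OF d lin_closed[OF lin_arrow_forms yn(1)] lin_closed[OF lin_vertex_forms yn(2)]] darrow_forms[OF yn(1)] dvertex_forms[OF yn(2)]
      by simp
    then have sum0: "boundary_map y c + n c = 0" for c using v(2) by (metis free_space_simps(1))
    have "n c = 0" for c
    proof (cases "c \<in> cycles G")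
      case True
      then show ?thesis using yn(2) by (auto simp: free_space_carrier)
    next
      case False
      then have "boundary_map y c = 0"
        using lin_closed[OF lin_boundary_map yn(1)] by (auto simp: free_space_carrier basis_cycles_def)
      then show ?thesis using sum0[of c] by simp
    qed
    then have "n = \<zero>\<^bsub>free_space noncycles\<^esub>" by auto
    then have "vertex_forms n = \<zero>\<^bsub>Om\<^esub>" using lin_zero[OF lin_vertex_forms kspace_free_space K.kspace_Om] by simp
    then have "v = arrow_forms y" using yn lin_closed[OF lin_arrow_forms yn(1)] by simp
    then show "v \<in> {v \<in> ?im. d v = \<zero>\<^bsub>?VB\<^esub>}" using yn(1) v(2) by blast
  qed
  note fdP = fin_dim_free_space[OF finite_P[OF finB], where 'k = 'k]
  \<comment> \<open>Rank-nullity is applied on this subspace, which is finite-dimensional as the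
    image of the free space on the finite set \<open>P\<close>.\<close>
  let ?I = "Om\<lparr>carrier := ?im\<rparr>"
  have kI: "kspace ?I"
    by (rule kspace_restrict[OF K.kspace_Om is_subspace_im[OF kspace_free_space K.kspace_Om lin_arrow_forms]])
  have dI: "lin ?I ?VB d"
    by (rule linI) (use lin_closed[OF lin_arrow_forms] in \<open>auto simp: lin_closed[OF d] lin_add[OF d] lin_smult[OF d]\<close>)
  have "card P = vectorspace.dim class_ring ?I +
      vectorspace.dim class_ring (free_space P\<lparr>carrier := relation_space\<rparr> :: ('k, _) module)"
    using rank_nullity_kspace[OF kspace_free_space K.kspace_Om lin_arrow_forms fdP] dim_free_space[OF finite_P[OF finB], where 'k = 'k]
    by (simp add: kernel_arrow_forms)
  moreover have "card efficient_circuits =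
      vectorspace.dim class_ring (free_space P\<lparr>carrier := relation_space\<rparr> :: ('k, _) module)"
  proof -
    have "{h \<in> carrier (free_space efficient_circuits). spread h = \<zero>\<^bsub>free_space P\<^esub>} =
        {\<zero>\<^bsub>free_space efficient_circuits\<^esub> :: _ \<Rightarrow> 'k}"
      using spread_inj kspace_zero[OF kspace_free_space, of efficient_circuits] by (auto simp: spread_def)
    then show ?thesis
      using rank_nullity_kspace[OF kspace_free_space kspace_free_space lin_spread
          fin_dim_free_space[OF finite_efficient_circuits]]
        dim_free_space[OF finite_efficient_circuits, where 'k = 'k]
        dim_zero_space[OF kspace_free_space, of efficient_circuits, where ?'a = 'k]
      by (simp only: spread_image)
  qed
  moreover have "vectorspace.dim class_ring ?I = vectorspace.dim class_ring
        (free_space basis_cycles\<lparr>carrier := boundary_map ` carrier (free_space P :: ('k, _) module)\<rparr>) +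
      vectorspace.dim class_ring (HH1 A)"
  proof -
    have "d ` ?im = boundary_map ` carrier (free_space P)"
      unfolding image_image using darrow_forms by (rule image_cong[OF refl])
    \<comment> \<open>Free spaces on different sets differ only in their carriers, so the image may
      be measured inside the basis cycles instead of \<open>B\<close>.\<close>
    moreover have "?VB\<lparr>carrier := X\<rparr> = free_space basis_cycles\<lparr>carrier := X\<rparr>" for X by (simp add: free_space_def)
    ultimately show ?thesis
      using rank_nullity_kspace[OF kI kspace_free_space dI fin_dim_image[OF kspace_free_space K.kspace_Om lin_arrow_forms fdP]]
      by (simp add: kernel[simplified] HH1)
  qed
  ultimately show ?thesis using dim_image_boundary_map[OF finB, where 'k = 'k] by simp
qed

end

end

theorem corollary2p19:
  fixes Q :: "('v, 'a) pre_digraph"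
    and Z :: "('v, 'a) path set"
    and A :: "('k::field_char_0, (('v, 'a) path \<Rightarrow> 'k) set) module"
  assumes "fin_digraph Q"
    and "Digraph_Component.connected Q"
    and "monomial_relations Q Z"
    and "A = monomial_algebra Q Z"
    and "vectorspace.fin_dim class_ring A"
  shows "int (vectorspace.dim class_ring (HH1 A)) =
      int (card (odot Q (arrow_paths Q) (basis_paths Q Z)))
    - int (card (odot Q (vertex_paths Q) (basis_paths Q Z)))
    + int (card (verts Q))
    - int (card {C \<in> circuits Q. efficient Q Z C})
    + int (card {C \<in> circuits Q. \<not> trivial_circuit Q C \<and> strong Q Z C})"
proof -
  interpret monomial_quiver Q Z
    using assms(1,3) by (simp add: monomial_quiver_def monomial_quiver_axioms_def)
  have fin: "finite B" by (rule finite_B[OF assms(4,5)])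
  show ?thesis
    using dim_HH1[OF assms(4) fin] card_odot_vertices card_strong_circuits[OF finite_strong_circuits[OF fin]]
    by (simp add: P_def efficient_circuits_def)
qed

end
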